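(* For every $\delta>0$, $$\lim_{N\to\infty}\mathbb E_\mu\big(\|b_N(\omega)-b(\omega)\|_{H^{-2-\delta}(\mathbb T^2)}^2\big)=0.$$ In particular, $b\in L^2(H^{-1-},\mu;H^{-2-\delta}(\mathbb T^2))$.
   Context: **Basic notation.** - $\mathbb T^2=\mathbb R^2/\mathbb Z^2$ and $\mathbb Z^2_0=\mathbb Z^2\setminus\{0\}$. - $\mathbb Z^2_+=\{k:k_1>0\text{ or }(k_1=0,k_2>0)\}$ and $\mathbb Z^2_-=-\mathbb Z^2_+$. - $e_k=\sqrt2\cos(2\pi k\cdot x)$ for $k\in\mathbb Z^2_+$, and $e_k=\sqrt2\sin(2\pi k\cdot x)$ for $k\in\mathbb Z^2_-$. - $\tilde e_k(x)=e^{2\pi ik\cdot x}$, and $\langle\omega,\tilde e_k\rangle$ denotes $\omega$ applied to $\overline{\tilde e_k}$. - $k^\perp=(k_2,-k_1)$. - $\Lambda_N=\{k\in\mathbb Z^2_0:|k|\le N\}$, $\Pi_N\omega=\omega_N=\sum_{k\in\Lambda_N}\langle\omega,\tilde e_k\rangle\tilde e_k$. - For a mean-zero distribution $g$, $\|g\|^2_{H^{-2-\delta}}=\sum_{j\in\mathbb Z^2_0}|j|^{-4-2\delta}\langle g,e_j\rangle^2$. - $\mu$ is the white noise measure on $H^{-1-}=\bigcap_{s>0}H^{-1-s}(\mathbb T^2)$. **Nonlinear term.** Let $K(x)=-2\pi\sum_{k\in\mathbb Z^2_0}\frac{k^\perp}{|k|^2}\sin(2\pi k\cdot x)$ and $H_\phi(x,y)=\tfrac12K(x-y)\cdot(\nabla\phi(x)-\nabla\phi(y))$,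 with $H_\phi(x,x)=0$. Under $\mu$, $\langle\omega\otimes\omega,H_\phi\rangle$ is the $L^2(\mu)$-limit of $\langle\omega\otimes\omega,h_n\rangle$ along smooth symmetric $h_n$ with $\int h_n(x,x)dx=0$ and $h_n\to H_\phi$ in $L^2$. **The maps $b$ and $b_N$.** - $b(\omega)$ is the random distribution defined by $\langle b(\omega),e_j\rangle=-\langle\omega\otimes\omega,H_{e_j}\rangle$ for $j\in\mathbb Z^2_0$; formally $b(\omega)=u(\omega)\cdot\nabla\omega$. - $b_N(\omega)=\Pi_N\big[u(\omega_N)\cdot\nabla\omega_N\big]$, where $u(\omega_N)=K*\omega_N$. Equivalently, $\langle b_N(\omega),e_j\rangle=-\mathbf 1_{\Lambda_N}(j)\int\!\!\int H_{e_j}(x,y)\omega_N(x)\omega_N(y)\,dx\,dy$. *)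

theory Defs
  imports "HOL-Probability.Probability"
begin

definition Z2_0 :: "(int \<times> int) set" where
  "Z2_0 = UNIV - {(0, 0)}"

definition Z2_plus :: "(int \<times> int) set" where
  "Z2_plus = {k. fst k > 0 \<or> (fst k = 0 \<and> snd k > 0)}"

definition knorm2 :: "int \<times> int \<Rightarrow> real" where
  "knorm2 k = real_of_int (fst k)^2 + real_of_int (snd k)^2"

definition Lambda :: "nat \<Rightarrow> (int \<times> int) set" where
  "Lambda N = {k \<in> Z2_0. knorm2 k \<le> (real N)^2}"

definition kdot :: "int \<times> int \<Rightarrow> real \<times> real \<Rightarrow> real" where
  "kdot k x = real_of_int (fst k) * fst x + real_of_int (snd k) * snd x"

definition ebasis :: "int \<times> int \<Rightarrow> real \<times> real \<Rightarrow> real" where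
  "ebasis k x = (if k \<in> Z2_plus then sqrt 2 * cos (2 * pi * kdot k x)
                 else sqrt 2 * sin (2 * pi * kdot k x))"

text \<open>The torus T^2 = R^2/Z^2 is represented by the fundamental domain [0,1]^2
  with Lebesgue measure.\<close>
definition T2 :: "(real \<times> real) set" where
  "T2 = {0..1} \<times> {0..1}"

coinductive smooth_fun :: "('a::real_normed_vector \<Rightarrow> real) \<Rightarrow> bool" where
  "(\<forall>x. f differentiable (at x)) \<Longrightarrow>
   (\<forall>v. smooth_fun (\<lambda>x. frechet_derivative f (at x) v)) \<Longrightarrow> smooth_fun f"

definition grad :: "(real \<times> real \<Rightarrow> real) \<Rightarrow> real \<times> real \<Rightarrow> real \<times> real" where
  "grad \<phi> x = (frechet_derivative \<phi> (at x) (1, 0), frechet_derivative \<phi> (at x) (0, 1))"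

definition kperp :: "int \<times> int \<Rightarrow> real \<times> real" where
  "kperp k = (real_of_int (snd k), - real_of_int (fst k))"

definition K_partial :: "nat \<Rightarrow> real \<times> real \<Rightarrow> real \<times> real" where
  "K_partial M x = (\<Sum>k \<in> {k \<in> Z2_0. \<bar>fst k\<bar> \<le> int M \<and> \<bar>snd k\<bar> \<le> int M}.
      (- 2 * pi * sin (2 * pi * kdot k x) / knorm2 k) *\<^sub>R kperp k)"

definition Kker :: "real \<times> real \<Rightarrow> real \<times> real" where
  "Kker x = (if convergent (\<lambda>M. K_partial M x) then lim (\<lambda>M. K_partial M x) else 0)"

definition Hphi :: "(real \<times> real \<Rightarrow> real) \<Rightarrow> real \<times> real \<Rightarrow> real \<times> real \<Rightarrow> real" where
  "Hphi \<phi> x y = (if x = y then 0 else (1/2) * (Kker (x - y) \<bullet> (grad \<phi> x - grad \<phi> y)))"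

text \<open>Under the white noise measure mu, the coordinates xi_k = <omega, e_k>, k in Z2_0,
  are i.i.d. standard Gaussians and omega = sum_k xi_k e_k. We model mu as this product law.\<close>
definition mu :: "((int \<times> int) \<Rightarrow> real) measure" where
  "mu = PiM Z2_0 (\<lambda>_. density lborel std_normal_density)"

definition omegaN :: "nat \<Rightarrow> ((int \<times> int) \<Rightarrow> real) \<Rightarrow> real \<times> real \<Rightarrow> real" where
  "omegaN N \<xi> x = (\<Sum>k \<in> Lambda N. \<xi> k * ebasis k x)"

definition pair_quad :: "nat \<Rightarrow> ((int \<times> int) \<Rightarrow> real) \<Rightarrow> (real \<times> real \<Rightarrow> real \<times> real \<Rightarrow> real) \<Rightarrow> real" where
  "pair_quad N \<xi> h = (\<integral>p \<in> T2 \<times> T2. h (fst p) (snd p) * omegaN N \<xi> (fst p) * omegaN N \<xi> (snd p) \<partial>lborel)"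

text \<open>For smooth h: <omega (x) omega, h> = lim_M <omega_M (x) omega_M, h>.\<close>
definition pair_smooth :: "((int \<times> int) \<Rightarrow> real) \<Rightarrow> (real \<times> real \<Rightarrow> real \<times> real \<Rightarrow> real) \<Rightarrow> real" where
  "pair_smooth \<xi> h = (if convergent (\<lambda>M. pair_quad M \<xi> h) then lim (\<lambda>M. pair_quad M \<xi> h) else 0)"

definition admissible :: "(real \<times> real \<Rightarrow> real \<times> real \<Rightarrow> real) \<Rightarrow> bool" where
  "admissible h \<longleftrightarrow>
     smooth_fun (\<lambda>p::(real \<times> real) \<times> (real \<times> real). h (fst p) (snd p)) \<and>
     (\<forall>x y (a::int \<times> int) (b::int \<times> int).
        h (fst x + of_int (fst a), snd x + of_int (snd a)) (fst y + of_int (fst b), snd y + of_int (snd b)) = h x y) \<and>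
     (\<forall>x y. h x y = h y x) \<and>
     (\<integral>x \<in> T2. h x x \<partial>lborel) = 0"

definition L2_conv_T4 :: "(nat \<Rightarrow> real \<times> real \<Rightarrow> real \<times> real \<Rightarrow> real) \<Rightarrow> (real \<times> real \<Rightarrow> real \<times> real \<Rightarrow> real) \<Rightarrow> bool" where
  "L2_conv_T4 hs H \<longleftrightarrow>
     (\<lambda>n. \<integral>\<^sup>+ p \<in> T2 \<times> T2. ennreal ((hs n (fst p) (snd p) - H (fst p) (snd p))^2) \<partial>lborel) \<longlonglongrightarrow> 0"

text \<open>X is (a version of) <omega (x) omega, H> : the L^2(mu)-limit of <omega (x) omega, h_n>
  along every admissible sequence h_n -> H in L^2.\<close>
definition is_pair_H :: "(real \<times> real \<Rightarrow> real \<times> real \<Rightarrow> real) \<Rightarrow> (((int \<times> int) \<Rightarrow> real) \<Rightarrow> real) \<Rightarrow> bool" where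
  "is_pair_H H X \<longleftrightarrow> X \<in> borel_measurable mu \<and>
     (\<forall>hs. (\<forall>n. admissible (hs n)) \<and> L2_conv_T4 hs H \<longrightarrow>
        (\<lambda>n. \<integral>\<^sup>+ \<xi>. ennreal ((pair_smooth \<xi> (hs n) - X \<xi>)^2) \<partial>mu) \<longlonglongrightarrow> 0)"

text \<open>B is (a version of) b, given by its coordinates B j = <b(omega), e_j>, j in Z2_0.\<close>
definition is_b :: "(int \<times> int \<Rightarrow> ((int \<times> int) \<Rightarrow> real) \<Rightarrow> real) \<Rightarrow> bool" where
  "is_b B \<longleftrightarrow> (\<forall>j \<in> Z2_0. is_pair_H (Hphi (ebasis j)) (\<lambda>\<xi>. - B j \<xi>))"

definition bN :: "nat \<Rightarrow> int \<times> int \<Rightarrow> ((int \<times> int) \<Rightarrow> real) \<Rightarrow> real" where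
  "bN N j \<xi> = (if j \<in> Lambda N then - pair_quad N \<xi> (Hphi (ebasis j)) else 0)"

definition Hneg_sq :: "real \<Rightarrow> (int \<times> int \<Rightarrow> real) \<Rightarrow> ennreal" where
  "Hneg_sq \<delta> g = (\<integral>\<^sup>+ j. ennreal (knorm2 j powr (-(2 + \<delta>)) * (g j)^2) \<partial>count_space Z2_0)"

end

theory Submission
  imports Defs "HOL-Real_Asymp.Real_Asymp"
begin

text \<open>
  Write \<open>a\<^sub>k\<^sub>l\<close> for the coefficients of a kernel \<open>h\<close> in the basis \<open>e\<^sub>k \<otimes> e\<^sub>l\<close>. Up to the trace
  \<open>\<Sum>\<^sub>k a\<^sub>k\<^sub>k\<close>, the pairing of \<open>h\<close> with \<open>\<omega> \<otimes> \<omega>\<close> is the second order Wick polynomial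
  \<open>\<Sum>\<^sub>k\<^sub>l a\<^sub>k\<^sub>l (\<xi>\<^sub>k \<xi>\<^sub>l - \<delta>\<^sub>k\<^sub>l)\<close>, whose variance is at most \<open>2 \<Sum> a\<^sub>k\<^sub>l\<^sup>2 \<le> 2 \<parallel>h\<parallel>\<^sup>2\<close>. For
  \<open>H = H\<^sub>\<phi>\<close> with \<open>\<phi> = e\<^sub>j\<close> all diagonal coefficients vanish, and for an admissible \<open>h\<close> the trace over nonzero modes is
  \<open>- \<integral>\<integral> h\<close>, which tends to \<open>- \<integral>\<integral> H = 0\<close> as \<open>h \<rightarrow> H\<close> in \<open>L\<^sup>2\<close>. Hence the pairing with \<open>H\<close> is the
  \<open>L\<^sup>2\<close>-limit of the finite sums over \<open>k, l \<in> \<Lambda>\<^sub>N\<close>, which are exactly the coordinates of \<open>b\<^sub>N\<close>.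

  The trigonometric polynomials obtained by truncating the series of \<open>K\<close> are themselves admissible.
  They are \<open>L\<^sup>2\<close>-Cauchy by an explicit computation of their coefficients, and a double summation by
  parts shows that they converge to \<open>H\<close> almost everywhere. The same computation gives
  \<open>\<parallel>H\<parallel>\<^sup>2 \<le> C |j|\<^bsup>2 + 2s\<^esup>\<close> for every \<open>s > 0\<close>, so that \<open>\<Sum>\<^sub>j |j|\<^bsup>-4 - 2\<delta>\<^esup> \<parallel>H\<parallel>\<^sup>2\<close> is finite and dominated
  convergence over \<open>j\<close> concludes.
\<close>

section \<open>Fourier analysis on the torus\<close>

text \<open>Two pointwise definitions keep this from being a pure Hilbert space argument.
  \<open>Kker\<close> is the limit of square partial sums, with value 0 where they diverge, so the
  L2 limit of the truncated kernels is known to be \<open>Hphi\<close> only once they converge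
  almost everywhere. Likewise \<open>pair_smooth\<close> is, for each \<open>\<xi>\<close>, the
  limit of the whole sequence of truncated pairings, so admissible kernels require almost sure
  convergence, not just convergence in mean square; it comes from the rapid decay of Fourier
  coefficients of smooth periodic functions. Since \<open>is_b\<close> quantifies over all versions
  of b, uniqueness matters as much as existence, and it rests on having at least one admissible
  sequence that approaches the kernel. The exponent s absorbs the logarithm hidden in the sum of
  |j|^2 / |k|^2 over |k| <= |j|. After weighting, the sum over j has exponent -2 - 2 delta + 2 s,
  which converges in two dimensions as long as s < delta.\<close>

definition tau1 :: "real measure" where
  "tau1 = density lborel (indicator {0..1})"

text \<open>Lebesgue measure restricted to the fundamental square, as a probability measure on the
  whole plane: set integrals over \<open>T2\<close> become plain integrals, to which Fubini and the
  \<open>prob_space\<close> facts apply.\<close>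

definition tau2 :: "(real \<times> real) measure" where
  "tau2 = density lborel (indicator T2)"

definition tau4 :: "((real \<times> real) \<times> (real \<times> real)) measure" where
  "tau4 = density lborel (indicator (T2 \<times> T2))"

lemma borel_measurable_fst_comp [measurable (raw)]:
  fixes f :: "'a \<Rightarrow> 'b::second_countable_topology \<times> 'c::second_countable_topology"
  shows "f \<in> borel_measurable M \<Longrightarrow> (\<lambda>x. fst (f x)) \<in> borel_measurable M"
  by (erule measurable_compose[OF _ borel_measurable_continuous_onI]) (intro continuous_on_fst continuous_on_id)

lemma borel_measurable_snd_comp [measurable (raw)]:
  fixes f :: "'a \<Rightarrow> 'b::second_countable_topology \<times> 'c::second_countable_topology"
  shows "f \<in> borel_measurable M \<Longrightarrow> (\<lambda>x. snd (f x)) \<in> borel_measurable M"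
  by (erule measurable_compose[OF _ borel_measurable_continuous_onI]) (intro continuous_on_snd continuous_on_id)

lemma T2_borel [measurable]: "T2 \<in> sets borel"
  unfolding T2_def by (intro borel_closed closed_Times closed_atLeastAtMost)

lemma T2_T2_borel [measurable]: "T2 \<times> T2 \<in> sets borel"
  unfolding T2_def by (intro borel_closed closed_Times closed_atLeastAtMost)

lemma sets_tau1 [simp, measurable_cong]: "sets tau1 = sets borel"
  by (simp add: tau1_def)

lemma sets_tau2 [simp, measurable_cong]: "sets tau2 = sets borel"
  by (simp add: tau2_def)

lemma sets_tau4 [simp, measurable_cong]: "sets tau4 = sets borel"
  by (simp add: tau4_def)

lemma space_tau [simp]: "space tau1 = UNIV" "space tau2 = UNIV" "space tau4 = UNIV"
  by (simp_all add: tau1_def tau2_def tau4_def)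

interpretation tau1: prob_space tau1
  by (rule prob_spaceI) (simp add: tau1_def emeasure_density)

lemma tau2_eq_pair: "tau2 = tau1 \<Otimes>\<^sub>M tau1"
proof -
  have "tau1 \<Otimes>\<^sub>M tau1 = density (lborel \<Otimes>\<^sub>M lborel)
      (\<lambda>(x, y). indicator {0..1} x * indicator {0..1} y)"
    unfolding tau1_def
    by (rule pair_measure_density)
       (auto intro: sigma_finite_lborel tau1.sigma_finite_measure_axioms[unfolded tau1_def])
  also have "\<dots> = tau2"
    unfolding tau2_def lborel_prod T2_def
    by (rule arg_cong[where f = "density lborel"]) (auto simp: indicator_def fun_eq_iff)
  finally show ?thesis by simp
qed

interpretation tau11: pair_prob_space tau1 tau1 ..

interpretation tau2: prob_space tau2
  unfolding tau2_eq_pair by (rule tau11.prob_space_axioms)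

lemma tau4_eq_pair: "tau4 = tau2 \<Otimes>\<^sub>M tau2"
proof -
  have "tau2 \<Otimes>\<^sub>M tau2 = density (lborel \<Otimes>\<^sub>M lborel) (\<lambda>(x, y). indicator T2 x * indicator T2 y)"
    unfolding tau2_def
    by (rule pair_measure_density)
       (auto intro: sigma_finite_lborel tau2.sigma_finite_measure_axioms[unfolded tau2_def])
  also have "\<dots> = tau4"
    unfolding tau4_def lborel_prod
    by (rule arg_cong[where f = "density lborel"]) (auto simp: indicator_def fun_eq_iff)
  finally show ?thesis by simp
qed

interpretation tau22: pair_prob_space tau2 tau2 ..

interpretation tau4: prob_space tau4
  unfolding tau4_eq_pair by (rule tau22.prob_space_axioms)

lemma integral_tau1:
  fixes f :: "real \<Rightarrow> real"
  assumes [measurable]: "f \<in> borel_measurable borel"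
  shows "(\<integral>x. f x \<partial>tau1) = (\<integral>x. f x * indicator {0..1} x \<partial>lborel)"
proof -
  have eq: "tau1 = density lborel (\<lambda>x. ennreal (indicator {0..1} x))"
    unfolding tau1_def by (simp add: ennreal_indicator)
  show ?thesis
    by (subst eq, subst integral_density) (auto simp: mult.commute)
qed

lemma integral_tau2:
  fixes f :: "real \<times> real \<Rightarrow> real"
  assumes [measurable]: "f \<in> borel_measurable borel"
  shows "(\<integral>x. f x \<partial>tau2) = (\<integral>x \<in> T2. f x \<partial>lborel)"
proof -
  have eq: "tau2 = density lborel (\<lambda>x. ennreal (indicator T2 x))"
    unfolding tau2_def by (simp add: ennreal_indicator)
  show ?thesis
    by (subst eq, subst integral_density) (auto simp: set_lebesgue_integral_def)
qed

lemma integral_tau4: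
  fixes f :: "(real \<times> real) \<times> (real \<times> real) \<Rightarrow> real"
  assumes [measurable]: "f \<in> borel_measurable borel"
  shows "(\<integral>x. f x \<partial>tau4) = (\<integral>x \<in> T2 \<times> T2. f x \<partial>lborel)"
proof -
  have eq: "tau4 = density lborel (\<lambda>x. ennreal (indicator (T2 \<times> T2) x))"
    unfolding tau4_def by (simp add: ennreal_indicator)
  show ?thesis
    by (subst eq, subst integral_density) (auto simp: set_lebesgue_integral_def)
qed

lemma nn_integral_tau4:
  assumes [measurable]: "f \<in> borel_measurable borel"
  shows "(\<integral>\<^sup>+ x. f x \<partial>tau4) = (\<integral>\<^sup>+ x \<in> T2 \<times> T2. f x \<partial>lborel)"
  unfolding tau4_def by (simp add: nn_integral_density mult.commute)

lemma integral_tau2_fubini: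
  fixes f :: "real \<times> real \<Rightarrow> real"
  assumes "integrable tau2 f"
  shows "(\<integral>x. f x \<partial>tau2) = (\<integral>s. (\<integral>t. f (s, t) \<partial>tau1) \<partial>tau1)"
    and "(\<integral>x. f x \<partial>tau2) = (\<integral>t. (\<integral>s. f (s, t) \<partial>tau1) \<partial>tau1)"
  using tau11.integral_fst'[of f] tau11.integral_snd[of "curry f"] assms
  by (simp_all add: tau2_eq_pair)

lemma integral_tau4_fubini:
  fixes f :: "(real \<times> real) \<times> (real \<times> real) \<Rightarrow> real"
  assumes "integrable tau4 f"
  shows "(\<integral>p. f p \<partial>tau4) = (\<integral>x. (\<integral>y. f (x, y) \<partial>tau2) \<partial>tau2)"
  using tau22.integral_fst'[of f] assms by (simp add: tau4_eq_pair)

lemma integrable_bounded: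
  fixes f :: "'a \<Rightarrow> real"
  assumes "finite_measure M" "f \<in> borel_measurable M" "\<And>x. \<bar>f x\<bar> \<le> C"
  shows "integrable M f"
  using finite_measure.integrable_const_bound[OF assms(1), of f C] assms(2,3) by auto

lemma borel_measurable_kdot [measurable]: "kdot k \<in> borel_measurable borel"
  unfolding kdot_def by (intro borel_measurable_continuous_onI continuous_intros)

text \<open>The free phase \<open>b\<close> covers sine and cosine at once. It also makes Fubini
  iterate: the coordinates that are held fixed are absorbed into the phase.\<close>

lemma integral_cos_tau1:
  "(\<integral>t. cos (2 * pi * of_int n * t + b) \<partial>tau1) = (if n = 0 then cos b else 0)"
proof (cases "n = 0")
  case True
  then show ?thesis using tau1.prob_space by simp
next
  case False
  let ?F = "\<lambda>t. sin (2 * pi * of_int n * t + b) / (2 * pi * of_int n)"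
  have "(\<integral>t. cos (2 * pi * of_int n * t + b) * indicator {0..1} t \<partial>lborel) = ?F 1 - ?F 0"
    using False by (intro integral_FTC_Icc_real) (auto intro!: derivative_eq_intros)
  moreover have "sin (2 * pi * of_int n + b) = sin b"
    by (simp add: sin_add sin_int_2pin cos_int_2pin)
  ultimately show ?thesis using False by (simp add: integral_tau1)
qed

lemma integral_cos_tau2:
  "(\<integral>x. cos (2 * pi * kdot k x + b) \<partial>tau2) = (if k = (0, 0) then cos b else 0)"
proof -
  have "integrable tau2 (\<lambda>x. cos (2 * pi * kdot k x + b))"
    by (rule integrable_bounded[where C = 1]) (auto intro: tau2.finite_measure_axioms)
  then have "(\<integral>x. cos (2 * pi * kdot k x + b) \<partial>tau2)
      = (\<integral>s. (\<integral>t. cos (2 * pi * kdot k (s, t) + b) \<partial>tau1) \<partial>tau1)"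
    by (rule integral_tau2_fubini)
  also have "\<dots> = (\<integral>s. (if snd k = 0 then cos (2 * pi * of_int (fst k) * s + b) else 0) \<partial>tau1)"
    using integral_cos_tau1[of "snd k" "2 * pi * of_int (fst k) * s + b" for s]
    by (intro Bochner_Integration.integral_cong) (auto simp: kdot_def algebra_simps)
  also have "\<dots> = (if snd k = 0 then \<integral>s. cos (2 * pi * of_int (fst k) * s + b) \<partial>tau1 else 0)"
    by simp
  finally show ?thesis
    by (simp only: integral_cos_tau1) (cases k, auto)
qed

lemma integral_cos_tau4:
  "(\<integral>p. cos (2 * pi * (kdot k (fst p) + kdot l (snd p)) + b) \<partial>tau4)
     = (if k = (0, 0) \<and> l = (0, 0) then cos b else 0)"
proof -
  have "integrable tau4 (\<lambda>p. cos (2 * pi * (kdot k (fst p) + kdot l (snd p)) + b))"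
    by (rule integrable_bounded[where C = 1]) (auto intro: tau4.finite_measure_axioms)
  then have "(\<integral>p. cos (2 * pi * (kdot k (fst p) + kdot l (snd p)) + b) \<partial>tau4)
      = (\<integral>x. (\<integral>y. cos (2 * pi * (kdot k x + kdot l y) + b) \<partial>tau2) \<partial>tau2)"
    by (simp add: integral_tau4_fubini)
  also have "\<dots> = (\<integral>x. (if l = (0, 0) then cos (2 * pi * kdot k x + b) else 0) \<partial>tau2)"
    using integral_cos_tau2[of l "2 * pi * kdot k x + b" for x]
    by (intro Bochner_Integration.integral_cong) (auto simp: algebra_simps)
  also have "\<dots> = (if l = (0, 0) then \<integral>x. cos (2 * pi * kdot k x + b) \<partial>tau2 else 0)"
    by simp
  finally show ?thesis
    by (simp only: integral_cos_tau2) auto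
qed

text \<open>Since sin z = cos (z - pi / 2), both branches of \<open>ebasis\<close> become one
  shifted cosine, and all products of basis functions reduce to the product-to-sum formula.\<close>

definition phase :: "int \<times> int \<Rightarrow> real" where
  "phase k = (if k \<in> Z2_plus then 0 else - pi / 2)"

lemma ebasis_eq_cos: "ebasis k x = sqrt 2 * cos (2 * pi * kdot k x + phase k)"
  by (simp add: ebasis_def phase_def cos_add cos_minus)

lemma borel_measurable_ebasis [measurable]: "ebasis k \<in> borel_measurable borel"
  unfolding ebasis_eq_cos by measurable

lemma abs_ebasis_le: "\<bar>ebasis k x\<bar> \<le> sqrt 2"
  using abs_cos_le_one[of "2 * pi * kdot k x + phase k"] by (simp add: ebasis_eq_cos abs_mult)

lemma kdot_add_left: "kdot (k + l) x = kdot k x + kdot l x"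
  and kdot_diff_left: "kdot (k - l) x = kdot k x - kdot l x"
  and kdot_minus_left: "kdot (- k) x = - kdot k x"
  and kdot_diff_right: "kdot k (x - y) = kdot k x - kdot k y"
  by (simp_all add: kdot_def algebra_simps)

lemma Z2_plus_uminus: "k \<in> Z2_0 \<Longrightarrow> - k \<in> Z2_plus \<longleftrightarrow> k \<notin> Z2_plus"
  by (cases k) (auto simp: Z2_plus_def Z2_0_def)

lemma integral_ebasis_mult:
  assumes "k \<in> Z2_0" "l \<in> Z2_0"
  shows "(\<integral>x. ebasis k x * ebasis l x \<partial>tau2) = (if k = l then 1 else 0)"
proof -
  have eq: "ebasis k x * ebasis l x
      = cos (2 * pi * kdot (k - l) x + (phase k - phase l)) + cos (2 * pi * kdot (k + l) x + (phase k + phase l))" for x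
  proof -
    have "ebasis k x * ebasis l x
       = 2 * (cos (2 * pi * kdot k x + phase k) * cos (2 * pi * kdot l x + phase l))"
      by (simp add: ebasis_eq_cos)
    also have "\<dots> = cos (2 * pi * kdot k x + phase k - (2 * pi * kdot l x + phase l))
       + cos (2 * pi * kdot k x + phase k + (2 * pi * kdot l x + phase l))"
      by (subst cos_times_cos) simp
    finally show ?thesis
      by (simp add: kdot_add_left kdot_diff_left algebra_simps)
  qed
  have int: "integrable tau2 (\<lambda>x. cos (2 * pi * kdot m x + b))" for m b
    by (rule integrable_bounded[where C = 1]) (auto intro: tau2.finite_measure_axioms)
  have "(\<integral>x. ebasis k x * ebasis l x \<partial>tau2)
     = (if k - l = (0, 0) then cos (phase k - phase l) else 0)
     + (if k + l = (0, 0) then cos (phase k + phase l) else 0)"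
    unfolding eq by (subst Bochner_Integration.integral_add[OF int int]) (simp only: integral_cos_tau2)
  moreover have "k + l \<noteq> (0, 0)" if "k = l"
    using assms that by (cases k) (auto simp: Z2_0_def)
  \<comment> \<open>Here l = - k, so exactly one of the two functions is a cosine and the other a
    sine; the phases add up to - pi / 2.\<close>
  moreover have "cos (phase k + phase l) = 0" if "k + l = (0, 0)"
  proof -
    have "l = - k" using that by (cases k; cases l) auto
    then show ?thesis using Z2_plus_uminus[OF assms(1)] by (auto simp: phase_def)
  qed
  moreover have "k - l = (0, 0) \<longleftrightarrow> k = l"
    by (cases k; cases l) auto
  ultimately show ?thesis by auto
qed

lemma integral_product:
  fixes f g :: "real \<times> real \<Rightarrow> real"
  assumes "integrable tau2 f" "integrable tau2 g"
  shows "(\<integral>p. f (fst p) * g (snd p) \<partial>tau4) = (\<integral>x. f x \<partial>tau2) * (\<integral>y. g y \<partial>tau2)"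
proof -
  have [measurable]: "f \<in> borel_measurable borel" "g \<in> borel_measurable borel"
    using assms[THEN borel_measurable_integrable] by (simp_all cong: measurable_cong_sets)
  have "integrable (tau2 \<Otimes>\<^sub>M tau2) (\<lambda>p. f (fst p) * g (snd p))"
    using assms by (intro tau22.Fubini_integrable) (auto simp: abs_mult)
  then show ?thesis
    using integral_tau4_fubini[of "\<lambda>p. f (fst p) * g (snd p)"]
    by (simp add: tau4_eq_pair)
qed

lemma integrable_ebasis_mult: "integrable tau2 (\<lambda>x. ebasis k x * ebasis l x)"
proof (rule integrable_bounded[where C = 2])
  fix x
  show "\<bar>ebasis k x * ebasis l x\<bar> \<le> 2"
    using mult_mono[OF abs_ebasis_le[of k x] abs_ebasis_le[of l x]] by (simp add: abs_mult)
qed (auto intro: tau2.finite_measure_axioms)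

definition ebasis2 :: "(int \<times> int) \<times> (int \<times> int) \<Rightarrow> (real \<times> real) \<times> (real \<times> real) \<Rightarrow> real" where
  "ebasis2 i p = ebasis (fst i) (fst p) * ebasis (snd i) (snd p)"

lemma borel_measurable_ebasis2 [measurable]: "ebasis2 i \<in> borel_measurable borel"
  unfolding ebasis2_def by measurable

lemma abs_ebasis2_le: "\<bar>ebasis2 i p\<bar> \<le> 2"
  using mult_mono[OF abs_ebasis_le[of "fst i" "fst p"] abs_ebasis_le[of "snd i" "snd p"]]
  by (simp add: ebasis2_def abs_mult)

lemma integral_ebasis2_mult:
  assumes "i \<in> Z2_0 \<times> Z2_0" "i' \<in> Z2_0 \<times> Z2_0"
  shows "(\<integral>p. ebasis2 i p * ebasis2 i' p \<partial>tau4) = (if i = i' then 1 else 0)"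
proof -
  have "(\<integral>p. ebasis2 i p * ebasis2 i' p \<partial>tau4)
    = (\<integral>p. (\<lambda>x. ebasis (fst i) x * ebasis (fst i') x) (fst p)
         * (\<lambda>x. ebasis (snd i) x * ebasis (snd i') x) (snd p) \<partial>tau4)"
    by (intro Bochner_Integration.integral_cong) (simp_all add: ebasis2_def)
  also have "\<dots> = (if i = i' then 1 else 0)"
    using assms by (subst integral_product) (auto simp: integrable_ebasis_mult integral_ebasis_mult prod_eq_iff)
  finally show ?thesis .
qed

section \<open>Orthogonal systems and Bessel's inequality\<close>

lemma integrable_mult_of_squares:
  fixes f g :: "'a \<Rightarrow> real"
  assumes [measurable]: "f \<in> borel_measurable M" "g \<in> borel_measurable M"
    and "integrable M (\<lambda>x. (f x)\<^sup>2)" "integrable M (\<lambda>x. (g x)\<^sup>2)"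
  shows "integrable M (\<lambda>x. f x * g x)"
proof (rule Bochner_Integration.integrable_bound)
  show "integrable M (\<lambda>x. (f x)\<^sup>2 + (g x)\<^sup>2)"
    using assms by simp
  show "AE x in M. norm (f x * g x) \<le> norm ((f x)\<^sup>2 + (g x)\<^sup>2)"
  proof (rule AE_I2)
    fix x
    have "2 * \<bar>f x\<bar> * \<bar>g x\<bar> \<le> \<bar>f x\<bar>\<^sup>2 + \<bar>g x\<bar>\<^sup>2" by (rule sum_squares_bound)
    moreover have "0 \<le> \<bar>f x\<bar> * \<bar>g x\<bar>" by simp
    ultimately show "norm (f x * g x) \<le> norm ((f x)\<^sup>2 + (g x)\<^sup>2)"
      unfolding real_norm_def abs_mult power2_abs by linarith
  qed
qed measurable

lemma integrable_sq_linear: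
  fixes f g :: "'a \<Rightarrow> real"
  assumes [measurable]: "f \<in> borel_measurable M" "g \<in> borel_measurable M"
    and "integrable M (\<lambda>x. (f x)\<^sup>2)" "integrable M (\<lambda>x. (g x)\<^sup>2)"
  shows "integrable M (\<lambda>x. (f x + g x)\<^sup>2)" "integrable M (\<lambda>x. (f x - g x)\<^sup>2)"
  using assms integrable_mult_of_squares[of f M g]
  by (auto simp: power2_sum power2_diff mult.assoc)

text \<open>The common squared norm \<open>r\<close> stays free because the systems in use are
  normalised differently: \<open>r = 1\<close> for \<open>ebasis\<close> and \<open>ebasis2\<close>,
  \<open>r = 1/2\<close> for single cosines and sines.\<close>

lemma integral_sq_sum_orthogonal:
  fixes \<phi> :: "'i \<Rightarrow> 'a \<Rightarrow> real"
  assumes "finite I" and meas: "\<And>i. i \<in> I \<Longrightarrow> \<phi> i \<in> borel_measurable M"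
    and sq: "\<And>i. i \<in> I \<Longrightarrow> integrable M (\<lambda>x. (\<phi> i x)\<^sup>2)"
    and orth: "\<And>i j. i \<in> I \<Longrightarrow> j \<in> I \<Longrightarrow> (\<integral>x. \<phi> i x * \<phi> j x \<partial>M) = (if i = j then r else 0)"
  shows "(\<integral>x. (\<Sum>i\<in>I. c i * \<phi> i x)\<^sup>2 \<partial>M) = r * (\<Sum>i\<in>I. (c i)\<^sup>2)"
    and "integrable M (\<lambda>x. (\<Sum>i\<in>I. c i * \<phi> i x)\<^sup>2)"
proof -
  have int: "integrable M (\<lambda>x. \<phi> i x * \<phi> j x)" if "i \<in> I" "j \<in> I" for i j
    by (intro integrable_mult_of_squares meas sq that)
  have eq: "(\<Sum>i\<in>I. c i * \<phi> i x)\<^sup>2 = (\<Sum>i\<in>I. \<Sum>j\<in>I. c i * c j * (\<phi> i x * \<phi> j x))" for x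
    unfolding power2_eq_square sum_product by (simp add: algebra_simps)
  show "integrable M (\<lambda>x. (\<Sum>i\<in>I. c i * \<phi> i x)\<^sup>2)"
    unfolding eq by (intro Bochner_Integration.integrable_sum integrable_mult_right int) auto
  have "(\<integral>x. (\<Sum>i\<in>I. c i * \<phi> i x)\<^sup>2 \<partial>M) = (\<Sum>i\<in>I. \<Sum>j\<in>I. c i * c j * (\<integral>x. \<phi> i x * \<phi> j x \<partial>M))"
    unfolding eq
    by (subst Bochner_Integration.integral_sum;
        (intro Bochner_Integration.integrable_sum integrable_mult_right int sum.cong refl)?)
       (auto intro!: sum.cong simp: Bochner_Integration.integral_sum int)
  also have "\<dots> = (\<Sum>i\<in>I. \<Sum>j\<in>I. if i = j then r * (c i)\<^sup>2 else 0)"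
    by (intro sum.cong refl) (auto simp: orth power2_eq_square)
  also have "\<dots> = r * (\<Sum>i\<in>I. (c i)\<^sup>2)"
    using assms(1) by (simp add: sum_distrib_left)
  finally show "(\<integral>x. (\<Sum>i\<in>I. c i * \<phi> i x)\<^sup>2 \<partial>M) = r * (\<Sum>i\<in>I. (c i)\<^sup>2)" .
qed

text \<open>Expand the nonnegative integral of (r f - S)^2, where S is the sum of c_i phi_i. Scaling
  f by r instead of dividing the coefficients by r keeps the expansion free of fractions: the cross
  term gives - 2 r and the square of S gives + r times the sum of c_i^2.\<close>

lemma Bessel_inequality:
  fixes \<phi> :: "'i \<Rightarrow> 'a \<Rightarrow> real"
  assumes "finite I" and meas: "\<And>i. i \<in> I \<Longrightarrow> \<phi> i \<in> borel_measurable M"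
    and sq: "\<And>i. i \<in> I \<Longrightarrow> integrable M (\<lambda>x. (\<phi> i x)\<^sup>2)"
    and orth: "\<And>i j. i \<in> I \<Longrightarrow> j \<in> I \<Longrightarrow> (\<integral>x. \<phi> i x * \<phi> j x \<partial>M) = (if i = j then r else 0)"
    and f: "f \<in> borel_measurable M" "integrable M (\<lambda>x. (f x)\<^sup>2)" and "r > 0"
  shows "(\<Sum>i\<in>I. (\<integral>x. f x * \<phi> i x \<partial>M)\<^sup>2) \<le> r * (\<integral>x. (f x)\<^sup>2 \<partial>M)"
proof -
  define c where "c i = (\<integral>x. f x * \<phi> i x \<partial>M)" for i
  let ?S = "\<lambda>x. \<Sum>i\<in>I. c i * \<phi> i x"
  note S = integral_sq_sum_orthogonal[of I \<phi> M r c, OF assms(1) meas sq orth]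
  have int: "integrable M (\<lambda>x. f x * \<phi> i x)" if "i \<in> I" for i
    by (intro integrable_mult_of_squares meas sq that f)
  have fS: "(\<lambda>x. f x * ?S x) = (\<lambda>x. \<Sum>i\<in>I. c i * (f x * \<phi> i x))"
    by (auto simp: sum_distrib_left algebra_simps)
  have intfS: "integrable M (\<lambda>x. f x * ?S x)"
    unfolding fS by (intro Bochner_Integration.integrable_sum integrable_mult_right int)
  have "0 \<le> (\<integral>x. (r * f x - ?S x)\<^sup>2 \<partial>M)" by simp
  also have "\<dots> = (\<integral>x. r\<^sup>2 * (f x)\<^sup>2 - 2 * r * (f x * ?S x) + (?S x)\<^sup>2 \<partial>M)"
    by (simp add: power2_diff power_mult_distrib algebra_simps)
  also have "\<dots> = r\<^sup>2 * (\<integral>x. (f x)\<^sup>2 \<partial>M) - 2 * r * (\<integral>x. f x * ?S x \<partial>M) + (\<integral>x. (?S x)\<^sup>2 \<partial>M)"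
    using intfS S(2) f by (simp)
  also have "(\<integral>x. f x * ?S x \<partial>M) = (\<Sum>i\<in>I. (c i)\<^sup>2)"
    unfolding fS
    by (subst Bochner_Integration.integral_sum; (intro integrable_mult_right int)?)
       (auto simp: c_def power2_eq_square)
  finally have "r * (\<Sum>i\<in>I. (c i)\<^sup>2) \<le> r * (r * (\<integral>x. (f x)\<^sup>2 \<partial>M))"
    using S(1) by (simp add: power2_eq_square)
  then show ?thesis using \<open>r > 0\<close> by (simp add: c_def)
qed

definition coef :: "((real \<times> real) \<times> (real \<times> real) \<Rightarrow> real) \<Rightarrow> (int \<times> int) \<times> (int \<times> int) \<Rightarrow> real" where
  "coef f i = (\<integral>p. f p * ebasis2 i p \<partial>tau4)"

lemma integrable_ebasis2_sq: "integrable tau4 (\<lambda>p. (ebasis2 i p)\<^sup>2)"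
proof (rule integrable_bounded[where C = 4])
  show "\<bar>(ebasis2 i p)\<^sup>2\<bar> \<le> 4" for p
    using power_mono[OF abs_ebasis2_le[of i p], of 2] by simp
qed (auto intro: tau4.finite_measure_axioms)

lemma sum_coef_sq_le:
  assumes "f \<in> borel_measurable borel" "integrable tau4 (\<lambda>p. (f p)\<^sup>2)" "finite I" "I \<subseteq> Z2_0 \<times> Z2_0"
  shows "(\<Sum>i\<in>I. (coef f i)\<^sup>2) \<le> (\<integral>p. (f p)\<^sup>2 \<partial>tau4)"
proof -
  have "(\<Sum>i\<in>I. (\<integral>p. f p * ebasis2 i p \<partial>tau4)\<^sup>2) \<le> 1 * (\<integral>p. (f p)\<^sup>2 \<partial>tau4)"
    using assms
    by (intro Bessel_inequality integral_ebasis2_mult) (auto simp: integrable_ebasis2_sq)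
  then show ?thesis by (simp add: coef_def)
qed

lemma integrable_mult_ebasis2:
  assumes "f \<in> borel_measurable borel" "integrable tau4 (\<lambda>p. (f p)\<^sup>2)"
  shows "integrable tau4 (\<lambda>p. f p * ebasis2 i p)"
  using assms by (intro integrable_mult_of_squares) (auto simp: integrable_ebasis2_sq)

section \<open>Lattice sums\<close>

text \<open>Unconditional summation does not see the shape of the finite sets, so discs
  \<open>Lambda\<close>, squares and symmetric intervals all compute the same sum.\<close>

lemma tendsto_sum_exhausting:
  fixes f :: "'a \<Rightarrow> real"
  assumes "(f has_sum S) A" "\<And>n. finite (F n)" "\<And>n. F n \<subseteq> A"
    and "\<And>x. x \<in> A \<Longrightarrow> eventually (\<lambda>n. x \<in> F n) sequentially"
  shows "(\<lambda>n. sum f (F n)) \<longlonglongrightarrow> S"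
proof -
  have "filterlim F (finite_subsets_at_top A) sequentially"
    unfolding filterlim_finite_subsets_at_top
  proof (intro allI impI)
    fix X assume X: "finite X \<and> X \<subseteq> A"
    then have "eventually (\<lambda>n. \<forall>x\<in>X. x \<in> F n) sequentially"
      using assms(4) by (intro eventually_ball_finite) auto
    then show "eventually (\<lambda>n. finite (F n) \<and> X \<subseteq> F n \<and> F n \<subseteq> A) sequentially"
      by eventually_elim (use assms(2,3) in auto)
  qed
  from filterlim_compose[OF assms(1)[unfolded has_sum_def] this] show ?thesis .
qed

text \<open>The integers are split into the ranges of n and - n - 1, on which the weight is a
  shifted p-series; the added 1 avoids the base 0.\<close>

lemma summable_on_powr_int:
  fixes a :: real
  assumes "a > 1"
  shows "(\<lambda>n::int. (1 + \<bar>real_of_int n\<bar>) powr (-a)) summable_on UNIV"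
proof -
  have "summable (\<lambda>n. real n powr (-a))"
    using assms by (simp add: summable_real_powr_iff)
  then have s: "summable (\<lambda>n. real (n + k) powr (-a))" for k
    using summable_ignore_initial_segment[of "\<lambda>n. real n powr (-a)" k] by simp
  have 1: "(\<lambda>n::nat. real (n + k) powr (-a)) summable_on UNIV" for k
    using s[of k] by (intro norm_summable_imp_summable_on) simp
  have "(\<lambda>n::int. (1 + \<bar>real_of_int n\<bar>) powr (-a)) summable_on range int"
    using 1[of 1] by (subst summable_on_reindex) (auto simp: o_def add.commute)
  moreover have "(\<lambda>n::int. (1 + \<bar>real_of_int n\<bar>) powr (-a)) summable_on range (\<lambda>n. - int n - 1)"
    using 1[of 2] by (subst summable_on_reindex) (auto simp: o_def inj_def add.commute abs_if)
  moreover have "range int \<union> range (\<lambda>n. - int n - 1) = UNIV"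
  proof (intro set_eqI iffI UNIV_I)
    fix x :: int
    show "x \<in> range int \<union> range (\<lambda>n. - int n - 1)"
    proof (cases "x \<ge> 0")
      case True then show ?thesis by (auto intro!: rev_image_eqI[of "nat x"])
    next
      case False
      then have "x = - int (nat (- x - 1)) - 1" by simp
      then show ?thesis by blast
    qed
  qed
  moreover have "range int \<inter> range (\<lambda>n. - int n - 1) = {}" by auto
  ultimately show ?thesis
    using summable_on_Un_disjoint by metis
qed

lemma knorm2_nonneg [simp]: "0 \<le> knorm2 k"
  by (simp add: knorm2_def)

lemma knorm2_ge_1: "k \<in> Z2_0 \<Longrightarrow> 1 \<le> knorm2 k"
proof -
  assume "k \<in> Z2_0"
  then have "(fst k)\<^sup>2 + (snd k)\<^sup>2 \<noteq> 0" by (cases k) (auto simp: Z2_0_def)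
  then have "1 \<le> (fst k)\<^sup>2 + (snd k)\<^sup>2"
    by (smt (verit) zero_le_power2)
  then have "1 \<le> real_of_int ((fst k)\<^sup>2 + (snd k)\<^sup>2)" by linarith
  then show ?thesis by (simp add: knorm2_def)
qed

lemma knorm2_zero [simp]: "knorm2 (0, 0) = 0" "knorm2 0 = 0"
  by (simp_all add: knorm2_def)

lemma knorm2_uminus [simp]: "knorm2 (- k) = knorm2 k"
  by (simp add: knorm2_def)

text \<open>Each factor is at most 1 + |k|, hence at most 2 |k| as |k| >= 1. This dominates a radial
  weight by a product of one-dimensional weights and so reduces the planar lattice sum to a product
  of two series.\<close>

lemma prod_le_knorm2:
  assumes "k \<in> Z2_0"
  shows "(1 + \<bar>real_of_int (fst k)\<bar>) * (1 + \<bar>real_of_int (snd k)\<bar>) \<le> 4 * knorm2 k"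
proof -
  define r where "r = sqrt (knorm2 k)"
  have r: "r\<^sup>2 = knorm2 k" "1 \<le> r" using knorm2_ge_1[OF assms] by (auto simp: r_def)
  have "\<bar>real_of_int (fst k)\<bar> \<le> r" "\<bar>real_of_int (snd k)\<bar> \<le> r"
    unfolding r_def by (auto intro!: real_le_rsqrt simp: knorm2_def)
  then have "(1 + \<bar>real_of_int (fst k)\<bar>) * (1 + \<bar>real_of_int (snd k)\<bar>) \<le> (2 * r) * (2 * r)"
    using r by (intro mult_mono) auto
  then show ?thesis using r by (simp add: power2_eq_square)
qed

text \<open>As \<open>knorm2\<close> is the squared length, a > 1 is the usual planar threshold
  |k|^(-2a) with 2a > 2.\<close>

lemma summable_on_knorm2_powr:
  fixes a :: real
  assumes "a > 1"
  shows "(\<lambda>k. knorm2 k powr (-a)) summable_on Z2_0"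
proof -
  let ?w = "\<lambda>n::int. (1 + \<bar>real_of_int n\<bar>) powr (-a)"
  have w: "(?w has_sum (infsum ?w UNIV)) UNIV"
    using summable_on_powr_int[OF assms] by (rule has_sum_infsum)
  have "(\<lambda>k. ?w (fst k) * ?w (snd k)) summable_on (UNIV \<times> UNIV)"
  proof -
    have "(\<lambda>(m, n). ?w m * ?w n) summable_on (Sigma UNIV (\<lambda>_. UNIV))"
      using has_sum_cmult_right[OF w] summable_on_cmult_left[OF summable_on_powr_int[OF assms]]
      by (intro summable_on_SigmaI[where g = "\<lambda>m. ?w m * infsum ?w UNIV"]) auto
    then show ?thesis by (simp add: case_prod_beta')
  qed
  then have "(\<lambda>k. 4 powr a * (?w (fst k) * ?w (snd k))) summable_on UNIV"
    by (intro summable_on_cmult_right) simp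
  then have "(\<lambda>k. 4 powr a * (?w (fst k) * ?w (snd k))) summable_on Z2_0"
    by (rule summable_on_subset_banach) simp
  then show ?thesis
  proof (rule summable_on_comparison_test)
    fix k assume k: "k \<in> Z2_0"
    have "knorm2 k powr (-a) \<le> ((1 + \<bar>real_of_int (fst k)\<bar>) * (1 + \<bar>real_of_int (snd k)\<bar>) / 4) powr (-a)"
      using prod_le_knorm2[OF k] assms by (intro powr_mono2') auto
    also have "\<dots> = 4 powr a * (?w (fst k) * ?w (snd k))"
      by (simp add: powr_divide powr_mult powr_minus divide_simps)
    finally show "knorm2 k powr (-a) \<le> 4 powr a * (?w (fst k) * ?w (snd k))" .
  qed simp
qed

lemma Lambda_subset: "Lambda N \<subseteq> Z2_0"
  by (auto simp: Lambda_def)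

lemma int_abs_le_of_sq: "real_of_int a ^ 2 \<le> real N ^ 2 \<Longrightarrow> \<bar>a\<bar> \<le> int N"
  using abs_le_square_iff[of "real_of_int a" "real N"] by simp

lemma finite_Lambda [simp]: "finite (Lambda N)"
proof (rule finite_subset)
  show "Lambda N \<subseteq> {- int N..int N} \<times> {- int N..int N}"
  proof
    fix k assume "k \<in> Lambda N"
    then have "real_of_int (fst k) ^ 2 \<le> real N ^ 2" "real_of_int (snd k) ^ 2 \<le> real N ^ 2"
      using zero_le_power2[of "real_of_int (fst k)"] zero_le_power2[of "real_of_int (snd k)"]
      unfolding Lambda_def knorm2_def mem_Collect_eq by linarith+
    then have "\<bar>fst k\<bar> \<le> int N" "\<bar>snd k\<bar> \<le> int N" by (auto intro: int_abs_le_of_sq)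
    then show "k \<in> {- int N..int N} \<times> {- int N..int N}" by (cases k) auto
  qed
qed simp

lemma Lambda_mono: "M \<le> N \<Longrightarrow> Lambda M \<subseteq> Lambda N"
  by (auto simp: Lambda_def intro: order_trans power_mono)

text \<open>Makes the approximation with N = 0 vanish identically, so that b itself can be treated
  as one of the errors b_N - b.\<close>

lemma Lambda_0 [simp]: "Lambda 0 = {}"
  using knorm2_ge_1 by (force simp: Lambda_def)

lemma eventually_in_Lambda: "k \<in> Z2_0 \<Longrightarrow> eventually (\<lambda>N. k \<in> Lambda N) sequentially"
proof -
  assume k: "k \<in> Z2_0"
  obtain N0 where N0: "knorm2 k \<le> real N0" using real_arch_simple by blast
  have "k \<in> Lambda N" if "N \<ge> N0" "N \<ge> 1" for N
  proof -
    have "real N0 \<le> real N * 1" using that by simp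
    also have "\<dots> \<le> real N * real N" using that by (intro mult_left_mono) auto
    finally show ?thesis using k N0 by (simp add: Lambda_def power2_eq_square)
  qed
  then show ?thesis using eventually_sequentiallyI[of "max N0 1"] by simp
qed

lemma Lambda_uminus: "uminus ` Lambda N = Lambda N"
proof -
  have *: "uminus ` Lambda N \<subseteq> Lambda N"
  proof (rule image_subsetI)
    fix k assume "k \<in> Lambda N"
    then show "- k \<in> Lambda N" by (cases k) (auto simp: Lambda_def Z2_0_def knorm2_def)
  qed
  then have "uminus ` uminus ` Lambda N \<subseteq> uminus ` Lambda N" by (rule image_mono)
  with * show ?thesis by (simp add: image_image)
qed

section \<open>Pointwise convergence of the Biot--Savart series\<close>

lemma sum_by_parts:
  fixes b v :: "nat \<Rightarrow> real"
  shows "(\<Sum>m<M. b m * v m)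
    = b M * (\<Sum>i<M. v i) + (\<Sum>m<M. (b m - b (Suc m)) * (\<Sum>i<Suc m. v i))"
  by (induction M) (simp_all add: algebra_simps)

lemma tendsto_zero_abs_le:
  fixes f g :: "nat \<Rightarrow> real"
  assumes "g \<longlonglongrightarrow> 0" "\<And>n. \<bar>f n\<bar> \<le> g n"
  shows "f \<longlonglongrightarrow> 0"
  by (rule Lim_null_comparison[OF _ assms(1)]) (use assms(2) in auto)

text \<open>Summation by parts moves the differences onto \<open>b\<close>; as \<open>b\<close>
  decreases to 0, they telescope and are absolutely summable against the bounded partial sums of
  \<open>v\<close>.\<close>

lemma Dirichlet_test:
  fixes b v :: "nat \<Rightarrow> real"
  assumes V: "\<And>n. \<bar>\<Sum>i<n. v i\<bar> \<le> V" and b: "b \<longlonglongrightarrow> 0" "decseq b"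
  shows "convergent (\<lambda>M. \<Sum>m<M. b m * v m)"
proof -
  have V0: "0 \<le> V" using V[of 0] by simp
  have "(\<lambda>M. b M * (\<Sum>i<M. v i)) \<longlonglongrightarrow> 0"
  proof (rule tendsto_zero_abs_le)
    show "(\<lambda>M. V * \<bar>b M\<bar>) \<longlonglongrightarrow> 0"
      using tendsto_mult_right_zero[OF tendsto_rabs_zero[OF b(1)]] .
    show "\<bar>b M * (\<Sum>i<M. v i)\<bar> \<le> V * \<bar>b M\<bar>" for M
      using mult_right_mono[OF V[of M], of "\<bar>b M\<bar>"] by (simp add: abs_mult mult.commute)
  qed
  moreover have "summable (\<lambda>m. (b m - b (Suc m)) * (\<Sum>i<Suc m. v i))"
  proof (rule summable_comparison_test')
    show "summable (\<lambda>m. (b m - b (Suc m)) * V)"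
      using telescope_summable'[OF b(1)] by (rule summable_mult2)
    show "norm ((b m - b (Suc m)) * (\<Sum>i<Suc m. v i)) \<le> (b m - b (Suc m)) * V" for m
      using decseq_SucD[OF b(2), of m] V[of "Suc m"] V0
      by (auto simp: abs_mult intro!: mult_mono)
  qed
  ultimately have conv: "convergent (\<lambda>M. b M * (\<Sum>i<M. v i) + (\<Sum>m<M. (b m - b (Suc m)) * (\<Sum>i<Suc m. v i)))"
    by (intro convergent_add[OF convergentI]) (simp_all only: summable_iff_convergent)
  have eq: "(\<lambda>M. \<Sum>m<M. b m * v m)
      = (\<lambda>M. b M * (\<Sum>i<M. v i) + (\<Sum>m<M. (b m - b (Suc m)) * (\<Sum>i<Suc m. v i)))"
    by (rule ext) (rule sum_by_parts)
  show ?thesis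
    by (rule subst[where P = convergent, OF eq[symmetric] conv])
qed

text \<open>The coefficients of the series for K decay only like 1 / |k|, too slowly for absolute
  convergence in the plane. Summing by parts in both variables leaves a double series in the mixed
  second differences, dominated by the product s n * s m, and three boundary terms, which
  \<open>b1\<close>, \<open>b2\<close> and \<open>b3\<close> send to 0.\<close>

lemma double_Dirichlet_test:
  fixes a :: "nat \<Rightarrow> nat \<Rightarrow> real" and u v :: "nat \<Rightarrow> real"
  assumes U: "\<And>n. \<bar>\<Sum>i<n. u i\<bar> \<le> U" and V: "\<And>n. \<bar>\<Sum>i<n. v i\<bar> \<le> V"
    and dd: "\<And>n m. \<bar>a n m - a (Suc n) m - (a n (Suc m) - a (Suc n) (Suc m))\<bar> \<le> s n * s m"
    and s: "summable s" "\<And>n. 0 \<le> s n"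
    and b1: "(\<lambda>M. \<Sum>n<M. \<bar>a n M - a (Suc n) M\<bar>) \<longlonglongrightarrow> 0"
    and b2: "(\<lambda>M. \<Sum>m<M. \<bar>a M m - a M (Suc m)\<bar>) \<longlonglongrightarrow> 0"
    and b3: "(\<lambda>M. a M M) \<longlonglongrightarrow> 0"
  shows "convergent (\<lambda>M. \<Sum>n<M. \<Sum>m<M. a n m * u n * v m)"
proof -
  define Us where "Us n = (\<Sum>i<n. u i)" for n
  define Vs where "Vs n = (\<Sum>i<n. v i)" for n
  have U0: "0 \<le> U" and V0: "0 \<le> V" using U[of 0] V[of 0] by auto
  have Ub: "\<bar>Us n\<bar> \<le> U" and Vb: "\<bar>Vs n\<bar> \<le> V" for n using U V by (auto simp: Us_def Vs_def)
  define D where "D n m = a n m - a (Suc n) m - (a n (Suc m) - a (Suc n) (Suc m))" for n m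
  have eq: "(\<Sum>n<M. \<Sum>m<M. a n m * u n * v m)
     = (a M M * Us M * Vs M + (\<Sum>n<M. (a n M - a (Suc n) M) * Us (Suc n)) * Vs M
     + (\<Sum>m<M. (a M m - a M (Suc m)) * Vs (Suc m)) * Us M)
     + (\<Sum>p\<in>{..<M} \<times> {..<M}. D (fst p) (snd p) * Us (Suc (fst p)) * Vs (Suc (snd p)))" for M
  proof -
    \<comment> \<open>The outer summation by parts produces differences in n of inner sums; summing
      these by parts in m brings in the mixed difference \<open>D\<close>.\<close>
    have dif: "(\<Sum>m<M. a n m * v m) - (\<Sum>m<M. a (Suc n) m * v m)
        = (a n M - a (Suc n) M) * Vs M + (\<Sum>m<M. D n m * Vs (Suc m))" for n
    proof -
      have "(\<Sum>m<M. a n m * v m) - (\<Sum>m<M. a (Suc n) m * v m) = (\<Sum>m<M. (a n m - a (Suc n) m) * v m)"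
        by (simp add: sum_subtractf algebra_simps)
      also have "\<dots> = (a n M - a (Suc n) M) * Vs M + (\<Sum>m<M. D n m * Vs (Suc m))"
        unfolding Vs_def D_def by (rule sum_by_parts)
      finally show ?thesis .
    qed
    have "(\<Sum>n<M. \<Sum>m<M. a n m * u n * v m) = (\<Sum>n<M. (\<Sum>m<M. a n m * v m) * u n)"
      by (simp add: sum_distrib_left sum_distrib_right mult_ac)
    also have "\<dots> = (\<Sum>m<M. a M m * v m) * Us M
        + (\<Sum>n<M. ((\<Sum>m<M. a n m * v m) - (\<Sum>m<M. a (Suc n) m * v m)) * Us (Suc n))"
      unfolding Us_def by (rule sum_by_parts)
    also have "(\<Sum>n<M. ((\<Sum>m<M. a n m * v m) - (\<Sum>m<M. a (Suc n) m * v m)) * Us (Suc n))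
        = (\<Sum>n<M. ((a n M - a (Suc n) M) * Vs M + (\<Sum>m<M. D n m * Vs (Suc m))) * Us (Suc n))"
      by (simp only: dif)
    also have "(\<Sum>m<M. a M m * v m) = a M M * Vs M + (\<Sum>m<M. (a M m - a M (Suc m)) * Vs (Suc m))"
      unfolding Vs_def by (rule sum_by_parts)
    also have "(\<Sum>n<M. ((a n M - a (Suc n) M) * Vs M + (\<Sum>m<M. D n m * Vs (Suc m))) * Us (Suc n))
       = (\<Sum>n<M. (a n M - a (Suc n) M) * Us (Suc n)) * Vs M
       + (\<Sum>n<M. \<Sum>m<M. D n m * Us (Suc n) * Vs (Suc m))"
      unfolding distrib_right sum.distrib sum_distrib_right
      by (intro arg_cong2[where f = "(+)"] sum.cong refl) (simp_all only: mult_ac)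
    also have "(\<Sum>n<M. \<Sum>m<M. D n m * Us (Suc n) * Vs (Suc m))
       = (\<Sum>p\<in>{..<M} \<times> {..<M}. D (fst p) (snd p) * Us (Suc (fst p)) * Vs (Suc (snd p)))"
      by (simp add: sum.cartesian_product case_prod_beta')
    finally show ?thesis
      by (simp only: distrib_right mult.assoc mult.commute[of "Vs M" "Us M"] add_ac)
  qed
  have "(\<lambda>M. a M M * Us M * Vs M) \<longlonglongrightarrow> 0"
  proof (rule tendsto_zero_abs_le)
    show "(\<lambda>M. \<bar>a M M\<bar> * (U * V)) \<longlonglongrightarrow> 0"
      using tendsto_mult_left_zero[OF tendsto_rabs_zero[OF b3]] .
    show "\<bar>a M M * Us M * Vs M\<bar> \<le> \<bar>a M M\<bar> * (U * V)" for M
      using Ub Vb U0 V0 unfolding abs_mult mult.assoc by (intro mult_mono) auto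
  qed
  moreover have "(\<lambda>M. (\<Sum>n<M. (a n M - a (Suc n) M) * Us (Suc n)) * Vs M) \<longlonglongrightarrow> 0"
  proof (rule tendsto_zero_abs_le)
    show "(\<lambda>M. (\<Sum>n<M. \<bar>a n M - a (Suc n) M\<bar>) * (U * V)) \<longlonglongrightarrow> 0"
      using tendsto_mult_left_zero[OF b1] .
    fix M
    have "\<bar>\<Sum>n<M. (a n M - a (Suc n) M) * Us (Suc n)\<bar> \<le> (\<Sum>n<M. \<bar>a n M - a (Suc n) M\<bar>) * U"
      unfolding sum_distrib_right by (rule order_trans[OF sum_abs]) (auto intro!: sum_mono mult_left_mono Ub simp: abs_mult)
    then show "\<bar>(\<Sum>n<M. (a n M - a (Suc n) M) * Us (Suc n)) * Vs M\<bar>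
         \<le> (\<Sum>n<M. \<bar>a n M - a (Suc n) M\<bar>) * (U * V)"
      unfolding abs_mult mult.assoc[symmetric]
      by (rule mult_mono[OF _ Vb]) (auto intro!: mult_nonneg_nonneg sum_nonneg U0)
  qed
  moreover have "(\<lambda>M. (\<Sum>m<M. (a M m - a M (Suc m)) * Vs (Suc m)) * Us M) \<longlonglongrightarrow> 0"
  proof (rule tendsto_zero_abs_le)
    show "(\<lambda>M. (\<Sum>m<M. \<bar>a M m - a M (Suc m)\<bar>) * (V * U)) \<longlonglongrightarrow> 0"
      using tendsto_mult_left_zero[OF b2] .
    fix M
    have "\<bar>\<Sum>m<M. (a M m - a M (Suc m)) * Vs (Suc m)\<bar> \<le> (\<Sum>m<M. \<bar>a M m - a M (Suc m)\<bar>) * V"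
      unfolding sum_distrib_right by (rule order_trans[OF sum_abs]) (auto intro!: sum_mono mult_left_mono Vb simp: abs_mult)
    then show "\<bar>(\<Sum>m<M. (a M m - a M (Suc m)) * Vs (Suc m)) * Us M\<bar>
         \<le> (\<Sum>m<M. \<bar>a M m - a M (Suc m)\<bar>) * (V * U)"
      unfolding abs_mult mult.assoc[symmetric]
      by (rule mult_mono[OF _ Ub]) (auto intro!: mult_nonneg_nonneg sum_nonneg V0)
  qed
  ultimately have "(\<lambda>M. a M M * Us M * Vs M + (\<Sum>n<M. (a n M - a (Suc n) M) * Us (Suc n)) * Vs M
     + (\<Sum>m<M. (a M m - a M (Suc m)) * Vs (Suc m)) * Us M) \<longlonglongrightarrow> 0 + 0 + 0"
    by (intro tendsto_add)
  moreover
  let ?f = "\<lambda>p. D (fst p) (snd p) * Us (Suc (fst p)) * Vs (Suc (snd p))"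
  have "?f summable_on UNIV"
  proof -
    have ss: "s summable_on UNIV" using s by (intro norm_summable_imp_summable_on) simp
    then have "(s has_sum (infsum s UNIV)) UNIV" by (rule has_sum_infsum)
    from has_sum_cmult_right[OF this] summable_on_cmult_left[OF ss]
    have "(\<lambda>(n, m). s n * s m) summable_on (Sigma UNIV (\<lambda>_. UNIV))"
      by (intro summable_on_SigmaI[where g = "\<lambda>m. s m * infsum s UNIV"]) (use s in auto)
    then have g: "(\<lambda>p. s (fst p) * s (snd p) * (U * V)) summable_on UNIV"
      by (intro summable_on_cmult_left) (simp add: case_prod_beta')
    have f: "norm (?f p) \<le> s (fst p) * s (snd p) * (U * V)" for p
      unfolding real_norm_def abs_mult mult.assoc[symmetric] D_def
      by (intro mult_mono[OF mult_mono[OF dd Ub] Vb]) (auto intro!: mult_nonneg_nonneg U0 s(2))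
    have "(\<lambda>p. norm (?f p)) summable_on UNIV"
      by (rule Infinite_Sum.abs_summable_on_comparison_test'[OF g f])
    then show ?thesis by (rule Infinite_Sum.abs_summable_summable)
  qed
  then have "(?f has_sum (infsum ?f UNIV)) UNIV" by (rule has_sum_infsum)
  then have "(\<lambda>M. sum ?f ({..<M} \<times> {..<M})) \<longlonglongrightarrow> infsum ?f UNIV"
  proof (rule tendsto_sum_exhausting)
    show "eventually (\<lambda>n. x \<in> {..<n} \<times> {..<n}) sequentially" for x
      by (rule eventually_sequentiallyI[of "Suc (max (fst x) (snd x))"]) (cases x, auto)
  qed auto
  ultimately show ?thesis
    unfolding eq by (rule convergentI[OF tendsto_add])
qed

text \<open>For z = (n + 1) + i (m + 1) the real part of 1 / z is the weight (n + 1) / ((n + 1)^2 +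
  (m + 1)^2) of the series. Lattice differences of the weight are thus real parts of differences of
  one rational function, and each step by 1 or by i gains a power of 1 / |z|.\<close>

lemma cmod_inverse_differences:
  fixes z :: complex
  assumes "Re z > 0" "Im z > 0"
  shows "cmod (1 / z - 1 / (z + 1)) \<le> 1 / (cmod z)\<^sup>2"
    and "cmod (1 / z - 1 / (z + \<i>)) \<le> 1 / (cmod z)\<^sup>2"
    and "cmod (1 / z - 1 / (z + 1) - (1 / (z + \<i>) - 1 / (z + 1 + \<i>))) \<le> 3 / (cmod z) ^ 3"
proof -
  have nz: "z \<noteq> 0" "z + 1 \<noteq> 0" "z + \<i> \<noteq> 0" "z + 1 + \<i> \<noteq> 0"
    using assms by (auto simp: complex_eq_iff)
  have p: "cmod z > 0" using nz by simp
  have ge: "cmod z \<le> cmod (z + 1)" "cmod z \<le> cmod (z + \<i>)" "cmod z \<le> cmod (z + 1 + \<i>)"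
    using assms unfolding cmod_def by (auto intro!: real_sqrt_le_mono add_mono power_mono)
  have 1: "1 / z - 1 / (z + 1) = 1 / (z * (z + 1))" and 2: "1 / z - 1 / (z + \<i>) = \<i> / (z * (z + \<i>))"
    using nz diff_frac_eq[of z "z + 1" 1 1] diff_frac_eq[of z "z + \<i>" 1 1] by simp_all
  show "cmod (1 / z - 1 / (z + 1)) \<le> 1 / (cmod z)\<^sup>2"
    unfolding 1 norm_divide norm_mult power2_eq_square using ge p
    by (intro frac_le) (auto intro!: mult_left_mono)
  show "cmod (1 / z - 1 / (z + \<i>)) \<le> 1 / (cmod z)\<^sup>2"
    unfolding 2 norm_divide norm_mult power2_eq_square using ge p
    by (intro frac_le) (auto intro!: mult_left_mono)
  have 3: "1 / (z + \<i>) - 1 / (z + 1 + \<i>) = 1 / ((z + \<i>) * (z + 1 + \<i>))"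
    using nz diff_frac_eq[of "z + \<i>" "z + 1 + \<i>" 1 1] by simp
  have "1 / z - 1 / (z + 1) - (1 / (z + \<i>) - 1 / (z + 1 + \<i>))
     = ((z + \<i>) * (z + 1 + \<i>) - z * (z + 1)) / (z * (z + 1) * ((z + \<i>) * (z + 1 + \<i>)))"
    unfolding 1 3 using nz by (subst diff_frac_eq) auto
  also have "(z + \<i>) * (z + 1 + \<i>) - z * (z + 1) = \<i> * (z + (z + 1)) - 1"
    by (simp add: algebra_simps)
  also have "z * (z + 1) * ((z + \<i>) * (z + 1 + \<i>)) = (z + 1) * (z * ((z + \<i>) * (z + 1 + \<i>)))"
    by (simp only: mult_ac)
  finally have "cmod (1 / z - 1 / (z + 1) - (1 / (z + \<i>) - 1 / (z + 1 + \<i>)))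
     = cmod ((\<i> * (z + (z + 1)) - 1) / ((z + 1) * (z * ((z + \<i>) * (z + 1 + \<i>)))))" by (rule arg_cong)
  \<comment> \<open>The numerator is at most |z| + |z + 1| + 1, and each summand is at most |z + 1|.
    The factor z + 1 of the denominator was moved to the front to cancel against it; the remaining
    three factors are at least |z|.\<close>
  also have "\<dots> \<le> (3 * cmod (z + 1)) / (cmod (z + 1) * (cmod z * (cmod z * cmod z)))"
    unfolding norm_divide norm_mult
  proof (rule frac_le)
    have "1 \<le> cmod (z + 1)" using assms abs_Re_le_cmod[of "z + 1"] by simp
    moreover have "cmod (\<i> * (z + (z + 1)) - 1) \<le> cmod z + cmod (z + 1) + 1"
      by (rule order_trans[OF norm_triangle_ineq4]) (use norm_triangle_ineq[of z "z + 1"] in \<open>simp add: norm_mult\<close>)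
    ultimately show "cmod (\<i> * (z + (z + 1)) - 1) \<le> 3 * cmod (z + 1)"
      using ge by linarith
    show "cmod (z + 1) * (cmod z * (cmod z * cmod z))
       \<le> cmod (z + 1) * (cmod z * (cmod (z + \<i>) * cmod (z + 1 + \<i>)))"
      using ge by (intro mult_mono) auto
  qed (use nz p in auto)
  also have "\<dots> = 3 / cmod z ^ 3"
    using nz by (simp add: power3_eq_cube mult.assoc)
  finally show "cmod (1 / z - 1 / (z + 1) - (1 / (z + \<i>) - 1 / (z + 1 + \<i>))) \<le> 3 / (cmod z) ^ 3" .
qed

text \<open>Multiplication by 2 sin (phi / 2) telescopes the sum into a difference of two sines, so
  the bound is independent of the length.\<close>

lemma abs_sum_cos_le:
  fixes \<phi> b :: real
  assumes "sin (\<phi> / 2) \<noteq> 0"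
  shows "\<bar>\<Sum>i<n. cos (real i * \<phi> + b)\<bar> \<le> 1 / \<bar>sin (\<phi> / 2)\<bar>"
proof -
  let ?G = "\<lambda>i. sin ((real i - 1 / 2) * \<phi> + b)"
  have "2 * sin (\<phi> / 2) * (\<Sum>i<n. cos (real i * \<phi> + b)) = (\<Sum>i<n. ?G (Suc i) - ?G i)"
    unfolding sum_distrib_left
  proof (intro sum.cong refl)
    fix i
    have 1: "(real (Suc i) - 1 / 2) * \<phi> + b = (real i * \<phi> + b) + \<phi> / 2"
      and 2: "(real i - 1 / 2) * \<phi> + b = (real i * \<phi> + b) - \<phi> / 2"
      by (simp_all add: algebra_simps)
    show "2 * sin (\<phi> / 2) * cos (real i * \<phi> + b) = ?G (Suc i) - ?G i"
      unfolding 1 2 by (simp add: sin_add sin_diff)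
  qed
  also have "\<dots> = ?G n - ?G 0" by (rule sum_lessThan_telescope)
  finally have "\<bar>2 * sin (\<phi> / 2) * (\<Sum>i<n. cos (real i * \<phi> + b))\<bar> \<le> 2"
    using abs_sin_le_one[of "(real n - 1 / 2) * \<phi> + b"] abs_sin_le_one[of "(real 0 - 1 / 2) * \<phi> + b"]
    by linarith
  then show ?thesis using assms by (simp add: abs_mult field_simps)
qed

lemma sum_symmetric_int:
  fixes f :: "int \<Rightarrow> 'a::comm_monoid_add"
  shows "(\<Sum>k = - int M..int M. f k) = f 0 + (\<Sum>n<M. f (1 + int n) + f (- (1 + int n)))"
proof (induction M)
  case (Suc M)
  have "{- int (Suc M)..int (Suc M)} = insert (1 + int M) (insert (- (1 + int M)) {- int M..int M})"
    by auto
  then show ?case by (simp add: Suc add_ac)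
qed simp

text \<open>Contains the origin, unlike the index set of \<open>K_partial\<close>. There
  \<open>kperp\<close> and \<open>cross\<close> vanish, so the extra term is 0.\<close>

definition square :: "nat \<Rightarrow> (int \<times> int) set" where
  "square M = {- int M..int M} \<times> {- int M..int M}"

lemma finite_square [simp]: "finite (square M)"
  by (simp add: square_def)

definition sine_sum :: "nat \<Rightarrow> real \<Rightarrow> real \<Rightarrow> real" where
  "sine_sum M s t = (\<Sum>k\<in>square M. of_int (snd k) * sin (2 * pi * (of_int (fst k) * s + of_int (snd k) * t)) / knorm2 k)"

lemma K_partial_eq: "K_partial M x = (\<Sum>k\<in>square M. (- 2 * pi * sin (2 * pi * kdot k x) / knorm2 k) *\<^sub>R kperp k)"
proof -
  have "{k \<in> Z2_0. \<bar>fst k\<bar> \<le> int M \<and> \<bar>snd k\<bar> \<le> int M} = square M - {(0, 0)}"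
    by (auto simp: Z2_0_def square_def)
  then have "K_partial M x
      = (\<Sum>k\<in>square M - {(0, 0)}. (- 2 * pi * sin (2 * pi * kdot k x) / knorm2 k) *\<^sub>R kperp k)"
    by (simp only: K_partial_def)
  also have "\<dots> = (\<Sum>k\<in>square M. (- 2 * pi * sin (2 * pi * kdot k x) / knorm2 k) *\<^sub>R kperp k)"
    by (rule sum.mono_neutral_left) (auto simp: kperp_def zero_prod_def)
  finally show ?thesis .
qed

lemma K_partial_sine_sum:
  "K_partial M x = (- 2 * pi * sine_sum M (fst x) (snd x), 2 * pi * sine_sum M (snd x) (fst x))"
proof -
  have "fst (K_partial M x) = - 2 * pi * sine_sum M (fst x) (snd x)"
    unfolding K_partial_eq fst_sum sine_sum_def sum_distrib_left
    by (intro sum.cong) (auto simp: kdot_def kperp_def)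
  moreover have "snd (K_partial M x) = 2 * pi * sine_sum M (snd x) (fst x)"
  proof -
    have "(\<Sum>k\<in>square M. of_int (snd k) * sin (2 * pi * (of_int (fst k) * snd x + of_int (snd k) * fst x)) / knorm2 k)
       = (\<Sum>k\<in>square M. of_int (fst k) * sin (2 * pi * (of_int (snd k) * snd x + of_int (fst k) * fst x)) / knorm2 k)"
      by (rule sum.reindex_bij_witness[of _ prod.swap prod.swap]) (auto simp: square_def knorm2_def add.commute)
    then have "2 * pi * sine_sum M (snd x) (fst x)
       = 2 * pi * (\<Sum>k\<in>square M. of_int (fst k) * sin (2 * pi * (of_int (snd k) * snd x + of_int (fst k) * fst x)) / knorm2 k)"
      by (simp only: sine_sum_def)
    also have "\<dots> = snd (K_partial M x)"
      unfolding K_partial_eq snd_sum sum_distrib_left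
      by (intro sum.cong) (auto simp: kdot_def kperp_def add.commute)
    finally show ?thesis by simp
  qed
  ultimately show ?thesis by (simp add: prod_eq_iff)
qed

text \<open>Terms with second component 0 vanish and those with first component 0 form a sawtooth
  series. For the rest, the four sign choices combine by the addition formulas into 4 sin cos, which
  separates the variables as the double Dirichlet test requires.\<close>

lemma sine_sum_eq:
  "sine_sum M s t = 2 * (\<Sum>n<M. 1 / (1 + real n) * sin (2 * pi * (1 + real n) * t))
     + 4 * (\<Sum>n<M. \<Sum>m<M. (1 + real n) / ((1 + real n)\<^sup>2 + (1 + real m)\<^sup>2)
         * sin (2 * pi * (1 + real n) * t) * cos (2 * pi * (1 + real m) * s))"
proof -
  define F where "F k l = of_int l * sin (2 * pi * (of_int k * s + of_int l * t)) / (of_int k ^ 2 + of_int l ^ 2)" for k l :: int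
  have "sine_sum M s t = (\<Sum>l = - int M..int M. \<Sum>k = - int M..int M. F k l)"
    unfolding sine_sum_def square_def
    by (subst sum.swap) (simp add: sum.cartesian_product F_def knorm2_def case_prod_beta')
  also have "\<dots> = (\<Sum>n<M. F 0 (1 + int n) + F 0 (- (1 + int n)))
     + (\<Sum>n<M. \<Sum>m<M. (F (1 + int m) (1 + int n) + F (- (1 + int m)) (1 + int n))
         + (F (1 + int m) (- (1 + int n)) + F (- (1 + int m)) (- (1 + int n))))"
    unfolding sum_symmetric_int by (simp add: sum.distrib F_def add_ac)
  also have "(\<Sum>n<M. F 0 (1 + int n) + F 0 (- (1 + int n)))
      = 2 * (\<Sum>n<M. 1 / (1 + real n) * sin (2 * pi * (1 + real n) * t))"
    unfolding sum_distrib_left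
  proof (intro sum.cong refl)
    fix n
    have F0: "F 0 l = sin (2 * pi * of_int l * t) / of_int l" for l
      by (cases "l = 0") (simp_all add: F_def power2_eq_square mult.assoc)
    have "F 0 (- l) = F 0 l" for l
      unfolding F0 by simp
    from this[of "1 + int n"] F0[of "1 + int n"]
    show "F 0 (1 + int n) + F 0 (- (1 + int n)) = 2 * (1 / (1 + real n) * sin (2 * pi * (1 + real n) * t))"
      by simp
  qed
  also have "(\<Sum>n<M. \<Sum>m<M. (F (1 + int m) (1 + int n) + F (- (1 + int m)) (1 + int n))
         + (F (1 + int m) (- (1 + int n)) + F (- (1 + int m)) (- (1 + int n))))
      = 4 * (\<Sum>n<M. \<Sum>m<M. (1 + real n) / ((1 + real n)\<^sup>2 + (1 + real m)\<^sup>2)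
         * sin (2 * pi * (1 + real n) * t) * cos (2 * pi * (1 + real m) * s))"
    unfolding sum_distrib_left
  proof (intro sum.cong refl)
    fix n m
    define p where "p = 1 + real m"
    define q where "q = 1 + real n"
    define A where "A = 2 * pi * p * s"
    define B where "B = 2 * pi * q * t"
    define c where "c = q / (q\<^sup>2 + p\<^sup>2)"
    have F: "F k l = of_int l / (of_int l ^ 2 + of_int k ^ 2) * sin (2 * pi * of_int k * s + 2 * pi * of_int l * t)" for k l
      by (simp add: F_def algebra_simps)
    have "F (1 + int m) (1 + int n) = c * sin (A + B)" "F (- (1 + int m)) (1 + int n) = c * sin (- A + B)"
      "F (1 + int m) (- (1 + int n)) = - c * sin (A - B)" "F (- (1 + int m)) (- (1 + int n)) = - c * sin (- A - B)"
      unfolding F of_int_minus of_int_add of_int_1 of_int_of_nat_eq p_def[symmetric] q_def[symmetric]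
      by (simp_all add: c_def A_def B_def)
    then show "(F (1 + int m) (1 + int n) + F (- (1 + int m)) (1 + int n))
         + (F (1 + int m) (- (1 + int n)) + F (- (1 + int m)) (- (1 + int n)))
        = 4 * ((1 + real n) / ((1 + real n)\<^sup>2 + (1 + real m)\<^sup>2)
         * sin (2 * pi * (1 + real n) * t) * cos (2 * pi * (1 + real m) * s))"
      unfolding p_def[symmetric] q_def[symmetric] c_def[symmetric] A_def[symmetric] B_def[symmetric]
      by (simp add: sin_add sin_diff algebra_simps)
  qed
  finally show ?thesis .
qed

text \<open>Off the integers sin (pi s) and sin (pi t) are nonzero, which bounds the partial sums of
  the cosines in s and of the sines in t.\<close>

lemma convergent_sine_sum:
  assumes "s \<notin> \<int>" "t \<notin> \<int>"
  shows "convergent (\<lambda>M. sine_sum M s t)"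
proof -
  define u where "u n = sin (2 * pi * (1 + real n) * t)" for n
  define v where "v m = cos (2 * pi * (1 + real m) * s)" for m
  define z where "z n m = Complex (1 + real n) (1 + real m)" for n m
  define a where "a n m = Re (1 / z n m)" for n m
  have sn: "sin (2 * pi * r / 2) \<noteq> 0" if "r \<notin> \<int>" for r
  proof
    assume "sin (2 * pi * r / 2) = 0"
    then obtain i :: int where "pi * r = of_int i * pi" by (auto simp: sin_zero_iff_int2)
    then have "r = of_int i" by simp
    then show False using that by simp
  qed
  have u: "\<bar>\<Sum>i<n. u i\<bar> \<le> 1 / \<bar>sin (2 * pi * t / 2)\<bar>" for n
  proof -
    have "u i = cos (real i * (2 * pi * t) + (2 * pi * t - pi / 2))" for i
      unfolding u_def sin_cos_eq by (subst cos_minus[symmetric]) (simp add: algebra_simps)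
    then show ?thesis using abs_sum_cos_le[OF sn[OF assms(2)]] by simp
  qed
  have v: "\<bar>\<Sum>i<n. v i\<bar> \<le> 1 / \<bar>sin (2 * pi * s / 2)\<bar>" for n
  proof -
    have "v i = cos (real i * (2 * pi * s) + 2 * pi * s)" for i
      unfolding v_def by (simp add: algebra_simps)
    then show ?thesis using abs_sum_cos_le[OF sn[OF assms(1)]] by simp
  qed
  have a_eq: "a n m = (1 + real n) / ((1 + real n)\<^sup>2 + (1 + real m)\<^sup>2)" for n m
    by (simp add: a_def z_def Re_divide)
  have zpos: "Re (z n m) > 0" "Im (z n m) > 0" for n m by (simp_all add: z_def)
  have zS: "z (Suc n) m = z n m + 1" "z n (Suc m) = z n m + \<i>" "z (Suc n) (Suc m) = z n m + 1 + \<i>" for n m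
    by (simp_all add: z_def complex_eq_iff)
  have d1: "\<bar>a n m - a (Suc n) m\<bar> \<le> 1 / (cmod (z n m))\<^sup>2" for n m
    using abs_Re_le_cmod[of "1 / z n m - 1 / z (Suc n) m"] cmod_inverse_differences(1)[OF zpos, of n m]
    by (simp add: a_def zS)
  have d2: "\<bar>a n m - a n (Suc m)\<bar> \<le> 1 / (cmod (z n m))\<^sup>2" for n m
    using abs_Re_le_cmod[of "1 / z n m - 1 / z n (Suc m)"] cmod_inverse_differences(2)[OF zpos, of n m]
    by (simp add: a_def zS)
  have zn: "(cmod (z n m))\<^sup>2 = (1 + real n)\<^sup>2 + (1 + real m)\<^sup>2" for n m
    by (simp add: z_def cmod_power2)
  have lim: "(\<lambda>M. 1 / (1 + real M)) \<longlonglongrightarrow> 0" by real_asymp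
  \<comment> \<open>For the boundary terms: along an edge of the index square |z| >= 1 + M, so M
    differences of size at most 1 / (1 + M)^2 are added.\<close>
  have bnd: "(\<Sum>n<M. \<bar>f n\<bar>) \<le> 1 / (1 + real M)" if "\<And>n. \<bar>f n\<bar> \<le> 1 / (1 + real M)\<^sup>2" for f :: "nat \<Rightarrow> real" and M
  proof -
    have "(\<Sum>n<M. \<bar>f n\<bar>) \<le> (\<Sum>n<M. 1 / (1 + real M)\<^sup>2)" by (intro sum_mono that)
    also have "\<dots> = real M / (1 + real M)\<^sup>2" by simp
    also have "\<dots> \<le> (1 + real M) / (1 + real M)\<^sup>2" by (intro divide_right_mono) auto
    also have "\<dots> = 1 / (1 + real M)" by (simp add: power2_eq_square)
    finally show ?thesis .
  qed
  have "convergent (\<lambda>M. \<Sum>n<M. \<Sum>m<M. a n m * u n * v m)"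
  \<comment> \<open>From |z|^2 >= 2 (1 + n) (1 + m) the bound 3 |z|^(-3) splits into factors of one
    variable with the summable exponent - 3/2. The constant 3 is put into both factors to match the
    form s n * s m.\<close>
  proof (rule double_Dirichlet_test[OF u v, where s = "\<lambda>n. 3 * (1 + real n) powr (- 3 / 2)"])
    fix n m
    have "\<bar>a n m - a (Suc n) m - (a n (Suc m) - a (Suc n) (Suc m))\<bar> \<le> 3 / cmod (z n m) ^ 3"
      using abs_Re_le_cmod[of "1 / z n m - 1 / z (Suc n) m - (1 / z n (Suc m) - 1 / z (Suc n) (Suc m))"]
        cmod_inverse_differences(3)[OF zpos, of n m]
      by (simp add: a_def zS)
    also have "cmod (z n m) ^ 3 = ((cmod (z n m))\<^sup>2) powr (3 / 2)"
    proof -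
      have "cmod (z n m) > 0" using zpos[of n m] by auto
      then show ?thesis
        using powr_powr[of "cmod (z n m)" 2 "3 / 2"] by simp
    qed
    also have "3 / \<dots> = 3 * ((cmod (z n m))\<^sup>2) powr (- 3 / 2)"
      by (simp add: powr_minus divide_simps)
    also have "\<dots> \<le> 3 * ((1 + real n) * (1 + real m)) powr (- 3 / 2)"
    proof -
      have "2 * (1 + real n) * (1 + real m) \<le> (cmod (z n m))\<^sup>2"
        unfolding zn by (rule sum_squares_bound)
      moreover have "0 < (1 + real n) * (1 + real m)" by simp
      ultimately have "(1 + real n) * (1 + real m) \<le> (cmod (z n m))\<^sup>2" by linarith
      then show ?thesis by (intro mult_left_mono powr_mono2') auto
    qed
    also have "\<dots> \<le> 3 * (1 + real n) powr (- 3 / 2) * (3 * (1 + real m) powr (- 3 / 2))"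
      by (simp add: powr_mult)
    finally show "\<bar>a n m - a (Suc n) m - (a n (Suc m) - a (Suc n) (Suc m))\<bar>
        \<le> 3 * (1 + real n) powr (- 3 / 2) * (3 * (1 + real m) powr (- 3 / 2))" .
  next
    have "summable (\<lambda>n. real n powr (- 3 / 2))" by (simp add: summable_real_powr_iff)
    then show "summable (\<lambda>n. 3 * (1 + real n) powr (- 3 / 2))"
      using summable_ignore_initial_segment[of "\<lambda>n. real n powr (- 3 / 2)" 1] by (intro summable_mult) (simp add: add.commute)
  next
    show "(\<lambda>M. \<Sum>n<M. \<bar>a n M - a (Suc n) M\<bar>) \<longlonglongrightarrow> 0"
    proof (rule tendsto_zero_abs_le[OF lim])
      fix M
      have "\<bar>a n M - a (Suc n) M\<bar> \<le> 1 / (1 + real M)\<^sup>2" for n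
        by (rule order_trans[OF d1]) (auto simp: zn intro!: divide_left_mono mult_pos_pos add_pos_pos)
      from bnd[OF this] show "\<bar>\<Sum>n<M. \<bar>a n M - a (Suc n) M\<bar>\<bar> \<le> 1 / (1 + real M)"
        by (simp add: abs_of_nonneg sum_nonneg)
    qed
    show "(\<lambda>M. \<Sum>m<M. \<bar>a M m - a M (Suc m)\<bar>) \<longlonglongrightarrow> 0"
    proof (rule tendsto_zero_abs_le[OF lim])
      fix M
      have "\<bar>a M m - a M (Suc m)\<bar> \<le> 1 / (1 + real M)\<^sup>2" for m
        by (rule order_trans[OF d2]) (auto simp: zn intro!: divide_left_mono mult_pos_pos add_pos_pos)
      from bnd[OF this] show "\<bar>\<Sum>m<M. \<bar>a M m - a M (Suc m)\<bar>\<bar> \<le> 1 / (1 + real M)"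
        by (simp add: abs_of_nonneg sum_nonneg)
    qed
    show "(\<lambda>M. a M M) \<longlonglongrightarrow> 0" unfolding a_eq by real_asymp
  qed simp
  moreover have "convergent (\<lambda>M. \<Sum>n<M. 1 / (1 + real n) * u n)"
    by (rule Dirichlet_test[OF u lim]) (auto simp: decseq_def intro!: divide_left_mono)
  ultimately show ?thesis
    unfolding sine_sum_eq a_eq u_def v_def
    by (intro convergent_add) (simp_all add: convergent_mult_const_iff)
qed

text \<open>The excluded lines form a null set, so this gives convergence almost everywhere.\<close>

lemma convergent_K_partial:
  assumes "fst x \<notin> \<int>" "snd x \<notin> \<int>"
  shows "convergent (\<lambda>M. K_partial M x)"
proof -
  obtain p q where "(\<lambda>M. sine_sum M (fst x) (snd x)) \<longlonglongrightarrow> p" "(\<lambda>M. sine_sum M (snd x) (fst x)) \<longlonglongrightarrow> q"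
    using convergent_sine_sum[OF assms] convergent_sine_sum[OF assms(2,1)] unfolding convergent_def by auto
  then have "(\<lambda>M. K_partial M x) \<longlonglongrightarrow> (- 2 * pi * p, 2 * pi * q)"
    unfolding K_partial_sine_sum by (intro tendsto_Pair tendsto_mult tendsto_const)
  then show ?thesis by (auto simp: convergent_def)
qed

section \<open>Quadratic forms of independent Gaussians\<close>

abbreviation gauss :: "real measure" where
  "gauss \<equiv> density lborel std_normal_density"

interpretation gauss: prob_space gauss
  by (rule prob_space_normal_density) simp

interpretation gauss_prod: product_prob_space "\<lambda>_. gauss" Z2_0 ..

interpretation mu: prob_space mu
  unfolding mu_def by (rule gauss_prod.prob_space_axioms)

text \<open>The Hermite polynomials 1, y and y^2 - 1 are orthogonal for the standard Gaussian, with
  squared norms 1, 1 and 2. The proof expands the square and inserts the moments 1, 0, 1, 0,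
  3.\<close>

lemma nn_integral_gauss_quadratic:
  "(\<integral>\<^sup>+ y. ennreal ((A + B * (y\<^sup>2 - 1) + C * y)\<^sup>2) \<partial>gauss) = ennreal (A\<^sup>2 + 2 * B\<^sup>2 + C\<^sup>2)"
proof -
  let ?d = std_normal_density
  have m0: "has_bochner_integral lborel (\<lambda>y. ?d y) 1"
    using std_normal_moment_even[of 0] by simp
  have m1: "has_bochner_integral lborel (\<lambda>y. ?d y * y) 0"
    using std_normal_moment_odd[of 0] by simp
  have m2: "has_bochner_integral lborel (\<lambda>y. ?d y * y\<^sup>2) 1"
    using std_normal_moment_even[of 1] by simp
  have m3: "has_bochner_integral lborel (\<lambda>y. ?d y * y ^ 3) 0"
    using std_normal_moment_odd[of 1] by (simp add: eval_nat_numeral)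
  have m4: "has_bochner_integral lborel (\<lambda>y. ?d y * y ^ 4) 3"
    using std_normal_moment_even[of 2] by (simp add: fact_numeral)
  have "has_bochner_integral lborel
      (\<lambda>y. (A - B)\<^sup>2 * ?d y + (2 * (A - B) * C) * (?d y * y) + (C\<^sup>2 + 2 * (A - B) * B) * (?d y * y\<^sup>2)
        + (2 * B * C) * (?d y * y ^ 3) + B\<^sup>2 * (?d y * y ^ 4))
      ((A - B)\<^sup>2 * 1 + (2 * (A - B) * C) * 0 + (C\<^sup>2 + 2 * (A - B) * B) * 1 + (2 * B * C) * 0 + B\<^sup>2 * 3)"
    by (intro has_bochner_integral_add has_bochner_integral_mult_right m0 m1 m2 m3 m4)
  also have "(\<lambda>y. (A - B)\<^sup>2 * ?d y + (2 * (A - B) * C) * (?d y * y) + (C\<^sup>2 + 2 * (A - B) * B) * (?d y * y\<^sup>2)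
        + (2 * B * C) * (?d y * y ^ 3) + B\<^sup>2 * (?d y * y ^ 4))
      = (\<lambda>y. ?d y * (A + B * (y\<^sup>2 - 1) + C * y)\<^sup>2)"
    by (intro ext) algebra
  also have "(A - B)\<^sup>2 * 1 + (2 * (A - B) * C) * 0 + (C\<^sup>2 + 2 * (A - B) * B) * 1 + (2 * B * C) * 0 + B\<^sup>2 * 3
      = A\<^sup>2 + 2 * B\<^sup>2 + C\<^sup>2"
    by algebra
  finally have *: "has_bochner_integral lborel (\<lambda>y. ?d y * (A + B * (y\<^sup>2 - 1) + C * y)\<^sup>2) (A\<^sup>2 + 2 * B\<^sup>2 + C\<^sup>2)" .
  have "(\<integral>\<^sup>+ y. ennreal ((A + B * (y\<^sup>2 - 1) + C * y)\<^sup>2) \<partial>gauss)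
      = (\<integral>\<^sup>+ y. ennreal (?d y * (A + B * (y\<^sup>2 - 1) + C * y)\<^sup>2) \<partial>lborel)"
    by (subst nn_integral_density) (auto simp: ennreal_mult)
  also have "\<dots> = ennreal (A\<^sup>2 + 2 * B\<^sup>2 + C\<^sup>2)"
    using * by (subst nn_integral_eq_integral) (auto simp: has_bochner_integral_iff)
  finally show ?thesis .
qed

lemma borel_measurable_component_gauss:
  "k \<in> F \<Longrightarrow> (\<lambda>\<xi>. \<xi> k) \<in> borel_measurable (PiM F (\<lambda>_. gauss))"
  using measurable_component_singleton[of k F "\<lambda>_. gauss"] by (simp cong: measurable_cong_sets)

lemma nn_integral_linear_gauss:
  assumes "finite F"
  shows "(\<integral>\<^sup>+ \<xi>. ennreal ((\<Sum>k\<in>F. c k * \<xi> k)\<^sup>2) \<partial>PiM F (\<lambda>_. gauss)) = ennreal (\<Sum>k\<in>F. (c k)\<^sup>2)"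
  using assms
proof (induction F rule: finite_induct)
  case empty
  then show ?case by simp
next
  case (insert z F)
  have [measurable]: "(\<lambda>\<xi>. ennreal ((\<Sum>k\<in>F. c k * \<xi> k)\<^sup>2)) \<in> borel_measurable (PiM F (\<lambda>_. gauss))"
    by (intro measurable_compose[OF _ measurable_ennreal] borel_measurable_power borel_measurable_sum
        borel_measurable_times borel_measurable_const borel_measurable_component_gauss)
  have meas: "(\<lambda>\<xi>. ennreal ((\<Sum>k\<in>insert z F. c k * \<xi> k)\<^sup>2)) \<in> borel_measurable (PiM (insert z F) (\<lambda>_. gauss))"
    by (intro measurable_compose[OF _ measurable_ennreal] borel_measurable_power borel_measurable_sum
        borel_measurable_times borel_measurable_const borel_measurable_component_gauss)
  \<comment> \<open>The coefficient 0 of y^2 - 1 is written out so that the quadratic Gaussian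
    integral applies when the coordinate z is integrated out.\<close>
  have upd: "(\<Sum>k\<in>insert z F. c k * (\<xi>(z := y)) k) = (\<Sum>k\<in>F. c k * \<xi> k) + 0 * (y\<^sup>2 - 1) + c z * y" for \<xi> :: "'a \<Rightarrow> real" and y
    using insert by (auto intro!: sum.cong)
  have "(\<integral>\<^sup>+ \<xi>. ennreal ((\<Sum>k\<in>insert z F. c k * \<xi> k)\<^sup>2) \<partial>PiM (insert z F) (\<lambda>_. gauss))
     = (\<integral>\<^sup>+ \<xi>. (\<integral>\<^sup>+ y. ennreal ((\<Sum>k\<in>insert z F. c k * (\<xi>(z := y)) k)\<^sup>2) \<partial>gauss) \<partial>PiM F (\<lambda>_. gauss))"
    using product_sigma_finite.product_nn_integral_insert[of "\<lambda>_. gauss", OF _ insert(1,2) meas]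
    by (simp add: product_sigma_finite_def gauss.sigma_finite_measure_axioms)
  also have "\<dots> = (\<integral>\<^sup>+ \<xi>. ennreal ((\<Sum>k\<in>F. c k * \<xi> k)\<^sup>2) + ennreal ((c z)\<^sup>2) \<partial>PiM F (\<lambda>_. gauss))"
    unfolding upd nn_integral_gauss_quadratic by (simp add: ennreal_plus)
  also have "\<dots> = ennreal (\<Sum>k\<in>F. (c k)\<^sup>2) + ennreal ((c z)\<^sup>2)"
  proof -
    interpret P: prob_space "PiM F (\<lambda>_. gauss)"
      by (intro prob_space_PiM gauss.prob_space_axioms)
    show ?thesis
      by (subst nn_integral_add) (simp_all add: insert.IH P.emeasure_space_1)
  qed
  also have "\<dots> = ennreal (\<Sum>k\<in>insert z F. (c k)\<^sup>2)"
    using insert by (simp add: ennreal_plus[symmetric] sum_nonneg add.commute del: ennreal_plus)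
  finally show ?case .
qed

text \<open>Second order Wick product: under independent standard Gaussian coordinates the
  subtracted diagonal is the expectation of the product.\<close>

definition wick :: "'k \<times> 'k \<Rightarrow> ('k \<Rightarrow> real) \<Rightarrow> real" where
  "wick i \<xi> = \<xi> (fst i) * \<xi> (snd i) - (if fst i = snd i then 1 else 0)"

definition wick_sum :: "'k set \<Rightarrow> ('k \<times> 'k \<Rightarrow> real) \<Rightarrow> ('k \<Rightarrow> real) \<Rightarrow> real" where
  "wick_sum F a \<xi> = (\<Sum>i\<in>F \<times> F. a i * wick i \<xi>)"

lemma sum_insert_Times:
  fixes f :: "'k \<times> 'k \<Rightarrow> 'b::comm_monoid_add"
  assumes "finite F" "z \<notin> F"
  shows "sum f (insert z F \<times> insert z F) = sum f (F \<times> F) + f (z, z) + (\<Sum>k\<in>F. f (k, z) + f (z, k))"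
proof -
  have S: "sum f (A \<times> B) = (\<Sum>x\<in>A. \<Sum>y\<in>B. f (x, y))" for A B
    by (simp add: sum.cartesian_product)
  show ?thesis unfolding S using assms by (simp add: sum.distrib add_ac)
qed

lemma borel_measurable_wick_sum:
  "F \<subseteq> G \<Longrightarrow> wick_sum F a \<in> borel_measurable (PiM G (\<lambda>_. gauss))"
  unfolding wick_sum_def wick_def
  by (intro borel_measurable_sum borel_measurable_times borel_measurable_const borel_measurable_diff
      borel_measurable_component_gauss) auto

text \<open>In one coordinate y = \<open>\<xi> z\<close> the form reads A + B (y^2 - 1) + C y, so
  integrating that coordinate out splits off orthogonal pieces. The coefficients \<open>a\<close>
  need not be symmetric: the exact variance involves (a_kl + a_lk)^2, which is estimated by 2
  (a_kl^2 + a_lk^2). Hence an inequality with the factor 2.\<close>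

lemma nn_integral_wick_sum_PiM:
  assumes "finite F"
  shows "(\<integral>\<^sup>+ \<xi>. ennreal ((wick_sum F a \<xi>)\<^sup>2) \<partial>PiM F (\<lambda>_. gauss)) \<le> ennreal (2 * (\<Sum>i\<in>F \<times> F. (a i)\<^sup>2))"
  using assms
proof (induction F rule: finite_induct)
  case empty
  then show ?case by (simp add: wick_sum_def)
next
  case (insert z F)
  interpret P: prob_space "PiM F (\<lambda>_. gauss)"
    by (intro prob_space_PiM gauss.prob_space_axioms)
  define c where "c k = a (k, z) + a (z, k)" for k
  have m1[measurable]: "(\<lambda>\<xi>. ennreal ((\<Sum>k\<in>F. c k * \<xi> k)\<^sup>2)) \<in> borel_measurable (PiM F (\<lambda>_. gauss))"
    by (intro measurable_compose[OF _ measurable_ennreal] borel_measurable_power borel_measurable_sum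
        borel_measurable_times borel_measurable_const borel_measurable_component_gauss)
  have m2[measurable]: "(\<lambda>\<xi>. ennreal ((wick_sum F a \<xi>)\<^sup>2)) \<in> borel_measurable (PiM F (\<lambda>_. gauss))"
    by (intro measurable_compose[OF _ measurable_ennreal] borel_measurable_power borel_measurable_wick_sum) simp
  have meas: "(\<lambda>\<xi>. ennreal ((wick_sum (insert z F) a \<xi>)\<^sup>2)) \<in> borel_measurable (PiM (insert z F) (\<lambda>_. gauss))"
    by (intro measurable_compose[OF _ measurable_ennreal] borel_measurable_power borel_measurable_wick_sum) simp
  have upd: "wick_sum (insert z F) a (\<xi>(z := y))
      = wick_sum F a \<xi> + a (z, z) * (y\<^sup>2 - 1) + (\<Sum>k\<in>F. c k * \<xi> k) * y" for \<xi> y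
  proof -
    have "(\<Sum>i\<in>F \<times> F. a i * wick i (\<xi>(z := y))) = wick_sum F a \<xi>"
      unfolding wick_sum_def using insert by (intro sum.cong) (auto simp: wick_def)
    moreover have "(\<Sum>k\<in>F. a (k, z) * wick (k, z) (\<xi>(z := y)) + a (z, k) * wick (z, k) (\<xi>(z := y)))
        = (\<Sum>k\<in>F. c k * \<xi> k) * y"
      unfolding sum_distrib_right using insert
      by (intro sum.cong) (auto simp: wick_def c_def algebra_simps)
    ultimately show ?thesis
      unfolding wick_sum_def[of "insert z F"] sum_insert_Times[OF insert(1,2)]
      by (simp add: wick_def power2_eq_square)
  qed
  have "(\<integral>\<^sup>+ \<xi>. ennreal ((wick_sum (insert z F) a \<xi>)\<^sup>2) \<partial>PiM (insert z F) (\<lambda>_. gauss))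
     = (\<integral>\<^sup>+ \<xi>. (\<integral>\<^sup>+ y. ennreal ((wick_sum (insert z F) a (\<xi>(z := y)))\<^sup>2) \<partial>gauss) \<partial>PiM F (\<lambda>_. gauss))"
    using product_sigma_finite.product_nn_integral_insert[of "\<lambda>_. gauss", OF _ insert(1,2) meas]
    by (simp add: product_sigma_finite_def gauss.sigma_finite_measure_axioms)
  also have "\<dots> = (\<integral>\<^sup>+ \<xi>. (ennreal ((wick_sum F a \<xi>)\<^sup>2) + ennreal (2 * (a (z, z))\<^sup>2))
        + ennreal ((\<Sum>k\<in>F. c k * \<xi> k)\<^sup>2) \<partial>PiM F (\<lambda>_. gauss))"
    unfolding upd nn_integral_gauss_quadratic by (simp add: ennreal_plus)
  also have "\<dots> = ((\<integral>\<^sup>+ \<xi>. ennreal ((wick_sum F a \<xi>)\<^sup>2) \<partial>PiM F (\<lambda>_. gauss)) + ennreal (2 * (a (z, z))\<^sup>2))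
      + ennreal (\<Sum>k\<in>F. (c k)\<^sup>2)"
    using m1 m2
    by (simp add: nn_integral_add nn_integral_linear_gauss[OF insert(1)] P.emeasure_space_1
        del: measurable_ennreal borel_measurable_ennreal_iff)
  also have "\<dots> \<le> (ennreal (2 * (\<Sum>i\<in>F \<times> F. (a i)\<^sup>2)) + ennreal (2 * (a (z, z))\<^sup>2))
      + ennreal (\<Sum>k\<in>F. (c k)\<^sup>2)"
    by (intro add_mono insert.IH order_refl)
  also have "\<dots> = ennreal (2 * (\<Sum>i\<in>F \<times> F. (a i)\<^sup>2) + 2 * (a (z, z))\<^sup>2 + (\<Sum>k\<in>F. (c k)\<^sup>2))"
    by (simp add: ennreal_plus[symmetric] sum_nonneg del: ennreal_plus)
  also have "\<dots> \<le> ennreal (2 * (\<Sum>i\<in>insert z F \<times> insert z F. (a i)\<^sup>2))"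
  proof (rule ennreal_leI)
    have "(c k)\<^sup>2 \<le> 2 * ((a (k, z))\<^sup>2 + (a (z, k))\<^sup>2)" for k
      using sum_squares_bound[of "a (k, z)" "a (z, k)"] by (simp add: c_def power2_sum)
    then have "(\<Sum>k\<in>F. (c k)\<^sup>2) \<le> (\<Sum>k\<in>F. 2 * ((a (k, z))\<^sup>2 + (a (z, k))\<^sup>2))"
      by (intro sum_mono)
    then show "2 * (\<Sum>i\<in>F \<times> F. (a i)\<^sup>2) + 2 * (a (z, z))\<^sup>2 + (\<Sum>k\<in>F. (c k)\<^sup>2)
        \<le> 2 * (\<Sum>i\<in>insert z F \<times> insert z F. (a i)\<^sup>2)"
      unfolding sum_insert_Times[OF insert(1,2)] by (simp add: sum_distrib_left algebra_simps)
  qed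
  finally show ?case .
qed

lemma borel_measurable_wick_sum_mu [measurable]: "F \<subseteq> Z2_0 \<Longrightarrow> wick_sum F a \<in> borel_measurable mu"
  unfolding mu_def by (rule borel_measurable_wick_sum)

lemma nn_integral_wick_sum:
  assumes F: "finite F" "F \<subseteq> Z2_0"
  shows "(\<integral>\<^sup>+ \<xi>. ennreal ((wick_sum F a \<xi>)\<^sup>2) \<partial>mu) \<le> ennreal (2 * (\<Sum>i\<in>F \<times> F. (a i)\<^sup>2))"
proof -
  have restr: "wick_sum F a (restrict \<xi> F) = wick_sum F a \<xi>" for \<xi>
    unfolding wick_sum_def by (intro sum.cong) (auto simp: wick_def)
  have "(\<integral>\<^sup>+ \<xi>. ennreal ((wick_sum F a \<xi>)\<^sup>2) \<partial>PiM F (\<lambda>_. gauss))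
      = (\<integral>\<^sup>+ \<xi>. ennreal ((wick_sum F a \<xi>)\<^sup>2) \<partial>distr mu (PiM F (\<lambda>_. gauss)) (\<lambda>\<xi>. restrict \<xi> F))"
    unfolding mu_def by (simp add: gauss_prod.distr_PiM_restrict_finite[OF F])
  also have "\<dots> = (\<integral>\<^sup>+ \<xi>. ennreal ((wick_sum F a (restrict \<xi> F))\<^sup>2) \<partial>mu)"
    using F unfolding mu_def
    by (intro nn_integral_distr measurable_restrict_subset measurable_compose[OF _ measurable_ennreal]
        borel_measurable_power) (auto intro!: borel_measurable_wick_sum)
  finally show ?thesis
    using nn_integral_wick_sum_PiM[OF F(1), of a] by (simp add: restr)
qed

lemma wick_sum_diff_subset:
  assumes "finite F" "E \<subseteq> F"
  shows "wick_sum F a \<xi> - wick_sum E a \<xi> = wick_sum F (\<lambda>i. if i \<in> E \<times> E then 0 else a i) \<xi>"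
proof -
  have "wick_sum F a \<xi> = (\<Sum>i\<in>F \<times> F - E \<times> E. a i * wick i \<xi>) + wick_sum E a \<xi>"
    unfolding wick_sum_def using assms by (intro sum.subset_diff) auto
  moreover have "wick_sum F (\<lambda>i. if i \<in> E \<times> E then 0 else a i) \<xi> = (\<Sum>i\<in>F \<times> F - E \<times> E. a i * wick i \<xi>)"
    unfolding wick_sum_def using assms by (intro sum.mono_neutral_cong_right) auto
  ultimately show ?thesis by simp
qed

text \<open>The difference is the Wick sum with the coefficients in E x E set to 0, so increments of
  Wick sums are controlled by increments of the sums of squares.\<close>

lemma nn_integral_wick_sum_diff:
  assumes "finite F" "E \<subseteq> F" "F \<subseteq> Z2_0"
  shows "(\<integral>\<^sup>+ \<xi>. ennreal ((wick_sum F a \<xi> - wick_sum E a \<xi>)\<^sup>2) \<partial>mu)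
     \<le> ennreal (2 * ((\<Sum>i\<in>F \<times> F. (a i)\<^sup>2) - (\<Sum>i\<in>E \<times> E. (a i)\<^sup>2)))"
proof -
  have "(\<Sum>i\<in>F \<times> F. (if i \<in> E \<times> E then 0 else a i)\<^sup>2) = (\<Sum>i\<in>F \<times> F - E \<times> E. (a i)\<^sup>2)"
    using assms by (intro sum.mono_neutral_cong_right) auto
  also have "\<dots> = (\<Sum>i\<in>F \<times> F. (a i)\<^sup>2) - (\<Sum>i\<in>E \<times> E. (a i)\<^sup>2)"
    using assms by (intro sum_diff) auto
  finally show ?thesis
    using nn_integral_wick_sum[OF assms(1,3), of "\<lambda>i. if i \<in> E \<times> E then 0 else a i"]
    by (simp add: wick_sum_diff_subset[OF assms(1,2)])
qed

text \<open>Combines almost everywhere convergence with mean square bounds: to identify the kernel,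
  to complete L2, and to pass from \<open>pair_quad\<close> to \<open>pair_smooth\<close>.\<close>

lemma Fatou_sq:
  fixes f :: "nat \<Rightarrow> 'a \<Rightarrow> real"
  assumes meas: "\<And>n. f n \<in> borel_measurable M" and lim: "AE x in M. (\<lambda>n. f n x) \<longlonglongrightarrow> g x"
    and le: "\<And>n. (\<integral>\<^sup>+ x. ennreal ((f n x)\<^sup>2) \<partial>M) \<le> c n" and c: "c \<longlonglongrightarrow> C"
  shows "(\<integral>\<^sup>+ x. ennreal ((g x)\<^sup>2) \<partial>M) \<le> C"
proof -
  note [measurable] = meas
  have "(\<integral>\<^sup>+ x. ennreal ((g x)\<^sup>2) \<partial>M) = (\<integral>\<^sup>+ x. liminf (\<lambda>n. ennreal ((f n x)\<^sup>2)) \<partial>M)"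
  proof (rule nn_integral_cong_AE, use lim in eventually_elim)
    case (elim x)
    then have "(\<lambda>n. ennreal ((f n x)\<^sup>2)) \<longlonglongrightarrow> ennreal ((g x)\<^sup>2)"
      by (intro tendsto_intros)
    from lim_imp_Liminf[OF _ this] show ?case by simp
  qed
  also have "\<dots> \<le> liminf (\<lambda>n. \<integral>\<^sup>+ x. ennreal ((f n x)\<^sup>2) \<partial>M)"
    by (rule nn_integral_liminf) measurable
  also have "\<dots> \<le> liminf c"
    by (intro Liminf_mono always_eventually allI le)
  also have "\<dots> = C" using lim_imp_Liminf[OF _ c] by simp
  finally show ?thesis .
qed

lemma nn_integral_sq_add_le:
  fixes f g :: "'a \<Rightarrow> real"
  assumes [measurable]: "f \<in> borel_measurable M" "g \<in> borel_measurable M"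
  shows "(\<integral>\<^sup>+ x. ennreal ((f x + g x)\<^sup>2) \<partial>M)
    \<le> 2 * (\<integral>\<^sup>+ x. ennreal ((f x)\<^sup>2) \<partial>M) + 2 * (\<integral>\<^sup>+ x. ennreal ((g x)\<^sup>2) \<partial>M)"
proof -
  have "(\<integral>\<^sup>+ x. ennreal ((f x + g x)\<^sup>2) \<partial>M) \<le> (\<integral>\<^sup>+ x. 2 * ennreal ((f x)\<^sup>2) + 2 * ennreal ((g x)\<^sup>2) \<partial>M)"
  proof (rule nn_integral_mono)
    fix x
    have "(f x + g x)\<^sup>2 \<le> 2 * (f x)\<^sup>2 + 2 * (g x)\<^sup>2"
      using sum_squares_bound[of "f x" "g x"] by (simp add: power2_sum)
    then have "ennreal ((f x + g x)\<^sup>2) \<le> ennreal (2 * (f x)\<^sup>2 + 2 * (g x)\<^sup>2)"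
      by (rule ennreal_leI)
    then show "ennreal ((f x + g x)\<^sup>2) \<le> 2 * ennreal ((f x)\<^sup>2) + 2 * ennreal ((g x)\<^sup>2)"
      by (simp add: ennreal_plus ennreal_mult)
  qed
  also have "\<dots> = 2 * (\<integral>\<^sup>+ x. ennreal ((f x)\<^sup>2) \<partial>M) + 2 * (\<integral>\<^sup>+ x. ennreal ((g x)\<^sup>2) \<partial>M)"
    by (simp add: nn_integral_add nn_integral_cmult)
  finally show ?thesis .
qed

text \<open>On a probability space L2-Cauchy implies L1-Cauchy, so a subsequence converges almost
  everywhere, and Fatou carries the Cauchy bound over to its limit. The rate \<open>e\<close> is
  kept explicitly because it later supplies the majorant for the sum over j.\<close>

lemma (in prob_space) L2_complete:
  fixes Y :: "nat \<Rightarrow> 'a \<Rightarrow> real"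
  assumes meas[measurable]: "\<And>n. Y n \<in> borel_measurable M"
    and cauchy: "\<And>n m. n \<le> m \<Longrightarrow> (\<integral>\<^sup>+ x. ennreal ((Y m x - Y n x)\<^sup>2) \<partial>M) \<le> ennreal (e n)"
    and e: "e \<longlonglongrightarrow> 0"
  obtains X where "X \<in> borel_measurable M"
    "\<And>n. (\<integral>\<^sup>+ x. ennreal ((Y n x - X x)\<^sup>2) \<partial>M) \<le> ennreal (e n)"
proof -
  have sqint: "integrable M (\<lambda>x. (Y m x - Y n x)\<^sup>2)"
    and sqle: "(\<integral>x. (Y m x - Y n x)\<^sup>2 \<partial>M) \<le> max 0 (e n)" if "n \<le> m" for n m
  proof -
    show "integrable M (\<lambda>x. (Y m x - Y n x)\<^sup>2)"
      using cauchy[OF that] by (intro integrableI_bounded) (auto simp: le_less_trans[OF _ ennreal_less_top])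
    then have "ennreal (\<integral>x. (Y m x - Y n x)\<^sup>2 \<partial>M) = (\<integral>\<^sup>+ x. ennreal ((Y m x - Y n x)\<^sup>2) \<partial>M)"
      by (intro nn_integral_eq_integral[symmetric]) auto
    also have "\<dots> \<le> ennreal (max 0 (e n))"
      using cauchy[OF that] by (rule order_trans) (simp add: ennreal_leI)
    finally show "(\<integral>x. (Y m x - Y n x)\<^sup>2 \<partial>M) \<le> max 0 (e n)"
      by (subst (asm) ennreal_le_iff) auto
  qed
  \<comment> \<open>Turns mean square bounds into L1 bounds; the free weight \<open>\<eta>\<close>
    is tuned to the target accuracy below.\<close>
  have absle: "\<bar>d\<bar> \<le> \<eta> + d\<^sup>2 / \<eta>" if "\<eta> > 0" for d \<eta> :: real
  proof (cases "\<bar>d\<bar> \<le> \<eta>")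
    case True
    moreover have "0 \<le> d\<^sup>2 / \<eta>" using that by simp
    ultimately show ?thesis by linarith
  next
    case False
    have "\<bar>d\<bar> * \<eta> \<le> \<bar>d\<bar> * \<bar>d\<bar>" using False by (intro mult_left_mono) auto
    then have "\<bar>d\<bar> \<le> d\<^sup>2 / \<eta>" using that by (simp add: field_simps power2_eq_square)
    then show ?thesis using that by simp
  qed
  have int: "integrable M (\<lambda>x. Y m x - Y n x)" if "n \<le> m" for n m
  proof (rule Bochner_Integration.integrable_bound)
    show "integrable M (\<lambda>x. 1 + (Y m x - Y n x)\<^sup>2 / 1)" using sqint[OF that] by simp
    show "AE x in M. norm (Y m x - Y n x) \<le> norm (1 + (Y m x - Y n x)\<^sup>2 / 1)"
      using absle[of 1] by (intro AE_I2) (simp add: abs_of_nonneg)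
  qed measurable
  \<comment> \<open>Only differences of the \<open>Y n\<close> are known to be square integrable, so
    the subsequence is extracted after subtracting \<open>Y 0\<close>.\<close>
  define s where "s n x = Y n x - Y 0 x" for n x
  obtain r where r: "strict_mono r" "AE x in M. Cauchy (\<lambda>i. s (r i) x)"
  proof (rule cauchy_L1_AE_cauchy_subseq)
    show "integrable M (s n)" for n unfolding s_def using int[of 0 n] by simp
    fix \<epsilon> :: real assume "\<epsilon> > 0"
    \<comment> \<open>With e n < \<open>\<eta>\<close>^2 the L1 distance is at most
      \<open>\<eta>\<close> + \<open>\<eta>\<close>^2 / \<open>\<eta>\<close> = 2
      \<open>\<eta>\<close>, which is below \<open>\<epsilon>\<close>.\<close>
    define \<eta> where "\<eta> = \<epsilon> / 3"
    have \<eta>: "\<eta> > 0" using \<open>\<epsilon> > 0\<close> by (simp add: \<eta>_def)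
    have "eventually (\<lambda>n. e n < \<eta>\<^sup>2) sequentially"
      using e \<eta> by (intro order_tendstoD) auto
    then obtain N where N: "\<And>n. n \<ge> N \<Longrightarrow> e n < \<eta>\<^sup>2" by (auto simp: eventually_sequentially)
    have main: "(\<integral>x. norm (Y m x - Y n x) \<partial>M) < \<epsilon>" if "n \<ge> N" "n \<le> m" for n m
    proof -
      have "(\<integral>x. norm (Y m x - Y n x) \<partial>M) \<le> (\<integral>x. \<eta> + (Y m x - Y n x)\<^sup>2 / \<eta> \<partial>M)"
        using absle[OF \<eta>] int sqint that
        by (intro integral_mono) (auto intro!: integrable_norm)
      also have "\<dots> = \<eta> + (\<integral>x. (Y m x - Y n x)\<^sup>2 \<partial>M) / \<eta>"
        using sqint that by (simp add: prob_space)
      also have "\<dots> \<le> \<eta> + \<eta>\<^sup>2 / \<eta>"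
        using order_trans[OF sqle[OF that(2)], of "\<eta>\<^sup>2"] N[OF that(1)] \<eta>
        by (intro add_left_mono divide_right_mono) auto
      also have "\<dots> < \<epsilon>" using \<eta> by (simp add: power2_eq_square \<eta>_def)
      finally show ?thesis .
    qed
    have "(\<integral>x. norm (s i x - s j x) \<partial>M) < \<epsilon>" if "i \<ge> N" "j \<ge> N" for i j
      using main[of j i] main[of i j] that by (cases "j \<le> i") (auto simp: s_def abs_minus_commute)
    then show "\<exists>N. \<forall>i\<ge>N. \<forall>j\<ge>N. (\<integral>x. norm (s i x - s j x) \<partial>M) < \<epsilon>" by blast
  qed
  define X where "X x = lim (\<lambda>i. Y (r i) x)" for x
  have X[measurable]: "X \<in> borel_measurable M" unfolding X_def by measurable
  have lim: "AE x in M. (\<lambda>i. Y (r i) x) \<longlonglongrightarrow> X x"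
    using r(2)
  proof eventually_elim
    case (elim x)
    then obtain l where "(\<lambda>i. s (r i) x) \<longlonglongrightarrow> l" by (auto simp: Cauchy_convergent_iff convergent_def)
    then have "(\<lambda>i. s (r i) x + Y 0 x) \<longlonglongrightarrow> l + Y 0 x" by (intro tendsto_intros)
    then have "convergent (\<lambda>i. Y (r i) x)" by (auto simp: s_def convergent_def)
    then show ?case by (simp add: X_def convergent_LIMSEQ_iff)
  qed
  have "(\<integral>\<^sup>+ x. ennreal ((Y n x - X x)\<^sup>2) \<partial>M) \<le> ennreal (e n)" for n
  proof (rule Fatou_sq)
    \<comment> \<open>The shift by n gives r (i + n) >= n, so the Cauchy bound e n holds for every
      i.\<close>
    show "AE x in M. (\<lambda>i. Y n x - Y (r (i + n)) x) \<longlonglongrightarrow> Y n x - X x"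
      using lim
    proof eventually_elim
      case (elim x)
      from LIMSEQ_ignore_initial_segment[OF this, of n] show ?case by (intro tendsto_intros)
    qed
    show "(\<integral>\<^sup>+ x. ennreal ((Y n x - Y (r (i + n)) x)\<^sup>2) \<partial>M) \<le> ennreal (e n)" for i
    proof -
      have "n \<le> r (i + n)" using seq_suble[OF r(1), of "i + n"] by simp
      from cauchy[OF this] show ?thesis by (simp add: power2_commute)
    qed
  qed auto
  with X show ?thesis by (rule that)
qed

section \<open>Fourier expansion of the interaction kernel\<close>

definition rvec :: "int \<times> int \<Rightarrow> real \<times> real" where
  "rvec k = (of_int (fst k), of_int (snd k))"

lemma knorm2_eq_norm: "knorm2 k = (norm (rvec k))\<^sup>2"
  by (simp add: knorm2_def rvec_def norm_Pair)

lemma rvec_add: "rvec (k + l) = rvec k + rvec l"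
  by (simp add: rvec_def)

definition cross :: "int \<times> int \<Rightarrow> int \<times> int \<Rightarrow> real" where
  "cross j k = of_int (snd k) * of_int (fst j) - of_int (fst k) * of_int (snd j)"

lemma cross_eq: "cross j k = kperp k \<bullet> rvec j"
  by (simp add: cross_def kperp_def rvec_def)

lemma cross_add_self: "cross j (k + j) = cross j k"
  by (simp add: cross_def algebra_simps)

lemma cross_uminus: "cross j (- k) = - cross j k"
  by (simp add: cross_def)

lemma abs_cross_le: "\<bar>cross j k\<bar> \<le> norm (rvec j) * norm (rvec k)"
proof -
  have "norm (kperp k) = norm (rvec k)" by (simp add: kperp_def rvec_def norm_Pair add.commute)
  then show ?thesis using Cauchy_Schwarz_ineq2[of "kperp k" "rvec j"] by (simp add: cross_eq mult.commute)
qed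

definition beta :: "int \<times> int \<Rightarrow> int \<times> int \<Rightarrow> real" where
  "beta j k = cross j k / knorm2 k"

text \<open>Up to the factor - 2 sqrt 2 pi^2 this is the coefficient of \<open>mode j k\<close> in
  the kernel. The two terms come from the gradient at x and from the gradient at y, the latter after
  a shift of the index by j.\<close>

definition gam :: "int \<times> int \<Rightarrow> int \<times> int \<Rightarrow> real" where
  "gam j k = beta j k - beta j (k + j)"

definition beta_trunc :: "nat \<Rightarrow> int \<times> int \<Rightarrow> int \<times> int \<Rightarrow> real" where
  "beta_trunc M j k = (if k \<in> square M then beta j k else 0)"

text \<open>The series of K is cut off, not that of the kernel, so the two terms are truncated
  separately. Near the edge of the square only one of them survives and the cancellation between
  them is lost.\<close>

definition gam_trunc :: "nat \<Rightarrow> int \<times> int \<Rightarrow> int \<times> int \<Rightarrow> real" where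
  "gam_trunc M j k = beta_trunc M j k - beta_trunc M j (k + j)"

lemma beta_uminus: "beta j (- k) = - beta j k"
  by (simp add: beta_def cross_uminus)

lemma rvec_nonzero: "k \<in> Z2_0 \<Longrightarrow> norm (rvec k) > 0"
  using knorm2_ge_1[of k] by (auto simp: knorm2_eq_norm)

lemma beta_sq_le:
  assumes "k \<in> Z2_0"
  shows "(beta j k)\<^sup>2 \<le> knorm2 j / knorm2 k"
proof -
  have "\<bar>cross j k\<bar>\<^sup>2 \<le> (norm (rvec j) * norm (rvec k))\<^sup>2"
    by (intro power_mono abs_cross_le) simp
  then have "(cross j k)\<^sup>2 \<le> knorm2 j * knorm2 k"
    by (simp add: knorm2_eq_norm power_mult_distrib)
  then have "(cross j k)\<^sup>2 / (knorm2 k)\<^sup>2 \<le> knorm2 j * knorm2 k / (knorm2 k)\<^sup>2"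
    by (rule divide_right_mono) simp
  then show ?thesis using knorm2_ge_1[OF assms] by (simp add: beta_def power_divide power2_eq_square)
qed

lemma min_le_powr:
  fixes t s :: real
  assumes "0 \<le> t" "0 \<le> s" "s \<le> 1"
  shows "min 1 t \<le> t powr s"
proof (cases "t = 0 \<or> 1 \<le> t")
  case True
  then show ?thesis using ge_one_powr_ge_zero[of t s] assms by auto
next
  case False
  then have "t powr 1 \<le> t powr s" using assms by (intro powr_mono') auto
  then show ?thesis using False assms by simp
qed

text \<open>The two terms of \<^const>\<open>gam\<close> share the numerator \<^const>\<open>cross\<close>; this cancellation gives an
  extra factor \<open>(|j| / |k|) powr s\<close> over the bound \<open>|j| / |k|\<close> for a single term.\<close>

lemma abs_inverse_square_diff_le:
  fixes c p q r s :: real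
  assumes "0 < p" "p \<le> q" "0 \<le> r" "q - p \<le> r" "\<bar>c\<bar> \<le> r * p" "0 \<le> s" "s \<le> 1"
  shows "(c * (1 / p\<^sup>2 - 1 / q\<^sup>2))\<^sup>2 \<le> 4 * (r\<^sup>2) powr (1 + s) * (p\<^sup>2) powr (- (1 + s))"
proof -
  have q: "0 < q" using assms by linarith
  have d: "1 / q\<^sup>2 \<le> 1 / p\<^sup>2" using assms q by (intro divide_left_mono power_mono) auto
  have "\<bar>c * (1 / p\<^sup>2 - 1 / q\<^sup>2)\<bar> \<le> (r * p) * (1 / p\<^sup>2 - 1 / q\<^sup>2)"
    unfolding abs_mult using assms d by (intro mult_mono) auto
  also have "\<dots> = r * p * ((1 / p + 1 / q) * (1 / p - 1 / q))"
    by (simp add: power2_eq_square algebra_simps)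
  also have "\<dots> \<le> r * p * ((1 / p + 1 / p) * (1 / p - 1 / q))"
    using assms q by (intro mult_left_mono mult_right_mono add_left_mono divide_left_mono) (auto simp: field_simps)
  also have "\<dots> = 2 * r * (1 / p) * ((q - p) / q)"
    using assms q by (simp add: field_simps)
  \<comment> \<open>(q - p) / q is at most 1 and, by q - p <= r and p <= q, at most r / p; the power
    s interpolates between the two bounds.\<close>
  also have "\<dots> \<le> 2 * r * (1 / p) * ((r / p) powr s)"
  proof (rule mult_left_mono)
    have "(q - p) / q \<le> 1" using assms q by simp
    moreover have "(q - p) / q \<le> r / p" using assms q by (intro frac_le) auto
    ultimately have "(q - p) / q \<le> min 1 (r / p)" by simp
    also have "\<dots> \<le> (r / p) powr s" using assms by (intro min_le_powr) auto
    finally show "(q - p) / q \<le> (r / p) powr s" .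
  qed (use assms in auto)
  finally have "\<bar>c * (1 / p\<^sup>2 - 1 / q\<^sup>2)\<bar> \<le> 2 * ((r / p) * (r / p) powr s)" by (simp add: field_simps)
  then have "\<bar>c * (1 / p\<^sup>2 - 1 / q\<^sup>2)\<bar>\<^sup>2 \<le> (2 * ((r / p) * (r / p) powr s))\<^sup>2"
    by (intro power_mono) auto
  also have "\<dots> = 4 * (((r / p)\<^sup>2) powr (1 + s))"
  proof (cases "r = 0")
    case False
    define t where "t = r / p"
    have pos: "0 < t" using assms False by (simp add: t_def)
    have "(t * t powr s)\<^sup>2 = (t powr (1 + s))\<^sup>2" using pos by (simp add: powr_add)
    also have "\<dots> = (t\<^sup>2) powr (1 + s)"
      using pos powr_powr[of t "1 + s" 2] powr_powr[of t 2 "1 + s"] by (simp add: mult.commute)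
    finally show ?thesis unfolding t_def[symmetric] by (simp add: power_mult_distrib)
  qed simp
  also have "\<dots> = 4 * (r\<^sup>2) powr (1 + s) * (p\<^sup>2) powr (- (1 + s))"
  proof -
    have "((r / p)\<^sup>2) powr (1 + s) = (r\<^sup>2) powr (1 + s) / (p\<^sup>2) powr (1 + s)"
      using assms by (simp add: power_divide powr_divide)
    then show ?thesis by (simp only: powr_minus divide_inverse mult.assoc)
  qed
  finally show ?thesis by simp
qed

text \<open>The estimate holds with the shorter of k and k + j; adding the bounds for both avoids
  tracking which one it is and makes the right side summable by translation.\<close>

lemma gam_sq_le:
  fixes s :: real
  assumes s: "0 \<le> s" "s \<le> 1"
  shows "(gam j k)\<^sup>2 \<le> 4 * knorm2 j powr (1 + s) * (knorm2 k powr (- (1 + s)) + knorm2 (k + j) powr (- (1 + s)))"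
proof (cases "k \<in> Z2_0 \<and> k + j \<in> Z2_0")
  case True
  define p q r where "p = norm (rvec k)" and "q = norm (rvec (k + j))" and "r = norm (rvec j)"
  have pos: "0 < p" "0 < q" "0 \<le> r" using True rvec_nonzero by (auto simp: p_def q_def r_def)
  have tri: "q - p \<le> r" "p - q \<le> r"
    unfolding p_def q_def r_def rvec_add
    using norm_triangle_ineq[of "rvec k" "rvec j"] norm_triangle_ineq4[of "rvec k + rvec j" "rvec j"] by auto
  have c: "\<bar>cross j k\<bar> \<le> r * p" "\<bar>cross j k\<bar> \<le> r * q"
    using abs_cross_le[of j k] abs_cross_le[of j "k + j"] by (auto simp: p_def q_def r_def cross_add_self)
  have g: "gam j k = cross j k * (1 / p\<^sup>2 - 1 / q\<^sup>2)"
    unfolding gam_def beta_def cross_add_self knorm2_eq_norm p_def q_def by (simp add: right_diff_distrib)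
  have kn: "knorm2 k = p\<^sup>2" "knorm2 (k + j) = q\<^sup>2" "knorm2 j = r\<^sup>2"
    by (simp_all add: knorm2_eq_norm p_def q_def r_def)
  have "(gam j k)\<^sup>2 \<le> 4 * (r\<^sup>2) powr (1 + s) * (p\<^sup>2) powr (- (1 + s))" if "p \<le> q"
    unfolding g using pos that tri c s by (intro abs_inverse_square_diff_le)
  moreover have "(gam j k)\<^sup>2 \<le> 4 * (r\<^sup>2) powr (1 + s) * (q\<^sup>2) powr (- (1 + s))" if "q \<le> p"
  proof -
    have "(gam j k)\<^sup>2 = (cross j k * (1 / q\<^sup>2 - 1 / p\<^sup>2))\<^sup>2"
      unfolding g by (simp add: power_mult_distrib power2_commute)
    also have "\<dots> \<le> 4 * (r\<^sup>2) powr (1 + s) * (q\<^sup>2) powr (- (1 + s))"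
      using pos that tri c s by (intro abs_inverse_square_diff_le)
    finally show ?thesis .
  qed
  moreover have "0 \<le> 4 * (r\<^sup>2) powr (1 + s) * (p\<^sup>2) powr (- (1 + s))" "0 \<le> 4 * (r\<^sup>2) powr (1 + s) * (q\<^sup>2) powr (- (1 + s))"
    by auto
  ultimately show ?thesis
    unfolding kn distrib_left by (cases "p \<le> q") (auto intro: order_trans)
next
  \<comment> \<open>At k = 0 or k = - j a denominator is 0, but then the common numerator
    \<open>cross j k\<close> vanishes as well.\<close>
  case False
  then consider "k = (0, 0)" | "k = - j"
    by (cases k; cases j) (auto simp: Z2_0_def)
  then have "cross j k = 0" by cases (auto simp: cross_def)
  then have "gam j k = 0" by (simp add: gam_def beta_def cross_add_self)
  then show ?thesis by simp
qed

text \<open>Any s > 0 makes the weight in k summable, at the price of the power 1 + s of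
  \<open>knorm2 j\<close>; s stays free so that it can be chosen small when summing over j. The
  constant 8 is 4 for each of the two translates of the weight.\<close>

lemma summable_on_gam_sq: "(\<lambda>k. (gam j k)\<^sup>2) summable_on UNIV"
  and infsum_gam_sq_le: "\<lbrakk>0 < s; s \<le> 1\<rbrakk> \<Longrightarrow> (\<Sum>\<^sub>\<infinity>k. (gam j k)\<^sup>2)
     \<le> 8 * (\<Sum>\<^sub>\<infinity>k\<in>Z2_0. knorm2 k powr (- (1 + s))) * knorm2 j powr (1 + s)"
proof -
  have main: "((\<lambda>k. (gam j k)\<^sup>2) summable_on UNIV) \<and> (\<Sum>\<^sub>\<infinity>k. (gam j k)\<^sup>2)
     \<le> 8 * (\<Sum>\<^sub>\<infinity>k\<in>Z2_0. knorm2 k powr (- (1 + s))) * knorm2 j powr (1 + s)"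
    if s: "0 < s" "s \<le> 1" for s :: real
  proof -
    define w where "w k = knorm2 k powr (- (1 + s))" for k
    have "w summable_on Z2_0" unfolding w_def using s by (intro summable_on_knorm2_powr) simp
    then have "(w has_sum infsum w Z2_0) Z2_0" by (rule has_sum_infsum)
    then have w0: "(w has_sum infsum w Z2_0) UNIV"
      by (rule has_sum_cong_neutral[THEN iffD1, rotated -1]) (auto simp: Z2_0_def w_def)
    have "bij_betw (\<lambda>k. k + j) UNIV UNIV"
      by (rule bij_betw_byWitness[where f' = "\<lambda>k. k - j"]) auto
    from has_sum_reindex_bij_betw[OF this, of w] w0
    have w1: "((\<lambda>k. w (k + j)) has_sum infsum w Z2_0) UNIV" by simp
    have ub: "((\<lambda>k. 4 * knorm2 j powr (1 + s) * (w k + w (k + j))) has_sum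
        4 * knorm2 j powr (1 + s) * (infsum w Z2_0 + infsum w Z2_0)) UNIV"
      by (intro has_sum_cmult_right has_sum_add w0 w1)
    have le: "(gam j k)\<^sup>2 \<le> 4 * knorm2 j powr (1 + s) * (w k + w (k + j))" for k
      unfolding w_def using gam_sq_le[of s j k] s by simp
    have sm: "(\<lambda>k. (gam j k)\<^sup>2) summable_on UNIV"
      using has_sum_imp_summable[OF ub] by (rule summable_on_comparison_test) (use le in auto)
    moreover have "(\<Sum>\<^sub>\<infinity>k. (gam j k)\<^sup>2) \<le> 4 * knorm2 j powr (1 + s) * (infsum w Z2_0 + infsum w Z2_0)"
      using has_sum_mono[OF has_sum_infsum[OF sm] ub] le by auto
    ultimately show ?thesis by (auto simp: w_def[abs_def] algebra_simps)
  qed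
  show "(\<lambda>k. (gam j k)\<^sup>2) summable_on UNIV" using main[of 1] by simp
  show "(\<Sum>\<^sub>\<infinity>k. (gam j k)\<^sup>2)
     \<le> 8 * (\<Sum>\<^sub>\<infinity>k\<in>Z2_0. knorm2 k powr (- (1 + s))) * knorm2 j powr (1 + s)" if "0 < s" "s \<le> 1"
    using main that by blast
qed

lemma square_mono: "M \<le> N \<Longrightarrow> square M \<subseteq> square N"
  by (auto simp: square_def)

lemma card_square: "card (square M) = (2 * M + 1)\<^sup>2"
proof -
  have "nat (2 * int M + 1) = 2 * M + 1" by linarith
  then show ?thesis by (simp add: square_def power2_eq_square)
qed

lemma knorm2_ge_of_notin_square: "k \<notin> square M \<Longrightarrow> (1 + real M)\<^sup>2 \<le> knorm2 k"
proof -
  assume "k \<notin> square M"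
  then have "1 + int M \<le> \<bar>fst k\<bar> \<or> 1 + int M \<le> \<bar>snd k\<bar>" by (cases k) (auto simp: square_def)
  then have "\<bar>1 + real M\<bar> \<le> \<bar>real_of_int (fst k)\<bar> \<or> \<bar>1 + real M\<bar> \<le> \<bar>real_of_int (snd k)\<bar>" by linarith
  then have "(1 + real M)\<^sup>2 \<le> real_of_int (fst k) ^ 2 \<or> (1 + real M)\<^sup>2 \<le> real_of_int (snd k) ^ 2"
    by (simp only: abs_le_square_iff)
  then show ?thesis unfolding knorm2_def
    using zero_le_power2[of "real_of_int (fst k)"] zero_le_power2[of "real_of_int (snd k)"] by linarith
qed

text \<open>If k and k + j both lie in the square there is no error; if neither does, the error is
  part of a convergent tail. In the mixed case it is a single \<open>beta\<close> at a point of a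
  frame of fixed width around the square. That frame has on the order of M points, each contributing
  at most |j|^2 / (1 + M)^2. The bound is uniform in the finite set \<open>R\<close>.\<close>

lemma gam_trunc_sq_convergence:
  obtains \<eta> where "\<eta> \<longlonglongrightarrow> 0" "\<And>M. 0 \<le> \<eta> M"
    "\<And>M R. finite R \<Longrightarrow> (\<Sum>k\<in>R. (gam_trunc M j k - gam j k)\<^sup>2) \<le> \<eta> M"
proof -
  \<comment> \<open>The sup norm of j: a shift by j or - j maps \<open>square M\<close> into
    \<open>square (M + J)\<close>.\<close>
  define J where "J = nat (max \<bar>fst j\<bar> \<bar>snd j\<bar>)"
  define G where "G = (\<Sum>\<^sub>\<infinity>k. (gam j k)\<^sup>2)"
  define D where "D M = square (M + J) - square M" for M
  define d where "d M k = (if k \<in> D M then (beta j k)\<^sup>2 else 0)" for M k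
  define \<eta>1 where "\<eta>1 M = G - (\<Sum>k\<in>square M. (gam j k)\<^sup>2)" for M
  define \<eta>2 where "\<eta>2 M = real (card (D M)) * (knorm2 j / (1 + real M)\<^sup>2)" for M
  have hs: "((\<lambda>k. (gam j k)\<^sup>2) has_sum G) UNIV" unfolding G_def by (rule has_sum_infsum[OF summable_on_gam_sq])
  have fD: "finite (D M)" for M by (simp add: D_def)
  have "(\<lambda>M. \<Sum>k\<in>square M. (gam j k)\<^sup>2) \<longlonglongrightarrow> G"
    using hs
  proof (rule tendsto_sum_exhausting)
    show "eventually (\<lambda>n. k \<in> square n) sequentially" for k
      by (rule eventually_sequentiallyI[of "nat (max \<bar>fst k\<bar> \<bar>snd k\<bar>)"]) (cases k, auto simp: square_def)
  qed auto
  from tendsto_diff[OF tendsto_const[of G] this] have e1: "\<eta>1 \<longlonglongrightarrow> 0" by (simp add: \<eta>1_def[abs_def])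
  have cardD: "real (card (D M)) = (2 * (real M + real J) + 1)\<^sup>2 - (2 * real M + 1)\<^sup>2" for M
  proof -
    have "card (D M) = (2 * (M + J) + 1)\<^sup>2 - (2 * M + 1)\<^sup>2"
      unfolding D_def using square_mono[of M "M + J"] by (subst card_Diff_subset) (auto simp: card_square)
    moreover have "(2 * M + 1)\<^sup>2 \<le> (2 * (M + J) + 1)\<^sup>2" by (intro power_mono) auto
    ultimately show ?thesis by (simp add: of_nat_diff add_ac)
  qed
  have e2: "\<eta>2 \<longlonglongrightarrow> 0" unfolding \<eta>2_def cardD by real_asymp
  have sumD: "(\<Sum>k\<in>R. d M k) \<le> \<eta>2 M" if "finite R" for M R
  proof -
    have "(\<Sum>k\<in>R. d M k) = (\<Sum>k\<in>R \<inter> D M. (beta j k)\<^sup>2)"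
      unfolding d_def using that by (simp add: sum.If_cases)
    also have "\<dots> \<le> (\<Sum>k\<in>D M. (beta j k)\<^sup>2)" using fD by (intro sum_mono2) auto
    also have "\<dots> \<le> (\<Sum>k\<in>D M. knorm2 j / (1 + real M)\<^sup>2)"
    proof (rule sum_mono)
      fix k assume k: "k \<in> D M"
      then have "k \<in> Z2_0" by (auto simp: D_def square_def Z2_0_def)
      have "(beta j k)\<^sup>2 \<le> knorm2 j / knorm2 k" by (rule beta_sq_le[OF \<open>k \<in> Z2_0\<close>])
      also have "\<dots> \<le> knorm2 j / (1 + real M)\<^sup>2"
        using knorm2_ge_of_notin_square[of k M] knorm2_ge_1[OF \<open>k \<in> Z2_0\<close>] k
        by (intro divide_left_mono mult_pos_pos) (auto simp: D_def)
      finally show "(beta j k)\<^sup>2 \<le> knorm2 j / (1 + real M)\<^sup>2" .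
    qed
    finally show ?thesis by (simp add: \<eta>2_def)
  qed
  have sumG: "(\<Sum>k\<in>R. if k \<in> square M then 0 else (gam j k)\<^sup>2) \<le> \<eta>1 M" if "finite R" for M R
  proof -
    have "(\<Sum>k\<in>R. if k \<in> square M then 0 else (gam j k)\<^sup>2) = (\<Sum>k\<in>R - square M. (gam j k)\<^sup>2)"
      using that by (intro sum.mono_neutral_cong_right) auto
    moreover have "(\<Sum>k\<in>R - square M. (gam j k)\<^sup>2) + (\<Sum>k\<in>square M. (gam j k)\<^sup>2)
        = (\<Sum>k\<in>(R - square M) \<union> square M. (gam j k)\<^sup>2)"
      using that by (intro sum.union_disjoint[symmetric]) auto
    moreover have "\<dots> \<le> G"
      unfolding G_def using that by (intro finite_sum_le_infsum summable_on_gam_sq) auto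
    ultimately show ?thesis by (simp add: \<eta>1_def)
  qed
  have sq_add: "k + j \<in> square (M + J)" "k - j \<in> square (M + J)" if "k \<in> square M" for k M
    using that by (cases k; cases j; auto simp: square_def J_def)+
  have pw: "(gam_trunc M j k - gam j k)\<^sup>2 \<le> (if k \<in> square M then 0 else (gam j k)\<^sup>2) + d M k + d M (k + j)" for M k
  proof -
    consider "k \<in> square M" "k + j \<in> square M" | "k \<notin> square M" "k + j \<notin> square M"
      | "k \<in> square M" "k + j \<notin> square M" | "k \<notin> square M" "k + j \<in> square M" by blast
    then show ?thesis
    proof cases
      case 2
      then have "(gam_trunc M j k - gam j k)\<^sup>2 = (gam j k)\<^sup>2"
        by (simp add: gam_trunc_def beta_trunc_def)
      moreover have "0 \<le> d M k" "0 \<le> d M (k + j)" by (auto simp: d_def)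
      ultimately show ?thesis using 2 by simp
    next
      case 3
      then have "k + j \<in> D M" using sq_add(1)[of k M] by (simp add: D_def)
      then show ?thesis using 3 by (simp add: gam_trunc_def beta_trunc_def gam_def d_def)
    next
      case 4
      then have "k \<in> D M" using sq_add(2)[of "k + j" M] by (simp add: D_def)
      then show ?thesis using 4 by (simp add: gam_trunc_def beta_trunc_def gam_def d_def)
    qed (auto simp: gam_trunc_def beta_trunc_def gam_def d_def)
  qed
  have bound: "(\<Sum>k\<in>R. (gam_trunc M j k - gam j k)\<^sup>2) \<le> \<eta>1 M + \<eta>2 M + \<eta>2 M" if "finite R" for M R
  proof -
    have "(\<Sum>k\<in>R. (gam_trunc M j k - gam j k)\<^sup>2)
       \<le> (\<Sum>k\<in>R. if k \<in> square M then 0 else (gam j k)\<^sup>2) + (\<Sum>k\<in>R. d M k) + (\<Sum>k\<in>R. d M (k + j))"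
      unfolding sum.distrib[symmetric] by (intro sum_mono pw)
    moreover have "(\<Sum>k\<in>R. d M (k + j)) = (\<Sum>k\<in>(\<lambda>k. k + j) ` R. d M k)"
      by (subst sum.reindex) (auto simp: inj_on_def)
    ultimately show ?thesis
      using sumG[OF that, of M] sumD[OF that, of M] sumD[of "(\<lambda>k. k + j) ` R" M] that by auto
  qed
  show ?thesis
  proof (rule that)
    show "(\<lambda>M. \<eta>1 M + \<eta>2 M + \<eta>2 M) \<longlonglongrightarrow> 0"
      using tendsto_add[OF tendsto_add[OF e1 e2] e2] by simp
    show "0 \<le> \<eta>1 M + \<eta>2 M + \<eta>2 M" for M using bound[of "{}" M] by simp
  qed (rule bound)
qed

section \<open>Truncated kernels and their expansion into modes\<close>

definition HM :: "nat \<Rightarrow> int \<times> int \<Rightarrow> real \<times> real \<Rightarrow> real \<times> real \<Rightarrow> real" where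
  "HM M j x y = (1 / 2) * (K_partial M (x - y) \<bullet> (grad (ebasis j) x - grad (ebasis j) y))"

lemma grad_ebasis: "grad (ebasis j) x = (- 2 * pi * sqrt 2 * sin (2 * pi * kdot j x + phase j)) *\<^sub>R rvec j"
proof -
  have "(ebasis j has_derivative (\<lambda>v. sqrt 2 * (- sin (2 * pi * kdot j x + phase j) * (2 * pi * kdot j v)))) (at x)"
    unfolding ebasis_eq_cos[abs_def] kdot_def
    by (auto intro!: derivative_eq_intros simp: algebra_simps)
  from frechet_derivative_at[OF this, symmetric] show ?thesis
    by (simp add: grad_def rvec_def kdot_def)
qed

text \<open>A common translation of x and y changes the kernel only through the phase of e_j. Hence
  only frequency pairs with sum j occur, and they are parametrised as (k + j, - k).\<close>

definition mode :: "int \<times> int \<Rightarrow> int \<times> int \<Rightarrow> (real \<times> real) \<times> (real \<times> real) \<Rightarrow> real" where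
  "mode j k p = cos (2 * pi * (kdot (k + j) (fst p) + kdot (- k) (snd p)) + phase j)"

lemma sin_mult_sin_diff_mode:
  "sin (2 * pi * kdot k (x - y)) * (sin (2 * pi * kdot j x + phase j) - sin (2 * pi * kdot j y + phase j))
   = (mode j (- k) (x, y) - mode j k (x, y) - mode j (- k - j) (x, y) + mode j (k - j) (x, y)) / 2"
proof -
  define \<theta> a b where "\<theta> = 2 * pi * kdot k (x - y)" and "a = 2 * pi * kdot j x + phase j"
    and "b = 2 * pi * kdot j y + phase j"
  have m: "mode j k (x, y) = cos (\<theta> + a)" "mode j (- k) (x, y) = cos (\<theta> - a)"
    "mode j (k - j) (x, y) = cos (\<theta> + b)" "mode j (- k - j) (x, y) = cos (\<theta> - b)"
    unfolding mode_def \<theta>_def a_def b_def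
    by (simp_all add: kdot_add_left kdot_diff_left kdot_minus_left kdot_diff_right algebra_simps)
       (subst cos_minus[symmetric], simp add: algebra_simps)+
  show ?thesis
    unfolding m \<theta>_def[symmetric] a_def[symmetric] b_def[symmetric]
    by (simp add: cos_add cos_diff algebra_simps)
qed

text \<open>\<open>beta\<close> is odd in k and the square is symmetric; this folds the modes of
  index - k onto those of index k.\<close>

lemma sum_square_odd:
  fixes f :: "int \<times> int \<Rightarrow> real"
  shows "(\<Sum>k\<in>square M. beta j k * f (- k)) = - (\<Sum>k\<in>square M. beta j k * f k)"
proof -
  have "(\<Sum>k\<in>square M. beta j k * f (- k)) = (\<Sum>k\<in>square M. beta j (- k) * f k)"
    by (rule sum.reindex_bij_witness[of _ uminus uminus]) (auto simp: square_def)
  then show ?thesis by (simp add: beta_uminus sum_negf)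
qed

text \<open>The index set \<open>R\<close> is arbitrary above the support, so that two truncations
  can be expanded over the same set and subtracted. The constant is 1/2 times 2 pi from K times 2 pi
  sqrt 2 from the gradient of e_j.\<close>

lemma HM_eq:
  assumes R: "finite R" "square M \<subseteq> R" "(\<lambda>k. k - j) ` square M \<subseteq> R"
  shows "HM M j x y = - (2 * sqrt 2 * pi\<^sup>2) * (\<Sum>k\<in>R. gam_trunc M j k * mode j k (x, y))"
proof -
  let ?S = "\<lambda>f. \<Sum>k\<in>square M. beta j k * f k"
  let ?d = "sin (2 * pi * kdot j x + phase j) - sin (2 * pi * kdot j y + phase j)"
  have "HM M j x y = (\<Sum>k\<in>square M. (1 / 2) * ((- 2 * pi * sin (2 * pi * kdot k (x - y)) / knorm2 k)
       * ((- 2 * pi * sqrt 2 * ?d) * (kperp k \<bullet> rvec j))))"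
    unfolding HM_def K_partial_eq grad_ebasis inner_sum_left sum_distrib_left
    by (intro sum.cong refl) (simp add: inner_diff_right algebra_simps)
  also have "\<dots> = (2 * sqrt 2 * pi\<^sup>2) * ?S (\<lambda>k. sin (2 * pi * kdot k (x - y)) * ?d)"
    unfolding sum_distrib_left
    by (intro sum.cong refl) (simp add: beta_def cross_eq power2_eq_square mult_ac)
  also have "?S (\<lambda>k. sin (2 * pi * kdot k (x - y)) * ?d)
      = ?S (\<lambda>k. (mode j (- k) (x, y) - mode j k (x, y) - mode j (- k - j) (x, y) + mode j (k - j) (x, y)) / 2)"
    by (simp only: sin_mult_sin_diff_mode)
  also have "\<dots> = (?S (\<lambda>k. mode j (- k) (x, y)) - ?S (\<lambda>k. mode j k (x, y)) - ?S (\<lambda>k. mode j (- k - j) (x, y))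
       + ?S (\<lambda>k. mode j (k - j) (x, y))) / 2"
    unfolding sum_subtractf[symmetric] sum.distrib[symmetric] sum_divide_distrib
    by (intro sum.cong refl) (simp add: algebra_simps add_divide_distrib diff_divide_distrib)
  also have "\<dots> = - ?S (\<lambda>k. mode j k (x, y)) + ?S (\<lambda>k. mode j (k - j) (x, y))"
    using sum_square_odd[of j "\<lambda>k. mode j k (x, y)" M] sum_square_odd[of j "\<lambda>k. mode j (k - j) (x, y)" M]
    by simp
  also have "?S (\<lambda>k. mode j k (x, y)) = (\<Sum>k\<in>R. beta_trunc M j k * mode j k (x, y))"
    using R by (intro sum.mono_neutral_cong_left) (auto simp: beta_trunc_def)
  also have "?S (\<lambda>k. mode j (k - j) (x, y)) = (\<Sum>k\<in>(\<lambda>k. k - j) ` square M. beta j (k + j) * mode j k (x, y))"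
    by (subst sum.reindex) (auto simp: inj_on_def)
  also have "\<dots> = (\<Sum>k\<in>R. beta_trunc M j (k + j) * mode j k (x, y))"
  proof (rule sum.mono_neutral_cong_left)
    show "\<forall>i\<in>R - (\<lambda>k. k - j) ` square M. beta_trunc M j (i + j) * mode j i (x, y) = 0"
    proof
      fix i assume i: "i \<in> R - (\<lambda>k. k - j) ` square M"
      have "i + j \<notin> square M"
      proof
        assume "i + j \<in> square M"
        then have "(i + j) - j \<in> (\<lambda>k. k - j) ` square M" by (rule imageI)
        then show False using i by simp
      qed
      then show "beta_trunc M j (i + j) * mode j i (x, y) = 0" by (simp add: beta_trunc_def)
    qed
  qed (use R in \<open>auto simp: beta_trunc_def\<close>)
  also have "- (\<Sum>k\<in>R. beta_trunc M j k * mode j k (x, y)) + (\<Sum>k\<in>R. beta_trunc M j (k + j) * mode j k (x, y))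
     = - (\<Sum>k\<in>R. gam_trunc M j k * mode j k (x, y))"
    unfolding gam_trunc_def by (simp add: left_diff_distrib sum_subtractf)
  finally show ?thesis by simp
qed

lemma borel_measurable_mode [measurable]: "mode j k \<in> borel_measurable borel"
  unfolding mode_def by measurable

lemma integrable_mode_sq: "integrable tau4 (\<lambda>p. (mode j k p)\<^sup>2)"
  by (rule integrable_bounded[where C = 1])
     (auto intro: tau4.finite_measure_axioms simp: mode_def abs_square_le_1)

lemma integral_mode_mult:
  assumes "j \<in> Z2_0"
  shows "(\<integral>p. mode j k p * mode j l p \<partial>tau4) = (if k = l then 1 / 2 else 0)"
proof -
  have eq: "mode j k p * mode j l p = (cos (2 * pi * (kdot (k - l) (fst p) + kdot (l - k) (snd p)) + 0)
      + cos (2 * pi * (kdot (k + l + j + j) (fst p) + kdot (- k - l) (snd p)) + 2 * phase j)) / 2" for p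
    unfolding mode_def cos_times_cos
    by (simp add: kdot_add_left kdot_diff_left kdot_minus_left algebra_simps)
  have int: "integrable tau4 (\<lambda>p. cos (2 * pi * (kdot k (fst p) + kdot l (snd p)) + b))" for k l b
    by (rule integrable_bounded[where C = 1]) (auto intro: tau4.finite_measure_axioms)
  have "(\<integral>p. mode j k p * mode j l p \<partial>tau4) = ((if k - l = (0, 0) \<and> l - k = (0, 0) then cos 0 else 0)
      + (if k + l + j + j = (0, 0) \<and> - k - l = (0, 0) then cos (2 * phase j) else 0)) / 2"
    unfolding eq integral_divide_zero by (subst Bochner_Integration.integral_add[OF int int]) (simp only: integral_cos_tau4)
  \<comment> \<open>The term with the sum of the frequencies could contribute only if k + l = 0 and
    2 j = 0, against j being nonzero.\<close>
  moreover have "\<not> (k + l + j + j = (0, 0) \<and> - k - l = (0, 0))"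
    using assms by (cases j; cases k; cases l) (auto simp: Z2_0_def)
  moreover have "k - l = (0, 0) \<and> l - k = (0, 0) \<longleftrightarrow> k = l"
    by (cases k; cases l) auto
  ultimately show ?thesis by auto
qed

definition Hf :: "int \<times> int \<Rightarrow> (real \<times> real) \<times> (real \<times> real) \<Rightarrow> real" where
  "Hf j p = Hphi (ebasis j) (fst p) (snd p)"

definition HMf :: "nat \<Rightarrow> int \<times> int \<Rightarrow> (real \<times> real) \<times> (real \<times> real) \<Rightarrow> real" where
  "HMf M j p = HM M j (fst p) (snd p)"

lemma HMf_eq:
  assumes "finite R" "square M \<subseteq> R" "(\<lambda>k. k - j) ` square M \<subseteq> R"
  shows "HMf M j p = (\<Sum>k\<in>R. (- (2 * sqrt 2 * pi\<^sup>2) * gam_trunc M j k) * mode j k p)"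
  unfolding HMf_def HM_eq[OF assms] by (simp add: sum_distrib_left mult.assoc)

lemma borel_measurable_HMf [measurable]: "HMf M j \<in> borel_measurable borel"
proof -
  have "HMf M j = (\<lambda>p. \<Sum>k\<in>square M \<union> (\<lambda>k. k - j) ` square M. (- (2 * sqrt 2 * pi\<^sup>2) * gam_trunc M j k) * mode j k p)"
    by (rule ext, rule HMf_eq) auto
  then show ?thesis by simp
qed

lemma integral_sum_mode_sq:
  assumes "j \<in> Z2_0" "finite R"
  shows "(\<integral>p. (\<Sum>k\<in>R. c k * mode j k p)\<^sup>2 \<partial>tau4) = (1 / 2) * (\<Sum>k\<in>R. (c k)\<^sup>2)"
    and "integrable tau4 (\<lambda>p. (\<Sum>k\<in>R. c k * mode j k p)\<^sup>2)"
  using assms integral_sq_sum_orthogonal[of R "mode j" tau4 "1 / 2" c]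
  by (auto simp: integrable_mode_sq integral_mode_mult)

text \<open>The constant is (2 sqrt 2 pi^2)^2 = 8 pi^4, halved because a mode has squared norm
  1/2.\<close>

lemma integral_HMf_sq:
  assumes "j \<in> Z2_0" "finite R" "square M \<subseteq> R" "(\<lambda>k. k - j) ` square M \<subseteq> R"
  shows "(\<integral>p. (HMf M j p)\<^sup>2 \<partial>tau4) = 4 * pi ^ 4 * (\<Sum>k\<in>R. (gam_trunc M j k)\<^sup>2)"
    and "integrable tau4 (\<lambda>p. (HMf M j p)\<^sup>2)"
proof -
  have sq: "(- (2 * sqrt 2 * pi\<^sup>2) * c)\<^sup>2 = 8 * pi ^ 4 * c\<^sup>2" for c
    by (simp add: power_mult_distrib)
  show "(\<integral>p. (HMf M j p)\<^sup>2 \<partial>tau4) = 4 * pi ^ 4 * (\<Sum>k\<in>R. (gam_trunc M j k)\<^sup>2)"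
    unfolding HMf_eq[OF assms(2-4)] integral_sum_mode_sq(1)[OF assms(1,2)] sq
    by (simp add: sum_distrib_left mult.assoc)
  show "integrable tau4 (\<lambda>p. (HMf M j p)\<^sup>2)"
    unfolding HMf_eq[OF assms(2-4)] by (rule integral_sum_mode_sq(2)[OF assms(1,2)])
qed

lemma integral_HMf_diff_sq:
  assumes "j \<in> Z2_0" "finite R" "square M \<subseteq> R" "(\<lambda>k. k - j) ` square M \<subseteq> R"
    "square N \<subseteq> R" "(\<lambda>k. k - j) ` square N \<subseteq> R"
  shows "(\<integral>p. (HMf M j p - HMf N j p)\<^sup>2 \<partial>tau4) = 4 * pi ^ 4 * (\<Sum>k\<in>R. (gam_trunc M j k - gam_trunc N j k)\<^sup>2)"
    and "integrable tau4 (\<lambda>p. (HMf M j p - HMf N j p)\<^sup>2)"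
proof -
  have sq: "(- (2 * sqrt 2 * pi\<^sup>2) * c)\<^sup>2 = 8 * pi ^ 4 * c\<^sup>2" for c
    by (simp add: power_mult_distrib)
  have eq: "HMf M j p - HMf N j p
      = (\<Sum>k\<in>R. (- (2 * sqrt 2 * pi\<^sup>2) * (gam_trunc M j k - gam_trunc N j k)) * mode j k p)" for p
    unfolding HMf_eq[OF assms(2-4)] HMf_eq[OF assms(2,5,6)] sum_subtractf[symmetric]
    by (intro sum.cong refl) (simp add: algebra_simps)
  show "(\<integral>p. (HMf M j p - HMf N j p)\<^sup>2 \<partial>tau4) = 4 * pi ^ 4 * (\<Sum>k\<in>R. (gam_trunc M j k - gam_trunc N j k)\<^sup>2)"
    unfolding eq integral_sum_mode_sq(1)[OF assms(1,2)] sq by (simp add: sum_distrib_left mult.assoc)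
  show "integrable tau4 (\<lambda>p. (HMf M j p - HMf N j p)\<^sup>2)"
    unfolding eq by (rule integral_sum_mode_sq(2)[OF assms(1,2)])
qed

lemma borel_measurable_K_partial [measurable]: "K_partial M \<in> borel_measurable borel"
proof -
  have "kperp k \<in> space borel" for k by simp
  then show ?thesis
    unfolding K_partial_def by (intro borel_measurable_sum borel_measurable_scaleR) auto
qed

lemma borel_measurable_Kker [measurable]: "Kker \<in> borel_measurable borel"
proof -
  have "{x. convergent (\<lambda>M. K_partial M x)} \<in> sets borel"
    unfolding Cauchy_convergent_iff[symmetric]
    using sets_Collect_Cauchy[of K_partial borel] by simp
  then have [measurable]: "Measurable.pred borel (\<lambda>x. convergent (\<lambda>M. K_partial M x))"
    by (simp add: pred_def)
  have [measurable]: "(\<lambda>x. lim (\<lambda>M. K_partial M x)) \<in> borel_measurable borel"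
    by (rule borel_measurable_lim_metric) measurable
  show ?thesis unfolding Kker_def[abs_def] by measurable
qed

lemma borel_measurable_Hf [measurable]: "Hf j \<in> borel_measurable borel"
proof -
  have [measurable]: "grad (ebasis j) \<in> borel_measurable borel"
    unfolding grad_ebasis by (intro borel_measurable_scaleR) auto
  have [measurable]: "{p::(real \<times> real) \<times> (real \<times> real). fst p = snd p} \<in> sets borel"
    by (intro borel_closed closed_Collect_eq continuous_intros)
  then have [measurable]: "Measurable.pred borel (\<lambda>p::(real \<times> real) \<times> (real \<times> real). fst p = snd p)"
    by (simp add: pred_def)
  show ?thesis unfolding Hf_def Hphi_def by measurable
qed

text \<open>The exceptional set lies in countably many hyperplanes, each of measure zero.\<close>

lemma AE_tau4_noninteger_difference:
  "AE p in tau4. fst (fst p - snd p) \<notin> \<int> \<and> snd (fst p - snd p) \<notin> \<int>"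
proof -
  have AE: "AE p in lborel. a \<bullet> p \<notin> \<int>" if "a \<noteq> 0" for a :: "(real \<times> real) \<times> (real \<times> real)"
  proof -
    have "AE p in lborel. a \<bullet> p \<noteq> of_int n" for n :: int
    proof -
      have "negligible {p. a \<bullet> p = of_int n}" using that by (intro negligible_hyperplane) simp
      then have "emeasure lebesgue {p. a \<bullet> p = of_int n} = 0"
        by (simp add: negligible_iff_null_sets null_sets_def)
      moreover have "{p. a \<bullet> p = of_int n} \<in> sets lborel"
        unfolding sets_lborel by (intro borel_closed closed_hyperplane)
      ultimately have "{p. a \<bullet> p = of_int n} \<in> null_sets lborel"
        by (simp add: null_sets_def)
      from AE_not_in[OF this] show ?thesis by simp
    qed
    then have "AE p in lborel. \<forall>n::int. a \<bullet> p \<noteq> of_int n" by (simp add: AE_all_countable)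
    then show ?thesis by eventually_elim (auto elim!: Ints_cases)
  qed
  have "AE p in lborel. ((1, 0), (- 1, 0)) \<bullet> p \<notin> \<int> \<and> ((0, 1), (0, - 1)) \<bullet> (p::(real \<times> real) \<times> (real \<times> real)) \<notin> \<int>"
    using AE[of "((1, 0), (- 1, 0))"] AE[of "((0, 1), (0, - 1))"] by (simp add: zero_prod_def)
  then have "AE p in (lborel :: ((real \<times> real) \<times> (real \<times> real)) measure). fst (fst p - snd p) \<notin> \<int> \<and> snd (fst p - snd p) \<notin> \<int>"
    by eventually_elim (auto simp: inner_prod_def)
  then show ?thesis
    unfolding tau4_def by (subst AE_density) auto
qed

lemma HMf_tendsto_Hf: "AE p in tau4. (\<lambda>M. HMf M j p) \<longlonglongrightarrow> Hf j p"
  using AE_tau4_noninteger_difference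
proof eventually_elim
  case (elim p)
  \<comment> \<open>Also excludes the diagonal, where \<open>Hphi\<close> takes its default value
    0.\<close>
  then have "fst p \<noteq> snd p" by auto
  moreover have "(\<lambda>M. K_partial M (fst p - snd p)) \<longlonglongrightarrow> Kker (fst p - snd p)"
    using convergent_K_partial[of "fst p - snd p"] elim by (simp add: Kker_def convergent_LIMSEQ_iff)
  ultimately show ?case
    unfolding HMf_def HM_def Hf_def Hphi_def by (auto intro!: tendsto_intros)
qed

text \<open>Orthogonality of the modes makes the truncations Cauchy with an explicit rate, and Fatou
  along the almost everywhere convergent sequence replaces one truncation by the kernel itself. The
  8 in the last bound is the 4 of the mode expansion doubled by (a + b)^2 <= 2 a^2 + 2 b^2.\<close>

lemma Hf_L2:
  assumes j: "j \<in> Z2_0"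
  shows "(\<lambda>M. \<integral>p. (HMf M j p - Hf j p)\<^sup>2 \<partial>tau4) \<longlonglongrightarrow> 0"
    and "integrable tau4 (\<lambda>p. (HMf M j p - Hf j p)\<^sup>2)"
    and "integrable tau4 (\<lambda>p. (Hf j p)\<^sup>2)"
    and "(\<integral>p. (Hf j p)\<^sup>2 \<partial>tau4) \<le> 8 * pi ^ 4 * (\<Sum>\<^sub>\<infinity>k. (gam j k)\<^sup>2)"
proof -
  obtain \<eta> where \<eta>: "\<eta> \<longlonglongrightarrow> 0" "\<And>M. 0 \<le> \<eta> M"
    "\<And>M R. finite R \<Longrightarrow> (\<Sum>k\<in>R. (gam_trunc M j k - gam j k)\<^sup>2) \<le> \<eta> M"
    using gam_trunc_sq_convergence[of j] by metis
  define G where "G = (\<Sum>\<^sub>\<infinity>k. (gam j k)\<^sup>2)"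
  define Q where "Q M N = square M \<union> (\<lambda>k. k - j) ` square M \<union> square N \<union> (\<lambda>k. k - j) ` square N" for M N
  have Q: "finite (Q M N)" "square M \<subseteq> Q M N" "(\<lambda>k. k - j) ` square M \<subseteq> Q M N"
    "square N \<subseteq> Q M N" "(\<lambda>k. k - j) ` square N \<subseteq> Q M N" for M N
    by (auto simp: Q_def)
  have sq2: "(a + b)\<^sup>2 \<le> 2 * a\<^sup>2 + 2 * b\<^sup>2" for a b :: real
    using sum_squares_bound[of a b] by (simp add: power2_sum)
  have d: "(\<integral>\<^sup>+ p. ennreal ((HMf M j p - HMf N j p)\<^sup>2) \<partial>tau4) \<le> ennreal (8 * pi ^ 4 * (\<eta> M + \<eta> N))" for M N
  proof -
    have "(\<Sum>k\<in>Q M N. (gam_trunc M j k - gam_trunc N j k)\<^sup>2)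
        \<le> (\<Sum>k\<in>Q M N. 2 * (gam_trunc M j k - gam j k)\<^sup>2 + 2 * (gam_trunc N j k - gam j k)\<^sup>2)"
    proof (rule sum_mono)
      fix k
      show "(gam_trunc M j k - gam_trunc N j k)\<^sup>2
          \<le> 2 * (gam_trunc M j k - gam j k)\<^sup>2 + 2 * (gam_trunc N j k - gam j k)\<^sup>2"
        using sq2[of "gam_trunc M j k - gam j k" "gam j k - gam_trunc N j k"]
        by (simp add: power2_commute[of "gam j k"])
    qed
    also have "\<dots> \<le> 2 * \<eta> M + 2 * \<eta> N"
      unfolding sum.distrib sum_distrib_left[symmetric] using \<eta>(3)[OF Q(1)] by (intro add_mono mult_left_mono) auto
    finally have "4 * pi ^ 4 * (\<Sum>k\<in>Q M N. (gam_trunc M j k - gam_trunc N j k)\<^sup>2) \<le> 4 * pi ^ 4 * (2 * \<eta> M + 2 * \<eta> N)"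
      by (intro mult_left_mono) auto
    then show ?thesis
      using integral_HMf_diff_sq[OF j Q[where M = M and N = N]]
      by (subst nn_integral_eq_integral) (auto intro!: ennreal_leI simp: algebra_simps)
  qed
  have lim: "(\<lambda>N. ennreal (8 * pi ^ 4 * (c + \<eta> N))) \<longlonglongrightarrow> ennreal (8 * pi ^ 4 * c)" for c
  proof -
    have "(\<lambda>N. 8 * pi ^ 4 * (c + \<eta> N)) \<longlonglongrightarrow> 8 * pi ^ 4 * (c + 0)"
      by (intro tendsto_mult tendsto_add tendsto_const \<eta>(1))
    then show ?thesis by (intro tendsto_ennrealI) simp
  qed
  have M: "(\<integral>\<^sup>+ p. ennreal ((HMf M j p - Hf j p)\<^sup>2) \<partial>tau4) \<le> ennreal (8 * pi ^ 4 * \<eta> M)" for M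
  proof (rule Fatou_sq[OF _ _ d lim])
    show "AE p in tau4. (\<lambda>N. HMf M j p - HMf N j p) \<longlonglongrightarrow> HMf M j p - Hf j p"
      using HMf_tendsto_Hf[of j] by eventually_elim (intro tendsto_intros)
  qed measurable
  show int: "integrable tau4 (\<lambda>p. (HMf M j p - Hf j p)\<^sup>2)" for M
    using M[of M] by (intro integrableI_bounded) (auto simp: le_less_trans[OF _ ennreal_less_top])
  have le: "(\<integral>p. (HMf M j p - Hf j p)\<^sup>2 \<partial>tau4) \<le> 8 * pi ^ 4 * \<eta> M" for M
    using M[of M] \<eta>(2)[of M] by (subst (asm) nn_integral_eq_integral[OF int]) auto
  show "(\<lambda>M. \<integral>p. (HMf M j p - Hf j p)\<^sup>2 \<partial>tau4) \<longlonglongrightarrow> 0"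
  proof (rule tendsto_zero_abs_le)
    show "(\<lambda>M. 8 * pi ^ 4 * \<eta> M) \<longlonglongrightarrow> 0" using tendsto_mult_right_zero[OF \<eta>(1)] .
    show "\<bar>\<integral>p. (HMf M j p - Hf j p)\<^sup>2 \<partial>tau4\<bar> \<le> 8 * pi ^ 4 * \<eta> M" for M
      using le[of M] by simp
  qed
  have G0: "0 \<le> G" unfolding G_def by (intro infsum_nonneg) auto
  have HM: "(\<integral>\<^sup>+ p. ennreal ((HMf M j p)\<^sup>2) \<partial>tau4) \<le> ennreal (8 * pi ^ 4 * (G + \<eta> M))" for M
  proof -
    have "(\<Sum>k\<in>Q M M. (gam_trunc M j k)\<^sup>2) \<le> (\<Sum>k\<in>Q M M. 2 * (gam_trunc M j k - gam j k)\<^sup>2 + 2 * (gam j k)\<^sup>2)"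
    proof (rule sum_mono)
      fix k
      show "(gam_trunc M j k)\<^sup>2 \<le> 2 * (gam_trunc M j k - gam j k)\<^sup>2 + 2 * (gam j k)\<^sup>2"
        using sq2[of "gam_trunc M j k - gam j k" "gam j k"] by simp
    qed
    also have "\<dots> \<le> 2 * \<eta> M + 2 * G"
      unfolding sum.distrib sum_distrib_left[symmetric] G_def using \<eta>(3)[OF Q(1)] Q(1)
      by (intro add_mono mult_left_mono finite_sum_le_infsum summable_on_gam_sq) auto
    finally have "4 * pi ^ 4 * (\<Sum>k\<in>Q M M. (gam_trunc M j k)\<^sup>2) \<le> 4 * pi ^ 4 * (2 * \<eta> M + 2 * G)"
      by (intro mult_left_mono) auto
    then show ?thesis
      using integral_HMf_sq[OF j Q(1-3)[where M = M and N = M]]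
      by (subst nn_integral_eq_integral) (auto intro!: ennreal_leI simp: algebra_simps)
  qed
  have H: "(\<integral>\<^sup>+ p. ennreal ((Hf j p)\<^sup>2) \<partial>tau4) \<le> ennreal (8 * pi ^ 4 * G)"
    by (rule Fatou_sq[OF _ HMf_tendsto_Hf HM lim]) measurable
  show intH: "integrable tau4 (\<lambda>p. (Hf j p)\<^sup>2)"
    using H by (intro integrableI_bounded) (auto simp: le_less_trans[OF _ ennreal_less_top])
  show "(\<integral>p. (Hf j p)\<^sup>2 \<partial>tau4) \<le> 8 * pi ^ 4 * (\<Sum>\<^sub>\<infinity>k. (gam j k)\<^sup>2)"
    using H G0 by (subst (asm) nn_integral_eq_integral[OF intH]) (auto simp: G_def)
qed

section \<open>Vanishing of the diagonal coefficients and of the mean\<close>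

lemma cos_mult_cos_cos:
  "cos a * (2 * cos b * cos c) = (cos (a + b + c) + cos (a + b - c) + cos (a - b + c) + cos (a - b - c)) / (2::real)"
  by (simp add: cos_add cos_diff sin_add sin_diff algebra_simps)

text \<open>The frequencies (p + j, - p) match those of e_k(x) e_k(y) only if p + j and - p both
  equal k or - k. As j is nonzero, this forces j = - 2 p; but then p is parallel to j and the
  numerator \<open>cross j p\<close> is 0. This is why no counterterm appears in the pairing with
  the kernel.\<close>

lemma gam_trunc_mult_integral_diagonal:
  assumes "j \<in> Z2_0"
  shows "gam_trunc M j p * (\<integral>q. mode j p q * ebasis2 (k, k) q \<partial>tau4) = 0"
proof (cases "p + p + j = (0, 0)")
  case True
  then have "fst j = - 2 * fst p" "snd j = - 2 * snd p" by (cases p; cases j; auto)+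
  then have "cross j p = 0" by (simp add: cross_def)
  then show ?thesis by (simp add: gam_trunc_def beta_trunc_def beta_def cross_add_self)
next
  case False
  let ?c = "\<lambda>u v b q. cos (2 * pi * (kdot u (fst q) + kdot v (snd q)) + b)"
  have eq: "mode j p q * ebasis2 (k, k) q
      = (?c (p + j + k) (- p + k) (phase j + phase k + phase k) q + ?c (p + j + k) (- p - k) (phase j) q
       + ?c (p + j - k) (- p + k) (phase j) q + ?c (p + j - k) (- p - k) (phase j - phase k - phase k) q) / 2" for q
  proof -
    have "ebasis2 (k, k) q = 2 * cos (2 * pi * kdot k (fst q) + phase k) * cos (2 * pi * kdot k (snd q) + phase k)"
      by (simp add: ebasis2_def ebasis_eq_cos)
    then have "mode j p q * ebasis2 (k, k) q = mode j p q * (2 * cos (2 * pi * kdot k (fst q) + phase k) * cos (2 * pi * kdot k (snd q) + phase k))"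
      by simp
    then show ?thesis
      unfolding mode_def cos_mult_cos_cos
      by (simp add: kdot_add_left kdot_diff_left kdot_minus_left algebra_simps)
  qed
  have int: "integrable tau4 (?c u v b)" for u v b
    by (rule integrable_bounded[where C = 1]) (auto intro: tau4.finite_measure_axioms)
  have "j \<noteq> (0, 0)" using assms by (simp add: Z2_0_def)
  then have z: "\<not> (p + j + k = (0, 0) \<and> - p + k = (0, 0))" "\<not> (p + j + k = (0, 0) \<and> - p - k = (0, 0))"
    "\<not> (p + j - k = (0, 0) \<and> - p + k = (0, 0))" "\<not> (p + j - k = (0, 0) \<and> - p - k = (0, 0))"
    using False by (cases p; cases k; cases j; auto)+
  have "(\<integral>q. mode j p q * ebasis2 (k, k) q \<partial>tau4)
     = ((\<integral>q. ?c (p + j + k) (- p + k) (phase j + phase k + phase k) q \<partial>tau4) + (\<integral>q. ?c (p + j + k) (- p - k) (phase j) q \<partial>tau4)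
       + (\<integral>q. ?c (p + j - k) (- p + k) (phase j) q \<partial>tau4) + (\<integral>q. ?c (p + j - k) (- p - k) (phase j - phase k - phase k) q \<partial>tau4)) / 2"
    unfolding eq integral_divide_zero using int by simp
  also have "\<dots> = 0" using z by (simp only: integral_cos_tau4 if_False) simp
  finally show ?thesis by simp
qed

lemma HMf_diagonal_and_mean:
  assumes j: "j \<in> Z2_0"
  shows "coef (HMf M j) (k, k) = 0" and "(\<integral>p. HMf M j p \<partial>tau4) = 0"
proof -
  define R where "R = square M \<union> (\<lambda>k. k - j) ` square M"
  define c where "c k = - (2 * sqrt 2 * pi\<^sup>2) * gam_trunc M j k" for k
  have eq: "HMf M j p = (\<Sum>k\<in>R. c k * mode j k p)" for p
    unfolding c_def R_def by (rule HMf_eq) auto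
  have int: "integrable tau4 (\<lambda>p. mode j l p)" for l
    by (rule integrable_bounded[where C = 1]) (auto intro: tau4.finite_measure_axioms simp: mode_def)
  have int2: "integrable tau4 (\<lambda>p. mode j l p * ebasis2 (k, k) p)" for l
    by (intro integrable_mult_ebasis2 integrable_mode_sq) simp
  have "coef (HMf M j) (k, k) = (\<integral>p. (\<Sum>l\<in>R. c l * (mode j l p * ebasis2 (k, k) p)) \<partial>tau4)"
    unfolding coef_def eq by (simp add: sum_distrib_right mult.assoc)
  also have "\<dots> = (\<Sum>l\<in>R. c l * (\<integral>p. mode j l p * ebasis2 (k, k) p \<partial>tau4))"
    using int2 by (subst Bochner_Integration.integral_sum) auto
  also have "\<dots> = 0"
    using gam_trunc_mult_integral_diagonal[OF j] by (intro sum.neutral) (simp add: c_def)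
  finally show "coef (HMf M j) (k, k) = 0" .
  have "(\<integral>p. mode j l p \<partial>tau4) = 0" for l
  proof -
    have "\<not> (l + j = (0, 0) \<and> - l = (0, 0))" using j by (cases l; cases j) (auto simp: Z2_0_def)
    then show ?thesis by (simp only: mode_def integral_cos_tau4 if_False)
  qed
  then show "(\<integral>p. HMf M j p \<partial>tau4) = 0"
    unfolding eq using int by (subst Bochner_Integration.integral_sum) auto
qed

lemma integral_sq_le:
  fixes f :: "(real \<times> real) \<times> (real \<times> real) \<Rightarrow> real"
  assumes [measurable]: "f \<in> borel_measurable borel" and "integrable tau4 (\<lambda>p. (f p)\<^sup>2)"
  shows "(\<integral>p. f p \<partial>tau4)\<^sup>2 \<le> (\<integral>p. (f p)\<^sup>2 \<partial>tau4)" and "integrable tau4 f"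
proof -
  show int: "integrable tau4 f"
    using integrable_mult_of_squares[of f tau4 "\<lambda>_. 1"] assms by simp
  show "(\<integral>p. f p \<partial>tau4)\<^sup>2 \<le> (\<integral>p. (f p)\<^sup>2 \<partial>tau4)"
    using tau4.variance_positive[of f] tau4.variance_eq[OF int assms(2)] by simp
qed

lemma coef_diff:
  assumes "f \<in> borel_measurable borel" "integrable tau4 (\<lambda>p. (f p)\<^sup>2)"
    "g \<in> borel_measurable borel" "integrable tau4 (\<lambda>p. (g p)\<^sup>2)"
  shows "coef (\<lambda>p. f p - g p) i = coef f i - coef g i"
  unfolding coef_def left_diff_distrib
  using integrable_mult_ebasis2[OF assms(1,2)] integrable_mult_ebasis2[OF assms(3,4)] by simp

text \<open>By Bessel a single coefficient is bounded by the L2 norm, so vanishing for all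
  truncations passes to the limit. The mean is treated in the same way below, with the variance in
  place of Bessel.\<close>

lemma Hf_diagonal:
  assumes j: "j \<in> Z2_0" and k: "k \<in> Z2_0"
  shows "coef (Hf j) (k, k) = 0"
proof -
  have intM: "integrable tau4 (\<lambda>p. (HMf M j p)\<^sup>2)" for M
    by (rule integral_HMf_sq(2)[OF j, of "square M \<union> (\<lambda>k. k - j) ` square M"]) auto
  have "(coef (Hf j) (k, k))\<^sup>2 \<le> (\<integral>p. (HMf M j p - Hf j p)\<^sup>2 \<partial>tau4)" for M
  proof -
    have "coef (\<lambda>p. HMf M j p - Hf j p) (k, k) = - coef (Hf j) (k, k)"
      using coef_diff[OF _ intM _ Hf_L2(3)[OF j]] HMf_diagonal_and_mean(1)[OF j] by simp
    then show ?thesis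
      using sum_coef_sq_le[of "\<lambda>p. HMf M j p - Hf j p" "{(k, k)}"] Hf_L2(2)[OF j] k by simp
  qed
  from LIMSEQ_le_const[OF Hf_L2(1)[OF j]] this have "(coef (Hf j) (k, k))\<^sup>2 \<le> 0" by blast
  then show ?thesis by simp
qed

lemma Hf_mean:
  assumes j: "j \<in> Z2_0"
  shows "(\<integral>p. Hf j p \<partial>tau4) = 0"
proof -
  have intM: "integrable tau4 (\<lambda>p. (HMf M j p)\<^sup>2)" for M
    by (rule integral_HMf_sq(2)[OF j, of "square M \<union> (\<lambda>k. k - j) ` square M"]) auto
  have "(\<integral>p. Hf j p \<partial>tau4)\<^sup>2 \<le> (\<integral>p. (HMf M j p - Hf j p)\<^sup>2 \<partial>tau4)" for M
  proof -
    have "(\<integral>p. HMf M j p - Hf j p \<partial>tau4) = - (\<integral>p. Hf j p \<partial>tau4)"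
      using integral_sq_le(2)[OF _ intM] integral_sq_le(2)[OF _ Hf_L2(3)[OF j]] HMf_diagonal_and_mean(2)[OF j] by simp
    then show ?thesis
      using integral_sq_le(1)[OF _ Hf_L2(2)[OF j, of M]] by simp
  qed
  from LIMSEQ_le_const[OF Hf_L2(1)[OF j]] this have "(\<integral>p. Hf j p \<partial>tau4)\<^sup>2 \<le> 0" by blast
  then show ?thesis by simp
qed

section \<open>Fourier coefficients of smooth periodic functions\<close>

lemma (in prob_space) abs_expectation_le:
  fixes f :: "'a \<Rightarrow> real"
  assumes "\<And>x. \<bar>f x\<bar> \<le> c"
  shows "\<bar>expectation f\<bar> \<le> c"
proof (cases "integrable M f")
  case True
  have "\<bar>expectation f\<bar> \<le> (\<integral>x. \<bar>f x\<bar> \<partial>M)" by (rule integral_abs_bound)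
  also have "\<dots> \<le> (\<integral>x. c \<partial>M)"
    using True assms by (intro integral_mono) auto
  finally have "\<bar>expectation f\<bar> \<le> (\<integral>x. c \<partial>M)" .
  then show ?thesis by (simp add: prob_space)
next
  case False
  then show ?thesis using assms[of undefined] by (simp add: not_integrable_integral_eq)
qed

lemma smooth_funD:
  assumes "smooth_fun f"
  shows "f differentiable (at x)" "smooth_fun (\<lambda>x. frechet_derivative f (at x) v)"
  using assms by (auto elim: smooth_fun.cases)

lemma smooth_fun_continuous: "smooth_fun f \<Longrightarrow> continuous_on UNIV f"
  using smooth_funD(1) differentiable_imp_continuous_within by (fastforce simp: continuous_on_eq_continuous_within)

definition smooth_periodic :: "((real \<times> real) \<times> (real \<times> real) \<Rightarrow> real) \<Rightarrow> bool" where
  "smooth_periodic f \<longleftrightarrow> smooth_fun f \<and> (\<forall>p a b. f (p + (rvec a, rvec b)) = f p)"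

lemma frechet_derivative_periodic:
  fixes f :: "'a::real_normed_vector \<Rightarrow> real"
  assumes "\<And>x. f differentiable (at x)" "\<And>x. f (x + c) = f x"
  shows "frechet_derivative f (at (x + c)) = frechet_derivative f (at x)"
proof -
  have "(f has_derivative frechet_derivative f (at (x + c))) (at (x + c))"
    using assms(1) by (simp add: frechet_derivative_works[symmetric])
  moreover have "((\<lambda>x. x + c) has_derivative (\<lambda>h. h)) (at x)"
    by (auto intro!: derivative_eq_intros)
  ultimately have "((\<lambda>x. f (x + c)) has_derivative (\<lambda>h. frechet_derivative f (at (x + c)) h)) (at x)"
    using has_derivative_compose[of "\<lambda>x. x + c" "\<lambda>h. h" x UNIV f] by simp
  then have "(f has_derivative frechet_derivative f (at (x + c))) (at x)"
    by (simp add: assms(2))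
  then show ?thesis by (rule frechet_derivative_at)
qed

lemma smooth_periodic_differentiable: "smooth_periodic f \<Longrightarrow> f differentiable (at p)"
  using smooth_funD(1) unfolding smooth_periodic_def by blast

lemma smooth_periodic_deriv:
  assumes "smooth_periodic f"
  shows "smooth_periodic (\<lambda>p. frechet_derivative f (at p) v)"
  unfolding smooth_periodic_def
proof (intro conjI allI)
  show "smooth_fun (\<lambda>p. frechet_derivative f (at p) v)"
    using assms smooth_funD(2) unfolding smooth_periodic_def by blast
  fix p a b
  have "f (q + (rvec a, rvec b)) = f q" for q
    using assms unfolding smooth_periodic_def by blast
  from frechet_derivative_periodic[OF smooth_periodic_differentiable[OF assms] this]
  show "frechet_derivative f (at (p + (rvec a, rvec b))) v = frechet_derivative f (at p) v" by simp
qed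

lemma smooth_periodic_continuous: "smooth_periodic f \<Longrightarrow> continuous_on UNIV f"
  by (simp add: smooth_periodic_def smooth_fun_continuous)

lemma smooth_periodic_measurable: "smooth_periodic f \<Longrightarrow> f \<in> borel_measurable borel"
  by (intro borel_measurable_continuous_onI smooth_periodic_continuous)

lemma smooth_periodic_bounded:
  assumes f: "smooth_periodic f"
  obtains B where "\<And>p. \<bar>f p\<bar> \<le> B"
proof -
  have "compact (T2 \<times> T2)" unfolding T2_def by (intro compact_Times compact_Icc)
  then have "compact (f ` (T2 \<times> T2))"
    using smooth_periodic_continuous[OF f] by (intro compact_continuous_image) (auto intro: continuous_on_subset)
  then have "bounded (f ` (T2 \<times> T2))" by (rule compact_imp_bounded)
  then obtain B where B: "\<forall>z\<in>f ` (T2 \<times> T2). norm z \<le> B" unfolding bounded_iff by blast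
  define fl where "fl x = (\<lfloor>fst x\<rfloor>, \<lfloor>snd x\<rfloor>)" for x :: "real \<times> real"
  have in_T2: "x - rvec (fl x) \<in> T2" for x
    by (cases x) (auto simp: T2_def rvec_def fl_def; linarith)
  have "\<bar>f p\<bar> \<le> B" for p
  proof -
    let ?q = "(fst p - rvec (fl (fst p)), snd p - rvec (fl (snd p)))"
    have "f (?q + (rvec (fl (fst p)), rvec (fl (snd p)))) = f ?q"
      using f unfolding smooth_periodic_def by blast
    then have "f p = f ?q" by simp
    moreover have "?q \<in> T2 \<times> T2" using in_T2 by auto
    ultimately show ?thesis using B by (metis imageI real_norm_def)
  qed
  then show ?thesis by (rule that)
qed

lemma smooth_periodic_directional:
  assumes "smooth_periodic f"
  shows "((\<lambda>t. f (p + t *\<^sub>R e)) has_real_derivative frechet_derivative f (at (p + t *\<^sub>R e)) e) (at t)"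
proof -
  have "(f has_derivative frechet_derivative f (at (p + t *\<^sub>R e))) (at (p + t *\<^sub>R e))"
    using smooth_periodic_differentiable[OF assms] by (simp add: frechet_derivative_works[symmetric])
  moreover have "((\<lambda>t. p + t *\<^sub>R e) has_derivative (\<lambda>h. h *\<^sub>R e)) (at t)"
    by (auto intro!: derivative_eq_intros)
  ultimately have D: "((\<lambda>t. f (p + t *\<^sub>R e)) has_derivative (\<lambda>h. frechet_derivative f (at (p + t *\<^sub>R e)) (h *\<^sub>R e))) (at t)"
    by (rule has_derivative_compose[rotated])
  have "linear (frechet_derivative f (at (p + t *\<^sub>R e)))"
    by (rule linear_frechet_derivative[OF smooth_periodic_differentiable[OF assms]])
  from linear_cmul[OF this] D show ?thesis
    by (simp add: has_field_derivative_def mult.commute[of _ "frechet_derivative f (at (p + t *\<^sub>R e)) e"])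
qed

text \<open>The sine produced by integration is written as a cosine with phase b - pi / 2, so both
  sides have the same shape and the step can be iterated.\<close>

lemma integral_by_parts_cos:
  fixes g g' :: "real \<Rightarrow> real" and n :: int
  assumes g: "\<And>t. (g has_real_derivative g' t) (at t)" and g': "continuous_on UNIV g'"
    and per: "g 1 = g 0" and n: "n \<noteq> 0"
  shows "(\<integral>t. g t * cos (2 * pi * of_int n * t + b) \<partial>tau1)
    = - (1 / (2 * pi * of_int n)) * (\<integral>t. g' t * cos (2 * pi * of_int n * t + (b - pi / 2)) \<partial>tau1)"
proof -
  let ?w = "2 * pi * of_int n :: real"
  have gc: "continuous_on UNIV g"
    using g by (intro DERIV_continuous_on) (auto intro: has_field_derivative_at_within)
  have [measurable]: "g \<in> borel_measurable borel" "g' \<in> borel_measurable borel"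
    using gc g' by (auto intro: borel_measurable_continuous_onI)
  have bnd: "\<exists>B. \<forall>t\<in>{0..1}. \<bar>u t\<bar> \<le> B" if "continuous_on UNIV u" for u :: "real \<Rightarrow> real"
  proof -
    have "compact (u ` {0..1})"
      using that by (intro compact_continuous_image) (auto intro: continuous_on_subset)
    then have "bounded (u ` {0..1})" by (rule compact_imp_bounded)
    then show ?thesis unfolding bounded_iff by auto
  qed
  have int: "integrable tau1 (\<lambda>t. u t * cos (?w * t + c))" if u: "continuous_on UNIV u" for u c
  proof -
    obtain B where B: "\<And>t. t \<in> {0..1} \<Longrightarrow> \<bar>u t\<bar> \<le> B" using bnd[OF u] by blast
    have [measurable]: "u \<in> borel_measurable borel" using u by (rule borel_measurable_continuous_onI)
    have "AE t in tau1. t \<in> {0..1}" unfolding tau1_def by (subst AE_density) (auto simp: indicator_def)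
    then have "AE t in tau1. norm (u t * cos (?w * t + c)) \<le> B"
    proof eventually_elim
      case (elim t)
      have "0 \<le> B" using B[OF elim] by linarith
      then show ?case using mult_mono[OF B[OF elim] abs_cos_le_one[of "?w * t + c"]] by (simp add: abs_mult)
    qed
    then show ?thesis by (rule tau1.integrable_const_bound) measurable
  qed
  have "0 = (\<integral>t. (g t * cos (?w * t + b) + 1 / ?w * (g' t * cos (?w * t + (b - pi / 2)))) \<partial>tau1)"
  proof -
    \<comment> \<open>Antiderivative of the whole integrand; its values at 0 and 1 agree because g
      and the sine do.\<close>
    let ?F = "\<lambda>t. g t * sin (?w * t + b) / ?w"
    let ?f = "\<lambda>t. g t * cos (?w * t + b) + 1 / ?w * (g' t * cos (?w * t + (b - pi / 2)))"
    have "(\<integral>t. ?f t * indicator {0..1} t \<partial>lborel) = ?F 1 - ?F 0"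
    proof (rule integral_FTC_Icc_real)
      show "(?F has_real_derivative ?f t) (at t)" for t
      proof -
        have "cos (?w * t + (b - pi / 2)) = sin (?w * t + b)"
          unfolding sin_cos_eq by (subst cos_minus[symmetric]) (simp add: algebra_simps)
        then show ?thesis using n by (auto intro!: derivative_eq_intros g simp: field_simps)
      qed
      have "continuous_on UNIV ?f" by (intro continuous_intros gc g')
      then show "isCont ?f t" for t by (simp add: continuous_on_eq_continuous_at)
    qed simp
    moreover have "sin (?w * 1 + b) = sin (?w * 0 + b)"
      by (simp add: sin_add sin_int_2pin cos_int_2pin)
    ultimately show ?thesis using per by (simp add: integral_tau1)
  qed
  also have "\<dots> = (\<integral>t. g t * cos (?w * t + b) \<partial>tau1) + 1 / ?w * (\<integral>t. g' t * cos (?w * t + (b - pi / 2)) \<partial>tau1)"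
    using int[OF gc] int[OF g'] by simp
  finally show ?thesis by linarith
qed

text \<open>Uniformity in the phase \<open>b\<close> is what the induction consumes, since every
  integration by parts shifts it. Uniformity in the base point \<open>p\<close> lets the remaining
  coordinates be frozen there.\<close>

lemma smooth_periodic_coef_decay_1d:
  assumes "smooth_periodic f" "\<And>p. f (p + e) = f p"
  shows "\<exists>B. \<forall>p n b. n \<noteq> 0 \<longrightarrow>
    \<bar>\<integral>t. f (p + t *\<^sub>R e) * cos (2 * pi * of_int n * t + b) \<partial>tau1\<bar> \<le> B / \<bar>real_of_int n\<bar> ^ r"
  using assms
proof (induction r arbitrary: f)
  case 0
  obtain B where B: "\<And>p. \<bar>f p\<bar> \<le> B" using smooth_periodic_bounded[OF 0(1)] by metis
  have B0: "0 \<le> B" using B[of 0] by linarith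
  have "\<bar>\<integral>t. f (p + t *\<^sub>R e) * cos (2 * pi * of_int n * t + b) \<partial>tau1\<bar> \<le> B" for p n b
  proof -
    have "\<bar>f (p + t *\<^sub>R e) * cos (2 * pi * of_int n * t + b)\<bar> \<le> B" for t
      using mult_mono[OF B[of "p + t *\<^sub>R e"] abs_cos_le_one[of "2 * pi * of_int n * t + b"]] B0 by (simp add: abs_mult)
    then show ?thesis by (rule tau1.abs_expectation_le)
  qed
  then show ?case by (intro exI[of _ B]) simp
next
  case (Suc r)
  let ?f' = "\<lambda>p. frechet_derivative f (at p) e"
  have f': "smooth_periodic ?f'" by (rule smooth_periodic_deriv[OF Suc.prems(1)])
  have per: "?f' (p + e) = ?f' p" for p
    by (subst frechet_derivative_periodic[OF smooth_periodic_differentiable[OF Suc.prems(1)] Suc.prems(2)]) simp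
  obtain B where B: "\<And>p n b. n \<noteq> 0 \<Longrightarrow>
    \<bar>\<integral>t. ?f' (p + t *\<^sub>R e) * cos (2 * pi * of_int n * t + b) \<partial>tau1\<bar> \<le> B / \<bar>real_of_int n\<bar> ^ r"
    using Suc.IH[OF f' per] by blast
  have "\<bar>\<integral>t. f (p + t *\<^sub>R e) * cos (2 * pi * of_int n * t + b) \<partial>tau1\<bar> \<le> B / \<bar>real_of_int n\<bar> ^ Suc r"
    if n: "n \<noteq> 0" for p n b
  proof -
    have "continuous_on UNIV (\<lambda>t. ?f' (p + t *\<^sub>R e))"
      by (rule continuous_on_compose2[OF smooth_periodic_continuous[OF f']]) (auto intro!: continuous_intros)
    then have "(\<integral>t. f (p + t *\<^sub>R e) * cos (2 * pi * of_int n * t + b) \<partial>tau1)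
      = - (1 / (2 * pi * of_int n)) * (\<integral>t. ?f' (p + t *\<^sub>R e) * cos (2 * pi * of_int n * t + (b - pi / 2)) \<partial>tau1)"
      using Suc.prems n by (intro integral_by_parts_cos smooth_periodic_directional) auto
    then have "\<bar>\<integral>t. f (p + t *\<^sub>R e) * cos (2 * pi * of_int n * t + b) \<partial>tau1\<bar>
      = 1 / (2 * pi * \<bar>of_int n\<bar>) * \<bar>\<integral>t. ?f' (p + t *\<^sub>R e) * cos (2 * pi * of_int n * t + (b - pi / 2)) \<partial>tau1\<bar>"
      by (simp add: abs_mult abs_divide)
    also have "\<dots> \<le> 1 / \<bar>real_of_int n\<bar> * (B / \<bar>real_of_int n\<bar> ^ r)"
    proof (rule mult_mono)
      have "1 * \<bar>real_of_int n\<bar> \<le> 2 * pi * \<bar>real_of_int n\<bar>"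
        using pi_ge_two by (intro mult_right_mono) auto
      then show "1 / (2 * pi * \<bar>real_of_int n\<bar>) \<le> 1 / \<bar>real_of_int n\<bar>"
        using n by (intro divide_left_mono) auto
    qed (use B[OF n] in auto)
    finally show ?thesis by simp
  qed
  then show ?case by blast
qed

text \<open>Four integrations by parts in the direction of the larger component of k, with the other
  coordinate absorbed into base point and phase.\<close>

lemma smooth_periodic_coef_decay:
  assumes f: "smooth_periodic f"
  obtains C where "0 \<le> C" "\<And>x k b. k \<in> Z2_0 \<Longrightarrow>
    \<bar>\<integral>y. f (x, y) * cos (2 * pi * kdot k y + b) \<partial>tau2\<bar> \<le> C / (knorm2 k)\<^sup>2"
proof -
  define e1 e2 :: "(real \<times> real) \<times> (real \<times> real)" where "e1 = (0, (1, 0))" and "e2 = (0, (0, 1))"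
  have "e1 = (rvec (0, 0), rvec (1, 0))" "e2 = (rvec (0, 0), rvec (0, 1))"
    by (simp_all add: e1_def e2_def rvec_def zero_prod_def)
  then have per: "f (p + e1) = f p" "f (p + e2) = f p" for p
    using f unfolding smooth_periodic_def by metis+
  obtain B1 where B1: "\<And>p n b. n \<noteq> 0 \<Longrightarrow>
    \<bar>\<integral>t. f (p + t *\<^sub>R e1) * cos (2 * pi * of_int n * t + b) \<partial>tau1\<bar> \<le> B1 / \<bar>real_of_int n\<bar> ^ 4"
    using smooth_periodic_coef_decay_1d[OF f per(1), of 4] by blast
  obtain B2 where B2: "\<And>p n b. n \<noteq> 0 \<Longrightarrow>
    \<bar>\<integral>t. f (p + t *\<^sub>R e2) * cos (2 * pi * of_int n * t + b) \<partial>tau1\<bar> \<le> B2 / \<bar>real_of_int n\<bar> ^ 4"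
    using smooth_periodic_coef_decay_1d[OF f per(2), of 4] by blast
  define B where "B = \<bar>B1\<bar> + \<bar>B2\<bar>"
  have B0: "0 \<le> B" and BB: "B1 \<le> B" "B2 \<le> B" by (auto simp: B_def)
  obtain F where F: "\<And>p. \<bar>f p\<bar> \<le> F" using smooth_periodic_bounded[OF f] by metis
  have [measurable]: "f \<in> borel_measurable borel" by (rule smooth_periodic_measurable[OF f])
  have mx[measurable]: "(\<lambda>y. f (x, y)) \<in> borel_measurable borel" for x
    by (intro borel_measurable_continuous_onI continuous_on_compose2[OF smooth_periodic_continuous[OF f]])
       (auto intro!: continuous_intros)
  have int: "integrable tau2 (\<lambda>y. f (x, y) * cos (2 * pi * kdot k y + b))" for x k b
  proof (rule integrable_bounded[where C = F])
    show "\<bar>f (x, y) * cos (2 * pi * kdot k y + b)\<bar> \<le> F" for y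
      using mult_mono[OF F[of "(x, y)"] abs_cos_le_one[of "2 * pi * kdot k y + b"]] F[of 0] by (simp add: abs_mult)
  qed (auto intro: tau2.finite_measure_axioms)
  have "\<bar>\<integral>y. f (x, y) * cos (2 * pi * kdot k y + b) \<partial>tau2\<bar> \<le> 4 * B / (knorm2 k)\<^sup>2" if k: "k \<in> Z2_0" for x k b
  proof -
    have nz: "fst k \<noteq> 0 \<or> snd k \<noteq> 0" using k by (cases k) (auto simp: Z2_0_def)
    \<comment> \<open>\<open>n\<close> will be the component of larger absolute value, for which
      |k|^2 <= 2 n^2; squaring gives the constant 4.\<close>
    have fin: "B / \<bar>real_of_int n\<bar> ^ 4 \<le> 4 * B / (knorm2 k)\<^sup>2" if n: "n \<noteq> 0" "knorm2 k \<le> 2 * real_of_int n ^ 2" for n :: int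
    proof -
      have "(knorm2 k)\<^sup>2 \<le> (2 * real_of_int n ^ 2)\<^sup>2" using n by (intro power_mono) auto
      also have "\<dots> = 4 * \<bar>real_of_int n\<bar> ^ 4" by (simp add: power_mult_distrib)
      finally have "4 * B / (4 * \<bar>real_of_int n\<bar> ^ 4) \<le> 4 * B / (knorm2 k)\<^sup>2"
        using n B0 knorm2_ge_1[OF k] by (intro divide_left_mono mult_pos_pos) auto
      then show ?thesis by simp
    qed
    show ?thesis
    proof (cases "\<bar>snd k\<bar> \<le> \<bar>fst k\<bar>")
      case True
      then have n: "fst k \<noteq> 0" using nz by auto
      have "\<bar>real_of_int (snd k)\<bar> \<le> \<bar>real_of_int (fst k)\<bar>" using True by linarith
      then have "knorm2 k \<le> 2 * real_of_int (fst k) ^ 2" by (simp add: knorm2_def abs_le_square_iff)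
      moreover have "\<bar>\<integral>y. f (x, y) * cos (2 * pi * kdot k y + b) \<partial>tau2\<bar> \<le> B / \<bar>real_of_int (fst k)\<bar> ^ 4"
        unfolding integral_tau2_fubini(2)[OF int]
      proof (rule tau1.abs_expectation_le)
        fix t
        have "(\<integral>s. f (x, (s, t)) * cos (2 * pi * kdot k (s, t) + b) \<partial>tau1)
           = (\<integral>s. f ((x, (0, t)) + s *\<^sub>R e1) * cos (2 * pi * of_int (fst k) * s + (2 * pi * of_int (snd k) * t + b)) \<partial>tau1)"
          by (simp add: e1_def kdot_def algebra_simps)
        then show "\<bar>\<integral>s. f (x, (s, t)) * cos (2 * pi * kdot k (s, t) + b) \<partial>tau1\<bar> \<le> B / \<bar>real_of_int (fst k)\<bar> ^ 4"
          using order_trans[OF B1[OF n, of "(x, (0, t))" "2 * pi * of_int (snd k) * t + b"] divide_right_mono[OF BB(1)]] by simp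
      qed
      ultimately show ?thesis using fin[OF n] by linarith
    next
      case False
      then have n: "snd k \<noteq> 0" using nz by auto
      have "\<bar>real_of_int (fst k)\<bar> \<le> \<bar>real_of_int (snd k)\<bar>" using False by linarith
      then have "knorm2 k \<le> 2 * real_of_int (snd k) ^ 2" by (simp add: knorm2_def abs_le_square_iff)
      moreover have "\<bar>\<integral>y. f (x, y) * cos (2 * pi * kdot k y + b) \<partial>tau2\<bar> \<le> B / \<bar>real_of_int (snd k)\<bar> ^ 4"
        unfolding integral_tau2_fubini(1)[OF int]
      proof (rule tau1.abs_expectation_le)
        fix s
        have "(\<integral>t. f (x, (s, t)) * cos (2 * pi * kdot k (s, t) + b) \<partial>tau1)
           = (\<integral>t. f ((x, (s, 0)) + t *\<^sub>R e2) * cos (2 * pi * of_int (snd k) * t + (2 * pi * of_int (fst k) * s + b)) \<partial>tau1)"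
          by (simp add: e2_def kdot_def algebra_simps)
        then show "\<bar>\<integral>t. f (x, (s, t)) * cos (2 * pi * kdot k (s, t) + b) \<partial>tau1\<bar> \<le> B / \<bar>real_of_int (snd k)\<bar> ^ 4"
          using order_trans[OF B2[OF n, of "(x, (s, 0))" "2 * pi * of_int (fst k) * s + b"] divide_right_mono[OF BB(2)]] by simp
      qed
      ultimately show ?thesis using fin[OF n] by linarith
    qed
  qed
  then show ?thesis using B0 by (intro that[of "4 * B"]) auto
qed

section \<open>Pointwise Fourier inversion and the trace\<close>

text \<open>The Dirichlet kernel with its denominator multiplied out, so that it holds at integer u
  too.\<close>

lemma sum_cos_mult_sin:
  "sin (pi * u) * (\<Sum>k = - int n..int n. cos (2 * pi * of_int k * u)) = sin ((2 * real n + 1) * pi * u)"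
proof -
  have "sin (pi * u) * (1 + (\<Sum>i<n. 2 * cos (2 * pi * (1 + real i) * u))) = sin ((2 * real n + 1) * pi * u)"
  proof (induction n)
    case (Suc n)
    define A where "A = 2 * pi * (1 + real n) * u"
    have "(2 * real (Suc n) + 1) * pi * u = A + pi * u" "(2 * real n + 1) * pi * u = A - pi * u"
      by (simp_all add: A_def algebra_simps)
    with Suc show ?case
      unfolding sum.lessThan_Suc A_def[symmetric] by (simp add: distrib_left sin_add sin_diff)
  qed simp
  moreover have "cos (2 * pi * of_int (1 + int i) * u) + cos (2 * pi * of_int (- (1 + int i)) * u)
      = 2 * cos (2 * pi * (1 + real i) * u)" for i
  proof -
    have "2 * pi * of_int (- (1 + int i)) * u = - (2 * pi * of_int (1 + int i) * u)"
      by (simp only: of_int_minus mult_minus_left mult_minus_right)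
    then have "cos (2 * pi * of_int (- (1 + int i)) * u) = cos (2 * pi * of_int (1 + int i) * u)"
      by (simp only: cos_minus)
    then show ?thesis by simp
  qed
  ultimately show ?thesis unfolding sum_symmetric_int by simp
qed

text \<open>Compares the distance to the nearest integer with the denominator of the Dirichlet
  kernel. Up to 1/3 the mean value theorem applies with cos >= 1/2 and pi >= 2; beyond, the sine is
  at least sin (pi / 6) = 1/2.\<close>

lemma abs_le_abs_sin_pi:
  fixes t :: real
  assumes "\<bar>t\<bar> \<le> 1 / 2"
  shows "\<bar>t\<bar> \<le> \<bar>sin (pi * t)\<bar>"
proof -
  have main: "t \<le> sin (pi * t)" if t: "0 \<le> t" "t \<le> 1 / 2" for t :: real
  proof (cases "t \<le> 1 / 3")
    case True
    show ?thesis
    proof (cases "t = 0")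
      case False
      then have p: "0 < pi * t" using t by simp
      obtain z where z: "0 < z" "z < pi * t" "sin (pi * t) - sin 0 = (pi * t - 0) * cos z"
        using MVT2[OF p, of sin cos] by (auto intro: DERIV_sin)
      have "pi * t \<le> pi * (1 / 3)" using True by (intro mult_left_mono) auto
      then have "z \<le> pi / 3" using z by linarith
      then have "cos (pi / 3) \<le> cos z"
        using z by (intro cos_monotone_0_pi_le) auto
      then have "1 / 2 \<le> cos z" by (simp add: cos_60)
      then have "pi * t * (1 / 2) \<le> pi * t * cos z" using p by (intro mult_left_mono) auto
      then have "pi * t * (1 / 2) \<le> sin (pi * t)" using z(3) by simp
      moreover have "2 * t \<le> pi * t" using t pi_ge_two by (intro mult_right_mono) auto
      ultimately show ?thesis by linarith
    qed simp
  next
    case False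
    have "sin (pi / 6) \<le> sin (pi * t)"
    proof (rule sin_monotone_2pi_le)
      have "pi * (1 / 6) \<le> pi * t" using False by (intro mult_left_mono) auto
      then show "pi / 6 \<le> pi * t" by simp
      have "pi * t \<le> pi * (1 / 2)" using t by (intro mult_left_mono) auto
      then show "pi * t \<le> pi / 2" by simp
    qed (use pi_gt_zero in linarith)
    then show ?thesis using t by (simp add: sin_30)
  qed
  show ?thesis
  proof (cases "0 \<le> t")
    case True then show ?thesis using main[of t] assms by linarith
  next
    case False
    then have "- t \<le> sin (pi * - t)" using assms by (intro main) auto
    then show ?thesis using False by simp
  qed
qed

lemma periodic_add_int:
  fixes f :: "real \<Rightarrow> 'a"
  assumes "\<And>t. f (t + 1) = f t"
  shows "f (t + of_int m) = f t"
proof -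
  have nat: "f (t + real n) = f t" for n t
  proof (induction n)
    case (Suc n)
    have "f (t + real (Suc n)) = f ((t + real n) + 1)" by (simp add: add_ac)
    then show ?case using Suc assms by simp
  qed simp
  show ?thesis
  proof (cases "0 \<le> m")
    case True then show ?thesis using nat[of t "nat m"] by simp
  next
    case False
    then show ?thesis using nat[of "t + of_int m" "nat (- m)"] by simp
  qed
qed

text \<open>The Lipschitz bound makes the quotient \<open>q\<close> of f t - f x by sin (pi (x - t))
  bounded. The error of the n-th partial sum is the integral of \<open>q\<close> against sin ((2 n +
  1) pi (x - t)); these sines are orthogonal, so Bessel makes the errors square summable and hence
  null.\<close>

lemma Dirichlet_kernel_convergence:
  fixes f :: "real \<Rightarrow> real"
  assumes per: "\<And>t. f (t + 1) = f t" and lip: "\<And>s t. \<bar>f s - f t\<bar> \<le> L * \<bar>s - t\<bar>"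
  shows "(\<lambda>n. \<Sum>k = - int n..int n. \<integral>t. f t * cos (2 * pi * of_int k * (x - t)) \<partial>tau1) \<longlonglongrightarrow> f x"
proof -
  have L0: "0 \<le> L" using order_trans[OF abs_ge_zero lip[of 0 1]] by simp
  have fm[measurable]: "f \<in> borel_measurable borel"
  proof (rule borel_measurable_continuous_onI)
    have "L-lipschitz_on UNIV f" using lip L0 by (auto simp: lipschitz_on_def dist_real_def)
    then show "continuous_on UNIV f" by (rule lipschitz_on_continuous_on)
  qed
  define q where "q t = (f t - f x) / sin (pi * (x - t))" for t
  have bound: "\<bar>f t - f x\<bar> \<le> L * \<bar>sin (pi * (x - t))\<bar>" for t
  proof -
    \<comment> \<open>By periodicity t may be replaced by its integer translate within distance 1/2
      of x.\<close>
    define m where "m = round (x - t)"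
    define d where "d = x - t - of_int m"
    have d: "\<bar>d\<bar> \<le> 1 / 2" unfolding d_def m_def using of_int_round_abs_le[of "x - t"] by linarith
    have "\<bar>f t - f x\<bar> = \<bar>f (t + of_int m) - f x\<bar>" by (simp add: periodic_add_int[of f, OF per])
    also have "\<dots> \<le> L * \<bar>d\<bar>" using lip[of "t + of_int m" x] by (simp add: d_def abs_minus_commute algebra_simps)
    also have "\<dots> \<le> L * \<bar>sin (pi * d)\<bar>" by (rule mult_left_mono[OF abs_le_abs_sin_pi[OF d] L0])
    also have "\<bar>sin (pi * d)\<bar> = \<bar>sin (pi * (x - t))\<bar>"
    proof -
      have "pi * d = pi * (x - t) - of_int m * pi" by (simp add: d_def algebra_simps)
      then show ?thesis by (simp add: sin_diff abs_mult sin_npi_int cos_npi_int mult.commute[of _ pi])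
    qed
    finally show ?thesis .
  qed
  have q_bound: "\<bar>q t\<bar> \<le> L" for t
  proof (cases "sin (pi * (x - t)) = 0")
    case False
    then show ?thesis using bound[of t] by (simp add: q_def abs_divide divide_le_eq mult.commute)
  qed (simp add: q_def L0)
  \<comment> \<open>Where the sine vanishes, \<open>bound\<close> forces f t = f x, so the value 0
    of the division is consistent.\<close>
  have q_mult: "f t - f x = q t * sin (pi * (x - t))" for t
    using bound[of t] by (cases "sin (pi * (x - t)) = 0") (auto simp: q_def)
  have qm[measurable]: "q \<in> borel_measurable borel" unfolding q_def by measurable
  have q2: "integrable tau1 (\<lambda>t. (q t)\<^sup>2)"
    by (rule integrable_bounded[where C = "L\<^sup>2"])
       (use q_bound L0 in \<open>auto intro: tau1.finite_measure_axioms simp: power2_le_iff_abs_le\<close>)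
  define \<phi> where "\<phi> n t = sin ((2 * real n + 1) * pi * (x - t))" for n t
  have \<phi>m[measurable]: "\<phi> n \<in> borel_measurable borel" for n unfolding \<phi>_def by measurable
  have \<phi>2: "integrable tau1 (\<lambda>t. (\<phi> n t)\<^sup>2)" for n
    by (rule integrable_bounded[where C = 1])
       (auto intro: tau1.finite_measure_axioms simp: \<phi>_def abs_square_le_1)
  have icos: "integrable tau1 (\<lambda>t. cos (2 * pi * of_int i * t + b))" for i :: int and b
    by (rule integrable_bounded[where C = 1]) (auto intro: tau1.finite_measure_axioms)
  have orth: "(\<integral>t. \<phi> n t * \<phi> m t \<partial>tau1) = (if n = m then 1 / 2 else 0)" for n m
  proof -
    have eq: "\<phi> n t * \<phi> m t = (cos (2 * pi * of_int (int m - int n) * t + 2 * pi * (real n - real m) * x)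
        - cos (2 * pi * of_int (- int n - int m - 1) * t + 2 * pi * (real n + real m + 1) * x)) / 2" for t
      unfolding \<phi>_def sin_times_sin by (simp add: algebra_simps)
    have "(\<integral>t. \<phi> n t * \<phi> m t \<partial>tau1) = ((if int m - int n = 0 then cos (2 * pi * (real n - real m) * x) else 0)
        - (if - int n - int m - 1 = 0 then cos (2 * pi * (real n + real m + 1) * x) else 0)) / 2"
      unfolding eq integral_divide_zero
      by (subst Bochner_Integration.integral_diff[OF icos icos]) (simp only: integral_cos_tau1)
    then show ?thesis by auto
  qed
  have "(\<Sum>n<N. (\<integral>t. q t * \<phi> n t \<partial>tau1)\<^sup>2) \<le> (1 / 2) * (\<integral>t. (q t)\<^sup>2 \<partial>tau1)" for N
    by (intro Bessel_inequality orth) (auto simp: \<phi>2 q2)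
  then have "summable (\<lambda>n. (\<integral>t. q t * \<phi> n t \<partial>tau1)\<^sup>2)"
    by (intro summableI_nonneg_bounded[where x = "(1 / 2) * (\<integral>t. (q t)\<^sup>2 \<partial>tau1)"]) auto
  from summable_LIMSEQ_zero[OF this] have "(\<lambda>n. \<integral>t. q t * \<phi> n t \<partial>tau1) \<longlonglongrightarrow> 0"
    by (simp add: power_tendsto_0_iff)
  moreover have "(\<integral>t. q t * \<phi> n t \<partial>tau1)
      = (\<Sum>k = - int n..int n. \<integral>t. f t * cos (2 * pi * of_int k * (x - t)) \<partial>tau1) - f x" for n
  proof -
    have cs: "cos (2 * pi * of_int k * (x - t)) = cos (2 * pi * of_int (- k) * t + 2 * pi * of_int k * x)" for k :: int and t
      by (simp add: algebra_simps)
    have i1: "integrable tau1 (\<lambda>t. (f t - f x) * cos (2 * pi * of_int k * (x - t)))" for k :: int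
    proof (rule integrable_bounded[where C = L])
      fix t
      have "\<bar>f t - f x\<bar> \<le> L" using bound[of t] mult_left_mono[OF abs_sin_le_one[of "pi * (x - t)"] L0] by simp
      then show "\<bar>(f t - f x) * cos (2 * pi * of_int k * (x - t))\<bar> \<le> L"
        using mult_mono[OF _ abs_cos_le_one, of "\<bar>f t - f x\<bar>" L "2 * pi * of_int k * (x - t)"] L0 by (simp add: abs_mult)
    qed (auto intro: tau1.finite_measure_axioms)
    have i2: "integrable tau1 (\<lambda>t. f x * cos (2 * pi * of_int k * (x - t)))" for k :: int
      unfolding cs by (intro integrable_mult_right icos)
    have split: "(\<integral>t. f t * cos (2 * pi * of_int k * (x - t)) \<partial>tau1)
        = (\<integral>t. (f t - f x) * cos (2 * pi * of_int k * (x - t)) \<partial>tau1) + (if k = 0 then f x else 0)" for k :: int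
    proof -
      have "(\<integral>t. f t * cos (2 * pi * of_int k * (x - t)) \<partial>tau1)
         = (\<integral>t. (f t - f x) * cos (2 * pi * of_int k * (x - t)) + f x * cos (2 * pi * of_int k * (x - t)) \<partial>tau1)"
        by (simp add: algebra_simps)
      also have "\<dots> = (\<integral>t. (f t - f x) * cos (2 * pi * of_int k * (x - t)) \<partial>tau1)
          + f x * (\<integral>t. cos (2 * pi * of_int k * (x - t)) \<partial>tau1)"
        using Bochner_Integration.integral_add[OF i1 i2, of k] by simp
      also have "(\<integral>t. cos (2 * pi * of_int k * (x - t)) \<partial>tau1) = (if k = 0 then 1 else 0)"
        unfolding cs integral_cos_tau1 by simp
      finally show ?thesis by simp
    qed
    have "(\<Sum>k = - int n..int n. \<integral>t. f t * cos (2 * pi * of_int k * (x - t)) \<partial>tau1)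
       = (\<Sum>k = - int n..int n. \<integral>t. (f t - f x) * cos (2 * pi * of_int k * (x - t)) \<partial>tau1) + f x"
      unfolding split sum.distrib by (simp add: sum.delta)
    also have "(\<Sum>k = - int n..int n. \<integral>t. (f t - f x) * cos (2 * pi * of_int k * (x - t)) \<partial>tau1)
       = (\<integral>t. (\<Sum>k = - int n..int n. (f t - f x) * cos (2 * pi * of_int k * (x - t))) \<partial>tau1)"
      by (rule Bochner_Integration.integral_sum[symmetric]) (rule i1)
    also have "\<dots> = (\<integral>t. q t * \<phi> n t \<partial>tau1)"
    proof (rule Bochner_Integration.integral_cong[OF refl])
      fix t
      show "(\<Sum>k = - int n..int n. (f t - f x) * cos (2 * pi * of_int k * (x - t))) = q t * \<phi> n t"
        unfolding sum_distrib_left[symmetric] q_mult \<phi>_def sum_cos_mult_sin[symmetric] by (simp only: mult.assoc)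
    qed
    finally show ?thesis by simp
  qed
  ultimately have "(\<lambda>n. ((\<Sum>k = - int n..int n. \<integral>t. f t * cos (2 * pi * of_int k * (x - t)) \<partial>tau1) - f x) + f x) \<longlonglongrightarrow> 0 + f x"
    by (intro tendsto_add tendsto_const) simp
  then show ?thesis by simp
qed

lemma smooth_periodic_lipschitz:
  assumes "smooth_periodic f"
  obtains L where "\<And>p s t. \<bar>f (p + s *\<^sub>R e) - f (p + t *\<^sub>R e)\<bar> \<le> L * \<bar>s - t\<bar>"
proof -
  obtain L where L: "\<And>p. \<bar>frechet_derivative f (at p) e\<bar> \<le> L"
    by (rule smooth_periodic_bounded[OF smooth_periodic_deriv[OF assms, of e]]) (rule that; blast)
  have "\<bar>f (p + s *\<^sub>R e) - f (p + t *\<^sub>R e)\<bar> \<le> L * \<bar>s - t\<bar>" for p s t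
  proof -
    have "norm (f (p + s *\<^sub>R e) - f (p + t *\<^sub>R e)) \<le> L * norm (s - t)"
      by (rule field_differentiable_bound[of UNIV "\<lambda>t. f (p + t *\<^sub>R e)" "\<lambda>t. frechet_derivative f (at (p + t *\<^sub>R e)) e"])
         (use smooth_periodic_directional[OF assms] L in \<open>auto intro: has_field_derivative_at_within\<close>)
    then show ?thesis by simp
  qed
  then show ?thesis by (rule that)
qed

text \<open>The product of cosines is cos (2 pi k . (x - y)) averaged over a sign change of one
  component of k. Summed over symmetric sets it agrees with the kernel of the Fourier partial sum,
  and its product form lets the one-dimensional theorem be applied in each variable.\<close>

definition kernel_coef :: "((real \<times> real) \<times> (real \<times> real) \<Rightarrow> real) \<Rightarrow> real \<times> real \<Rightarrow> int \<times> int \<Rightarrow> real" where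
  "kernel_coef f x k = (\<integral>y. f (x, y) * (cos (2 * pi * of_int (fst k) * (fst x - fst y))
      * cos (2 * pi * of_int (snd k) * (snd x - snd y))) \<partial>tau2)"

lemma smooth_periodic_slice_measurable:
  assumes "smooth_periodic f"
  shows "(\<lambda>y. f (x, y)) \<in> borel_measurable borel"
  by (intro borel_measurable_continuous_onI continuous_on_compose2[OF smooth_periodic_continuous[OF assms]])
     (auto intro!: continuous_intros)

lemma integrable_slice:
  assumes "smooth_periodic f" "g \<in> borel_measurable borel" "\<And>y. \<bar>g y\<bar> \<le> c"
  shows "integrable tau2 (\<lambda>y. f (x, y) * g y)"
proof -
  note [measurable] = smooth_periodic_slice_measurable[OF assms(1), of x] assms(2)
  obtain F where F: "\<And>p. \<bar>f p\<bar> \<le> F" by (rule smooth_periodic_bounded[OF assms(1)]) (rule that; blast)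
  have "0 \<le> F" using F[of 0] by linarith
  show ?thesis
  proof (rule integrable_bounded[where C = "F * c"])
    show "\<bar>f (x, y) * g y\<bar> \<le> F * c" for y
      unfolding abs_mult using F assms(3) \<open>0 \<le> F\<close> by (intro mult_mono) auto
  qed (auto intro: tau2.finite_measure_axioms)
qed

lemma kernel_coef_decay:
  assumes f: "smooth_periodic f"
  obtains C where "0 \<le> C" "\<And>x k. k \<in> Z2_0 \<Longrightarrow> \<bar>kernel_coef f x k\<bar> \<le> C / (knorm2 k)\<^sup>2"
proof -
  obtain C where C: "0 \<le> C" "\<And>x k b. k \<in> Z2_0 \<Longrightarrow>
    \<bar>\<integral>y. f (x, y) * cos (2 * pi * kdot k y + b) \<partial>tau2\<bar> \<le> C / (knorm2 k)\<^sup>2"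
    by (rule smooth_periodic_coef_decay[OF f]) (rule that; blast)
  have "\<bar>kernel_coef f x k\<bar> \<le> C / (knorm2 k)\<^sup>2" if k: "k \<in> Z2_0" for x k
  proof -
    \<comment> \<open>Product-to-sum splits the integrand into the frequencies k and its reflection
      k', which has the same length.\<close>
    define k' where "k' = (fst k, - snd k)"
    have k': "k' \<in> Z2_0" "knorm2 k' = knorm2 k" using k by (auto simp: k'_def Z2_0_def knorm2_def prod_eq_iff)
    have int: "integrable tau2 (\<lambda>y. f (x, y) * cos (2 * pi * kdot l y + b))" for l b
      by (rule integrable_slice[OF f, where c = 1]) auto
    have eq: "f (x, y) * (cos (2 * pi * of_int (fst k) * (fst x - fst y)) * cos (2 * pi * of_int (snd k) * (snd x - snd y)))
       = (f (x, y) * cos (2 * pi * kdot k' y + - 2 * pi * kdot k' x) + f (x, y) * cos (2 * pi * kdot k y + - 2 * pi * kdot k x)) / 2" for y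
    proof -
      define A B where "A = 2 * pi * of_int (fst k) * (fst x - fst y)" and "B = 2 * pi * of_int (snd k) * (snd x - snd y)"
      have 1: "2 * pi * kdot k' y + - 2 * pi * kdot k' x = - (A - B)" "2 * pi * kdot k y + - 2 * pi * kdot k x = - (A + B)"
        by (simp_all add: A_def B_def kdot_def k'_def algebra_simps)
      show ?thesis unfolding 1 A_def[symmetric] B_def[symmetric] cos_minus cos_times_cos
        by (simp add: algebra_simps)
    qed
    have "kernel_coef f x k = ((\<integral>y. f (x, y) * cos (2 * pi * kdot k' y + - 2 * pi * kdot k' x) \<partial>tau2)
        + (\<integral>y. f (x, y) * cos (2 * pi * kdot k y + - 2 * pi * kdot k x) \<partial>tau2)) / 2"
      unfolding kernel_coef_def eq integral_divide_zero by (subst Bochner_Integration.integral_add[OF int int]) simp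
    then show ?thesis using C(2)[OF k, of x "- 2 * pi * kdot k x"] C(2)[OF k'(1), of x "- 2 * pi * kdot k' x"] k'(2)
      by simp
  qed
  then show ?thesis using C(1) by (intro that[of C]) auto
qed

lemma summable_on_inverse_knorm2_sq: "(\<lambda>k. 1 / (knorm2 k)\<^sup>2) summable_on Z2_0"
proof -
  have "(\<lambda>k. knorm2 k powr (- 2)) summable_on Z2_0" by (rule summable_on_knorm2_powr) simp
  moreover have "knorm2 k powr (- 2) = 1 / (knorm2 k)\<^sup>2" if "k \<in> Z2_0" for k
    using knorm2_ge_1[OF that] by (simp add: powr_minus divide_inverse)
  ultimately show ?thesis by (simp cong: summable_on_cong)
qed

lemma summable_on_kernel_coef:
  assumes f: "smooth_periodic f"
  shows "kernel_coef f x summable_on UNIV"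
proof -
  obtain C where C: "0 \<le> C" "\<And>x k. k \<in> Z2_0 \<Longrightarrow> \<bar>kernel_coef f x k\<bar> \<le> C / (knorm2 k)\<^sup>2"
    by (rule kernel_coef_decay[OF f]) (rule that; blast)
  have g: "(\<lambda>k. C * (1 / (knorm2 k)\<^sup>2)) summable_on Z2_0"
    by (rule summable_on_cmult_right[OF summable_on_inverse_knorm2_sq])
  have b: "norm (kernel_coef f x k) \<le> C * (1 / (knorm2 k)\<^sup>2)" if "k \<in> Z2_0" for k
    using C(2)[OF that] by simp
  have "(\<lambda>k. norm (kernel_coef f x k)) summable_on Z2_0"
    by (rule Infinite_Sum.abs_summable_on_comparison_test'[OF g b])
  then have "kernel_coef f x summable_on Z2_0" by (rule Infinite_Sum.abs_summable_summable)
  moreover have "kernel_coef f x summable_on {(0, 0)}" by simp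
  moreover have "Z2_0 \<inter> {(0, 0)} = {}" "Z2_0 \<union> {(0, 0)} = UNIV" by (auto simp: Z2_0_def)
  ultimately show ?thesis using summable_on_Un_disjoint[of "kernel_coef f x" Z2_0 "{(0, 0)}"] by simp
qed

lemma infsum_eq_symmetric_limit:
  fixes g :: "int \<Rightarrow> real"
  assumes "g summable_on UNIV" "(\<lambda>n. \<Sum>k = - int n..int n. g k) \<longlonglongrightarrow> l"
  shows "infsum g UNIV = l"
proof -
  have "(\<lambda>n. sum g {- int n..int n}) \<longlonglongrightarrow> infsum g UNIV"
    using has_sum_infsum[OF assms(1)]
  proof (rule tendsto_sum_exhausting)
    show "eventually (\<lambda>n. k \<in> {- int n..int n}) sequentially" for k
      by (rule eventually_sequentiallyI[of "nat \<bar>k\<bar>"]) auto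
  qed auto
  from LIMSEQ_unique[OF this assms(2)] show ?thesis .
qed

text \<open>Absolute summability permits an iterated sum: the inner one inverts the Fourier series
  in the second coordinate of y with the first frequency fixed, the outer one in the first
  coordinate.\<close>

lemma infsum_kernel_coef:
  assumes f: "smooth_periodic f"
  shows "infsum (kernel_coef f x) UNIV = f (x, x)"
proof -
  define e1 e2 :: "(real \<times> real) \<times> (real \<times> real)" where "e1 = (0, (1, 0))" and "e2 = (0, (0, 1))"
  have "e1 = (rvec (0, 0), rvec (1, 0))" "e2 = (rvec (0, 0), rvec (0, 1))"
    by (simp_all add: e1_def e2_def rvec_def zero_prod_def)
  then have per: "f (p + e1) = f p" "f (p + e2) = f p" for p
    using f unfolding smooth_periodic_def by metis+
  have p1: "f (x, (s + 1, t)) = f (x, (s, t))" and p2: "f (x, (s, t + 1)) = f (x, (s, t))" for s t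
    using per(1)[of "(x, (s, t))"] per(2)[of "(x, (s, t))"] by (simp_all add: e1_def e2_def)
  obtain L1 where L1: "\<And>p s t. \<bar>f (p + s *\<^sub>R e1) - f (p + t *\<^sub>R e1)\<bar> \<le> L1 * \<bar>s - t\<bar>"
    by (rule smooth_periodic_lipschitz[OF f, where e = e1]) (rule that; blast)
  obtain L2 where L2: "\<And>p s t. \<bar>f (p + s *\<^sub>R e2) - f (p + t *\<^sub>R e2)\<bar> \<le> L2 * \<bar>s - t\<bar>"
    by (rule smooth_periodic_lipschitz[OF f, where e = e2]) (rule that; blast)
  have l1: "\<bar>f (x, (s, t)) - f (x, (s', t))\<bar> \<le> L1 * \<bar>s - s'\<bar>" for s s' t
    using L1[of "(x, (0, t))" s s'] by (simp add: e1_def)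
  have l2: "\<bar>f (x, (s, t)) - f (x, (s, t'))\<bar> \<le> L2 * \<bar>t - t'\<bar>" for s t t'
    using L2[of "(x, (s, 0))" t t'] by (simp add: e2_def)
  obtain F where F: "\<And>p. \<bar>f p\<bar> \<le> F" by (rule smooth_periodic_bounded[OF f]) (rule that; blast)
  have fs: "(\<lambda>s. f (x, (s, t))) \<in> borel_measurable borel" for t
    by (intro borel_measurable_continuous_onI continuous_on_compose2[OF smooth_periodic_continuous[OF f]])
       (auto intro!: continuous_intros)
  have ints: "integrable tau1 (\<lambda>s. f (x, (s, t)) * cos (2 * pi * of_int k * (fst x - s)))" for t and k :: int
  proof (rule integrable_bounded[where C = F])
    show "\<bar>f (x, s, t) * cos (2 * pi * of_int k * (fst x - s))\<bar> \<le> F" for s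
      using mult_mono[OF F[of "(x, s, t)"] abs_cos_le_one[of "2 * pi * of_int k * (fst x - s)"]] F[of 0]
      by (simp add: abs_mult)
  qed (use fs in \<open>auto intro: tau1.finite_measure_axioms\<close>)
  define G where "G k t = (\<integral>s. f (x, (s, t)) * cos (2 * pi * of_int k * (fst x - s)) \<partial>tau1)" for k :: int and t
  have Gper: "G k (t + 1) = G k t" for k t by (simp add: G_def p2)
  \<comment> \<open>Integrating out s keeps periodicity and the Lipschitz bound in t, so the
    one-dimensional theorem applies to \<open>G k\<close>.\<close>
  have Glip: "\<bar>G k t - G k t'\<bar> \<le> L2 * \<bar>t - t'\<bar>" for k t t'
  proof -
    have "G k t - G k t' = (\<integral>s. (f (x, (s, t)) - f (x, (s, t'))) * cos (2 * pi * of_int k * (fst x - s)) \<partial>tau1)"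
      unfolding G_def left_diff_distrib by (rule Bochner_Integration.integral_diff[OF ints ints, symmetric])
    moreover have "\<bar>(f (x, (s, t)) - f (x, (s, t'))) * cos (2 * pi * of_int k * (fst x - s))\<bar> \<le> L2 * \<bar>t - t'\<bar>" for s
      using mult_mono[OF l2[of s t t'] abs_cos_le_one[of "2 * pi * of_int k * (fst x - s)"]]
        order_trans[OF abs_ge_zero l2[of s t t']] by (simp add: abs_mult)
    ultimately show ?thesis by (simp only: tau1.abs_expectation_le)
  qed
  have kc: "kernel_coef f x (k, l) = (\<integral>t. G k t * cos (2 * pi * of_int l * (snd x - t)) \<partial>tau1)" for k l
  proof -
    have "integrable tau2 (\<lambda>y. f (x, y) * (cos (2 * pi * of_int k * (fst x - fst y)) * cos (2 * pi * of_int l * (snd x - snd y))))"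
    proof (rule integrable_slice[OF f, where c = 1])
      show "\<bar>cos (2 * pi * of_int k * (fst x - fst y)) * cos (2 * pi * of_int l * (snd x - snd y))\<bar> \<le> 1" for y
        using mult_mono[OF abs_cos_le_one[of "2 * pi * of_int k * (fst x - fst y)"] abs_cos_le_one[of "2 * pi * of_int l * (snd x - snd y)"]]
        by (simp add: abs_mult)
    qed measurable
    from integral_tau2_fubini(2)[OF this] show ?thesis
      by (simp add: kernel_coef_def G_def mult.assoc[symmetric])
  qed
  have sm: "kernel_coef f x summable_on UNIV \<times> UNIV" using summable_on_kernel_coef[OF f] by simp
  then have sm': "(\<lambda>(k, l). kernel_coef f x (k, l)) summable_on UNIV \<times> UNIV" by (simp add: case_prod_beta')
  have inner: "infsum (\<lambda>l. kernel_coef f x (k, l)) UNIV = G k (snd x)" for k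
  proof (rule infsum_eq_symmetric_limit)
    have "kernel_coef f x summable_on (Pair k ` UNIV)"
      using summable_on_kernel_coef[OF f] by (rule summable_on_subset_banach) simp
    then show "(\<lambda>l. kernel_coef f x (k, l)) summable_on UNIV"
      by (subst (asm) summable_on_reindex) (auto simp: o_def inj_on_def)
    show "(\<lambda>n. \<Sum>l = - int n..int n. kernel_coef f x (k, l)) \<longlonglongrightarrow> G k (snd x)"
      unfolding kc by (rule Dirichlet_kernel_convergence[OF Gper Glip])
  qed
  have outer: "infsum (\<lambda>k. G k (snd x)) UNIV = f (x, x)"
  proof (rule infsum_eq_symmetric_limit)
    show "(\<lambda>k. G k (snd x)) summable_on UNIV"
      using summable_on_Sigma_banach[OF sm'] by (simp add: inner)
    show "(\<lambda>n. \<Sum>k = - int n..int n. G k (snd x)) \<longlonglongrightarrow> f (x, x)"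
      using Dirichlet_kernel_convergence[of "\<lambda>s. f (x, (s, snd x))" L1 "fst x", OF p1 l1]
      by (simp add: G_def)
  qed
  show ?thesis
    using infsum_Sigma'_banach[OF sm'] by (simp add: inner outer case_prod_beta')
qed

text \<open>\<open>Lambda\<close> omits the zero mode; the subtracted term is the mean of f over
  y.\<close>

lemma sum_kernel_coef_Lambda:
  assumes f: "smooth_periodic f"
  shows "(\<lambda>m. \<Sum>k\<in>Lambda m. kernel_coef f x k) \<longlonglongrightarrow> f (x, x) - kernel_coef f x (0, 0)"
proof -
  have "(kernel_coef f x has_sum f (x, x)) UNIV"
    using has_sum_infsum[OF summable_on_kernel_coef[OF f]] by (simp add: infsum_kernel_coef[OF f])
  then have "(\<lambda>m. sum (kernel_coef f x) (insert (0, 0) (Lambda m))) \<longlonglongrightarrow> f (x, x)"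
  proof (rule tendsto_sum_exhausting)
    show "eventually (\<lambda>m. k \<in> insert (0, 0) (Lambda m)) sequentially" for k
    proof (cases "k \<in> Z2_0")
      case True
      from eventually_in_Lambda[OF this] show ?thesis by eventually_elim simp
    qed (auto simp: Z2_0_def)
  qed auto
  moreover have "sum (kernel_coef f x) (insert (0, 0) (Lambda m)) = kernel_coef f x (0, 0) + (\<Sum>k\<in>Lambda m. kernel_coef f x k)" for m
    using Lambda_subset[of m] by (intro sum.insert) (auto simp: Z2_0_def)
  ultimately have "(\<lambda>m. (kernel_coef f x (0, 0) + (\<Sum>k\<in>Lambda m. kernel_coef f x k)) - kernel_coef f x (0, 0))
      \<longlonglongrightarrow> f (x, x) - kernel_coef f x (0, 0)"
    by (intro tendsto_diff tendsto_const) simp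
  then show ?thesis by simp
qed

text \<open>Two symmetries of the disc are used: k -> - k cancels the terms in x + y, which carry
  opposite signs for sine and cosine, and reflecting the first component cancels the products of
  sines.\<close>

lemma sum_ebasis_Lambda:
  "(\<Sum>k\<in>Lambda m. ebasis k x * ebasis k y)
   = (\<Sum>k\<in>Lambda m. cos (2 * pi * of_int (fst k) * (fst x - fst y)) * cos (2 * pi * of_int (snd k) * (snd x - snd y)))"
proof -
  define \<sigma> :: "int \<times> int \<Rightarrow> real" where "\<sigma> k = (if k \<in> Z2_plus then 1 else - 1)" for k
  have e: "ebasis k x * ebasis k y = cos (2 * pi * kdot k (x - y)) + \<sigma> k * cos (2 * pi * (kdot k x + kdot k y))" for k
  proof -
    define A B where "A = 2 * pi * kdot k x" and "B = 2 * pi * kdot k y"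
    have AB: "2 * pi * kdot k (x - y) = A - B" "2 * pi * (kdot k x + kdot k y) = A + B"
      by (simp_all add: A_def B_def kdot_diff_right algebra_simps)
    show ?thesis
      unfolding AB ebasis_def A_def[symmetric] B_def[symmetric] \<sigma>_def
      by (simp add: cos_add cos_diff)
  qed
  have odd0: "(\<Sum>k\<in>Lambda m. g k) = 0" if "\<And>k. k \<in> Lambda m \<Longrightarrow> r k \<in> Lambda m" "\<And>k. r (r k) = k"
    "\<And>k. k \<in> Lambda m \<Longrightarrow> g (r k) = - g k" for g :: "int \<times> int \<Rightarrow> real" and r
  proof -
    have "(\<Sum>k\<in>Lambda m. g k) = (\<Sum>k\<in>Lambda m. - g k)"
      by (rule sum.reindex_bij_witness[of _ r r]) (use that in auto)
    then show ?thesis by (simp add: sum_negf)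
  qed
  have "(\<Sum>k\<in>Lambda m. \<sigma> k * cos (2 * pi * (kdot k x + kdot k y))) = 0"
  proof (rule odd0[of uminus])
    fix k assume k: "k \<in> Lambda m"
    then show "- k \<in> Lambda m" using Lambda_uminus[of m] by blast
    have "k \<in> Z2_0" using k Lambda_subset by blast
    moreover have "2 * pi * (kdot (- k) x + kdot (- k) y) = - (2 * pi * (kdot k x + kdot k y))"
      by (simp add: kdot_minus_left algebra_simps)
    then have "cos (2 * pi * (kdot (- k) x + kdot (- k) y)) = cos (2 * pi * (kdot k x + kdot k y))"
      by (simp only: cos_minus)
    ultimately show "\<sigma> (- k) * cos (2 * pi * (kdot (- k) x + kdot (- k) y)) = - (\<sigma> k * cos (2 * pi * (kdot k x + kdot k y)))"
      using Z2_plus_uminus[of k] by (simp add: \<sigma>_def)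
  qed simp
  moreover have "cos (2 * pi * kdot k (x - y))
      = cos (2 * pi * of_int (fst k) * (fst x - fst y)) * cos (2 * pi * of_int (snd k) * (snd x - snd y))
      - sin (2 * pi * of_int (fst k) * (fst x - fst y)) * sin (2 * pi * of_int (snd k) * (snd x - snd y))" for k
    by (simp add: kdot_def cos_add[symmetric] algebra_simps)
  moreover have "(\<Sum>k\<in>Lambda m. sin (2 * pi * of_int (fst k) * (fst x - fst y)) * sin (2 * pi * of_int (snd k) * (snd x - snd y))) = 0"
  proof (rule odd0[of "\<lambda>k. (- fst k, snd k)"])
    fix k assume "k \<in> Lambda m"
    then show "(- fst k, snd k) \<in> Lambda m" by (cases k) (auto simp: Lambda_def Z2_0_def knorm2_def)
  qed auto
  ultimately show ?thesis
    unfolding e by (simp add: sum.distrib sum_subtractf)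
qed

lemma smooth_periodic_sq_integrable: "smooth_periodic f \<Longrightarrow> integrable tau4 (\<lambda>p. (f p)\<^sup>2)"
proof -
  assume f: "smooth_periodic f"
  obtain F where F: "\<And>p. \<bar>f p\<bar> \<le> F" by (rule smooth_periodic_bounded[OF f]) (rule that; blast)
  have "0 \<le> F" using F[of 0] by linarith
  then show ?thesis
    by (intro integrable_bounded[where C = "F\<^sup>2"])
       (use F smooth_periodic_measurable[OF f] in \<open>auto intro: tau4.finite_measure_axioms simp: power2_le_iff_abs_le\<close>)
qed

text \<open>Diagonal coefficients and integrals of \<open>kernel_coef\<close> agree only after
  summation over the symmetric set \<open>Lambda m\<close>. Pointwise inversion on the diagonal then
  passes under the integral, with a majorant \<open>S\<close> independent of x and m, and what
  remains is the missing zero mode.\<close>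

lemma trace_limit:
  assumes f: "smooth_periodic f" and tr: "(\<integral>x. f (x, x) \<partial>tau2) = 0"
  shows "(\<lambda>m. \<Sum>k\<in>Lambda m. coef f (k, k)) \<longlonglongrightarrow> - (\<integral>p. f p \<partial>tau4)"
proof -
  note [measurable] = smooth_periodic_measurable[OF f]
  obtain C where C: "0 \<le> C" "\<And>x k. k \<in> Z2_0 \<Longrightarrow> \<bar>kernel_coef f x k\<bar> \<le> C / (knorm2 k)\<^sup>2"
    by (rule kernel_coef_decay[OF f]) (rule that; blast)
  define S where "S = C * (\<Sum>\<^sub>\<infinity>k\<in>Z2_0. 1 / (knorm2 k)\<^sup>2)"
  let ?D = "\<lambda>k p. cos (2 * pi * of_int (fst k) * (fst (fst p) - fst (snd p))) * cos (2 * pi * of_int (snd k) * (snd (fst p) - snd (snd p)))"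
  obtain F where F: "\<And>p. \<bar>f p\<bar> \<le> F" by (rule smooth_periodic_bounded[OF f]) (rule that; blast)
  have F0: "0 \<le> F" using F[of 0] by linarith
  have Dle: "\<bar>?D k p\<bar> \<le> 1" for k :: "int \<times> int" and p :: "(real \<times> real) \<times> (real \<times> real)"
    unfolding abs_mult using mult_mono[OF abs_cos_le_one abs_cos_le_one] by simp
  have intD: "integrable tau4 (\<lambda>p. f p * ?D k p)" for k
  proof (rule integrable_bounded[where C = "F * 1"])
    show "\<bar>f p * ?D k p\<bar> \<le> F * 1" for p
      unfolding abs_mult[of "f p"] using F Dle F0 by (intro mult_mono) auto
  qed (auto intro: tau4.finite_measure_axioms)
  have inner: "(\<integral>y. f (x, y) * ?D k (x, y) \<partial>tau2) = kernel_coef f x k" for x k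
    by (simp add: kernel_coef_def)
  have kint: "integrable tau2 (\<lambda>x. kernel_coef f x k)" for k
    using tau22.integrable_fst'[of "\<lambda>p. f p * ?D k p"] intD[of k] unfolding tau4_eq_pair inner by simp
  have kI: "(\<integral>p. f p * ?D k p \<partial>tau4) = (\<integral>x. kernel_coef f x k \<partial>tau2)" for k
    using integral_tau4_fubini[OF intD[of k]] unfolding inner .
  have sum_eq: "(\<Sum>k\<in>Lambda m. coef f (k, k)) = (\<integral>x. (\<Sum>k\<in>Lambda m. kernel_coef f x k) \<partial>tau2)" for m
  proof -
    have "(\<Sum>k\<in>Lambda m. coef f (k, k)) = (\<integral>p. (\<Sum>k\<in>Lambda m. f p * ebasis2 (k, k) p) \<partial>tau4)"
      unfolding coef_def
      by (rule Bochner_Integration.integral_sum[symmetric])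
         (intro integrable_mult_ebasis2 smooth_periodic_measurable smooth_periodic_sq_integrable f)
    also have "\<dots> = (\<integral>p. (\<Sum>k\<in>Lambda m. f p * ?D k p) \<partial>tau4)"
      unfolding sum_distrib_left[symmetric] ebasis2_def fst_conv snd_conv sum_ebasis_Lambda ..
    also have "\<dots> = (\<Sum>k\<in>Lambda m. \<integral>x. kernel_coef f x k \<partial>tau2)"
      unfolding kI[symmetric] by (rule Bochner_Integration.integral_sum[OF intD])
    also have "\<dots> = (\<integral>x. (\<Sum>k\<in>Lambda m. kernel_coef f x k) \<partial>tau2)"
      by (rule Bochner_Integration.integral_sum[symmetric, OF kint])
    finally show ?thesis .
  qed
  have "(\<lambda>m. \<integral>x. (\<Sum>k\<in>Lambda m. kernel_coef f x k) \<partial>tau2) \<longlonglongrightarrow> (\<integral>x. f (x, x) - kernel_coef f x (0, 0) \<partial>tau2)"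
  proof (rule integral_dominated_convergence[where w = "\<lambda>_. S"])
    have fm: "(\<lambda>x. f (x, x)) \<in> borel_measurable borel"
      by (intro borel_measurable_continuous_onI continuous_on_compose2[OF smooth_periodic_continuous[OF f]])
         (auto intro!: continuous_intros)
    then show "(\<lambda>x. f (x, x) - kernel_coef f x (0, 0)) \<in> borel_measurable tau2"
      using kint[of "(0, 0)"] by (intro borel_measurable_diff) auto
    show "(\<lambda>x. \<Sum>k\<in>Lambda m. kernel_coef f x k) \<in> borel_measurable tau2" for m
      using kint by (intro borel_measurable_sum) auto
    show "AE x in tau2. (\<lambda>m. \<Sum>k\<in>Lambda m. kernel_coef f x k) \<longlonglongrightarrow> f (x, x) - kernel_coef f x (0, 0)"
      using sum_kernel_coef_Lambda[OF f] by simp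
    show "AE x in tau2. norm (\<Sum>k\<in>Lambda m. kernel_coef f x k) \<le> S" for m
    proof (rule AE_I2)
      fix x
      have "norm (\<Sum>k\<in>Lambda m. kernel_coef f x k) \<le> (\<Sum>k\<in>Lambda m. C * (1 / (knorm2 k)\<^sup>2))"
      proof (rule sum_norm_le)
        fix k assume "k \<in> Lambda m"
        then have "k \<in> Z2_0" using Lambda_subset by blast
        from C(2)[OF this, of x] show "norm (kernel_coef f x k) \<le> C * (1 / (knorm2 k)\<^sup>2)" by simp
      qed
      also have "\<dots> = C * (\<Sum>k\<in>Lambda m. 1 / (knorm2 k)\<^sup>2)" by (simp add: sum_distrib_left)
      also have "\<dots> \<le> S"
        unfolding S_def using C(1) Lambda_subset
        by (intro mult_left_mono finite_sum_le_infsum summable_on_inverse_knorm2_sq) auto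
      finally show "norm (\<Sum>k\<in>Lambda m. kernel_coef f x k) \<le> S" .
    qed
  qed simp
  also have "(\<integral>x. f (x, x) - kernel_coef f x (0, 0) \<partial>tau2) = - (\<integral>p. f p \<partial>tau4)"
  proof -
    have "(\<lambda>x. f (x, x)) \<in> borel_measurable borel"
      by (intro borel_measurable_continuous_onI continuous_on_compose2[OF smooth_periodic_continuous[OF f]])
         (auto intro!: continuous_intros)
    then have "integrable tau2 (\<lambda>x. f (x, x))"
      using F by (intro integrable_bounded[where C = F]) (auto intro: tau2.finite_measure_axioms)
    moreover have "(\<integral>x. kernel_coef f x (0, 0) \<partial>tau2) = (\<integral>p. f p \<partial>tau4)"
      using kI[of "(0, 0)"] by simp
    ultimately show ?thesis using kint[of "(0, 0)"] tr by simp
  qed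
  finally show ?thesis unfolding sum_eq .
qed

section \<open>Admissible kernels\<close>

text \<open>Coinduction over all amplitudes and phases: a derivative in direction v multiplies the
  amplitude by L i v and shifts the phase by pi / 2, so the class reproduces itself.\<close>

lemma smooth_fun_trig_sum:
  fixes L :: "'i \<Rightarrow> 'a::real_normed_vector \<Rightarrow> real"
  assumes "\<And>i. bounded_linear (L i)"
  shows "smooth_fun (\<lambda>p. \<Sum>i\<in>I. a i * cos (L i p + b i))"
proof (coinduction arbitrary: a b rule: smooth_fun.coinduct)
  case smooth_fun
  let ?f = "\<lambda>p. \<Sum>i\<in>I. a i * cos (L i p + b i)"
  have D: "(?f has_derivative (\<lambda>v. \<Sum>i\<in>I. a i * (- sin (L i x + b i) * L i v))) (at x)" for x
    by (auto intro!: derivative_eq_intros bounded_linear.has_derivative[OF assms] simp: mult_ac)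
  have "frechet_derivative ?f (at x) v = (\<Sum>i\<in>I. (a i * L i v) * cos (L i x + (b i + pi / 2)))" for x v
  proof -
    have "cos (L i x + (b i + pi / 2)) = - sin (L i x + b i)" for i
      using cos_add[of "L i x + b i" "pi / 2"] by (simp add: add.assoc)
    then show ?thesis
      unfolding frechet_derivative_at[OF D, symmetric] by (simp add: mult_ac)
  qed
  moreover have "?f differentiable (at x)" for x using D differentiableI by blast
  ultimately show ?case
    by (intro exI[of _ ?f] conjI allI disjI1 exI[of _ "\<lambda>i. b i + pi / 2"] exI) (auto simp: fun_eq_iff)
qed

lemma kdot_rvec: "kdot k (rvec a) = of_int (fst k * fst a + snd k * snd a)"
  by (simp add: kdot_def rvec_def)

lemma kdot_add_right: "kdot k (x + y) = kdot k x + kdot k y"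
  by (simp add: kdot_def algebra_simps)

lemma cos_add_2pi_int: "cos (z + 2 * pi * of_int n) = cos z"
  by (simp add: cos_add sin_int_2pin cos_int_2pin)

lemma mode_periodic: "mode j k (p + (rvec a, rvec b)) = mode j k p"
proof -
  have eq: "2 * pi * (kdot (k + j) (fst (p + (rvec a, rvec b))) + kdot (- k) (snd (p + (rvec a, rvec b)))) + phase j
     = (2 * pi * (kdot (k + j) (fst p) + kdot (- k) (snd p)) + phase j)
       + 2 * pi * of_int (fst (k + j) * fst a + snd (k + j) * snd a + (fst (- k) * fst b + snd (- k) * snd b))"
    by (simp only: fst_add snd_add fst_conv snd_conv kdot_add_right kdot_rvec of_int_add) (simp add: algebra_simps)
  show ?thesis unfolding mode_def eq by (rule cos_add_2pi_int)
qed

lemma K_partial_uminus: "K_partial M (- x) = - K_partial M x"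
proof -
  have k: "2 * pi * kdot k (- x) = - (2 * pi * kdot k x)" for k by (simp add: kdot_def algebra_simps)
  show ?thesis
    unfolding K_partial_def sum_negf[symmetric] k sin_minus by (intro sum.cong refl) simp
qed

text \<open>Exchanging x and y flips the sign of the odd K and of the gradient difference.\<close>

lemma HM_symmetric: "HM M j x y = HM M j y x"
proof -
  have "K_partial M (y - x) = - K_partial M (x - y)"
    using K_partial_uminus[of M "x - y"] by simp
  then show ?thesis unfolding HM_def by (simp add: inner_diff_right algebra_simps)
qed

lemma admissible_HM: "admissible (HM M j)"
proof -
  define R where "R = square M \<union> (\<lambda>k. k - j) ` square M"
  define c where "c k = - (2 * sqrt 2 * pi\<^sup>2) * gam_trunc M j k" for k
  define L where "L k p = 2 * pi * (kdot (k + j) (fst p) + kdot (- k) (snd p))" for k and p :: "(real \<times> real) \<times> (real \<times> real)"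
  have eq: "HMf M j p = (\<Sum>k\<in>R. c k * mode j k p)" for p
    unfolding c_def R_def by (rule HMf_eq) auto
  have "bounded_linear (L k)" for k
    unfolding linear_conv_bounded_linear[symmetric]
    by (rule linearI) (simp_all add: L_def kdot_def algebra_simps)
  then have "smooth_fun (\<lambda>p. \<Sum>k\<in>R. c k * cos (L k p + phase j))"
    by (rule smooth_fun_trig_sum)
  then have sm: "smooth_fun (\<lambda>p. HM M j (fst p) (snd p))"
    unfolding HMf_def[symmetric] eq mode_def L_def .
  have per: "HM M j (fst x + of_int (fst a), snd x + of_int (snd a)) (fst y + of_int (fst b), snd y + of_int (snd b)) = HM M j x y"
    for x y a b
  proof -
    have "HMf M j ((x, y) + (rvec a, rvec b)) = HMf M j (x, y)"
      unfolding eq mode_periodic ..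
    then show ?thesis by (cases x; cases y) (simp add: HMf_def rvec_def)
  qed
  have "HM M j x x = 0" for x
    using HM_symmetric by (simp add: HM_def)
  then have "(\<integral>x \<in> T2. HM M j x x \<partial>lborel) = 0" by simp
  with sm per HM_symmetric show ?thesis unfolding admissible_def by blast
qed

lemma admissible_smooth_periodic:
  assumes "admissible h"
  shows "smooth_periodic (\<lambda>p. h (fst p) (snd p))"
  unfolding smooth_periodic_def
proof (intro conjI allI)
  show "smooth_fun (\<lambda>p. h (fst p) (snd p))" using assms by (simp add: admissible_def)
  fix p a b
  have "h (fst (fst p) + of_int (fst a), snd (fst p) + of_int (snd a)) (fst (snd p) + of_int (fst b), snd (snd p) + of_int (snd b)) = h (fst p) (snd p)"
    using assms unfolding admissible_def by blast
  moreover have "fst (p + (rvec a, rvec b)) = (fst (fst p) + of_int (fst a), snd (fst p) + of_int (snd a))"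
    "snd (p + (rvec a, rvec b)) = (fst (snd p) + of_int (fst b), snd (snd p) + of_int (snd b))"
    by (simp_all add: rvec_def prod_eq_iff)
  ultimately show "h (fst (p + (rvec a, rvec b))) (snd (p + (rvec a, rvec b))) = h (fst p) (snd p)" by simp
qed

lemma admissible_trace_zero:
  assumes "admissible h"
  shows "(\<integral>x. h x x \<partial>tau2) = 0"
proof -
  have "continuous_on UNIV (\<lambda>x. (\<lambda>p. h (fst p) (snd p)) (x, x))"
    by (rule continuous_on_compose2[OF smooth_periodic_continuous[OF admissible_smooth_periodic[OF assms]]])
       (auto intro!: continuous_intros)
  then have "(\<lambda>x. h x x) \<in> borel_measurable borel" by (intro borel_measurable_continuous_onI) simp
  then show ?thesis using assms by (simp add: integral_tau2 admissible_def)
qed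

lemma pair_quad_eq:
  assumes f: "f = (\<lambda>p. h (fst p) (snd p))" "f \<in> borel_measurable borel" "integrable tau4 (\<lambda>p. (f p)\<^sup>2)"
  shows "pair_quad N \<xi> h = wick_sum (Lambda N) (coef f) \<xi> + (\<Sum>k\<in>Lambda N. coef f (k, k))"
proof -
  note [measurable] = f(2)
  let ?g = "\<lambda>p. f p * omegaN N \<xi> (fst p) * omegaN N \<xi> (snd p)"
  have om: "?g p = (\<Sum>i\<in>Lambda N \<times> Lambda N. (\<xi> (fst i) * \<xi> (snd i)) * (f p * ebasis2 i p))" for p
  proof -
    have "omegaN N \<xi> (fst p) * omegaN N \<xi> (snd p)
        = (\<Sum>i\<in>Lambda N \<times> Lambda N. (\<xi> (fst i) * ebasis (fst i) (fst p)) * (\<xi> (snd i) * ebasis (snd i) (snd p)))"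
      unfolding omegaN_def sum_product sum.cartesian_product by (simp add: case_prod_beta')
    then have "?g p = f p * (\<Sum>i\<in>Lambda N \<times> Lambda N. (\<xi> (fst i) * ebasis (fst i) (fst p)) * (\<xi> (snd i) * ebasis (snd i) (snd p)))"
      by (simp only: mult.assoc)
    also have "\<dots> = (\<Sum>i\<in>Lambda N \<times> Lambda N. (\<xi> (fst i) * \<xi> (snd i)) * (f p * ebasis2 i p))"
      unfolding sum_distrib_left ebasis2_def by (intro sum.cong refl) (simp only: mult_ac)
    finally show ?thesis .
  qed
  have "?g \<in> borel_measurable borel" unfolding om by measurable
  then have "pair_quad N \<xi> h = (\<integral>p. ?g p \<partial>tau4)"
    unfolding pair_quad_def f(1) by (simp add: integral_tau4)
  also have "\<dots> = (\<Sum>i\<in>Lambda N \<times> Lambda N. (\<xi> (fst i) * \<xi> (snd i)) * coef f i)"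
    unfolding om coef_def using integrable_mult_ebasis2[OF f(2,3)]
    by (subst Bochner_Integration.integral_sum) auto
  also have "\<dots> = (\<Sum>i\<in>Lambda N \<times> Lambda N. coef f i * wick i \<xi>)
      + (\<Sum>i\<in>Lambda N \<times> Lambda N. if fst i = snd i then coef f i else 0)"
    unfolding sum.distrib[symmetric] by (intro sum.cong refl) (auto simp: wick_def algebra_simps)
  also have "(\<Sum>i\<in>Lambda N \<times> Lambda N. if fst i = snd i then coef f i else 0)
      = (\<Sum>k\<in>Lambda N. \<Sum>l\<in>Lambda N. if k = l then coef f (k, l) else 0)"
    unfolding sum.cartesian_product by (intro sum.cong) auto
  also have "\<dots> = (\<Sum>k\<in>Lambda N. coef f (k, k))" by (intro sum.cong refl) simp
  finally show ?thesis by (simp add: wick_sum_def)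
qed

lemma coef_swap:
  assumes "f \<in> borel_measurable borel" "\<And>x y. f (x, y) = f (y, x)"
  shows "coef f (k, l) = coef f (l, k)"
proof -
  note [measurable] = assms(1)
  have "(\<lambda>p. f p * ebasis2 (k, l) p) \<in> borel_measurable tau4" by measurable
  then have "(\<lambda>p. f p * ebasis2 (k, l) p) \<in> borel_measurable (tau2 \<Otimes>\<^sub>M tau2)"
    by (simp add: tau4_eq_pair)
  from tau22.integral_product_swap[OF this]
  have "coef f (k, l) = (\<integral>(x, y). f (y, x) * ebasis2 (k, l) (y, x) \<partial>(tau2 \<Otimes>\<^sub>M tau2))"
    unfolding coef_def tau4_eq_pair by simp
  also have "\<dots> = coef f (l, k)"
    unfolding coef_def tau4_eq_pair
    by (intro Bochner_Integration.integral_cong refl) (auto simp: ebasis2_def assms(2) mult_ac)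
  finally show ?thesis .
qed

text \<open>Integrating in y against e_l gives a function of x of size |l|^(-4) by smoothness, and
  Bessel in x sums its squared coefficients over all k at once.\<close>

lemma coef_row_bound:
  assumes f: "smooth_periodic f"
  obtains C where "0 \<le> C" "\<And>l F. \<lbrakk>l \<in> Z2_0; finite F; F \<subseteq> Z2_0\<rbrakk> \<Longrightarrow> (\<Sum>k\<in>F. (coef f (k, l))\<^sup>2) \<le> C / (knorm2 l) ^ 4"
proof -
  note fm[measurable] = smooth_periodic_measurable[OF f]
  obtain C where C: "0 \<le> C" "\<And>x k b. k \<in> Z2_0 \<Longrightarrow>
    \<bar>\<integral>y. f (x, y) * cos (2 * pi * kdot k y + b) \<partial>tau2\<bar> \<le> C / (knorm2 k)\<^sup>2"
    by (rule smooth_periodic_coef_decay[OF f]) (rule that; blast)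
  obtain F where F: "\<And>p. \<bar>f p\<bar> \<le> F" by (rule smooth_periodic_bounded[OF f]) (rule that; blast)
  have "(\<Sum>k\<in>E. (coef f (k, l))\<^sup>2) \<le> 2 * C\<^sup>2 / (knorm2 l) ^ 4" if l: "l \<in> Z2_0" and E: "finite E" "E \<subseteq> Z2_0" for l E
  proof -
    define g where "g x = (\<integral>y. f (x, y) * ebasis l y \<partial>tau2)" for x
    have g_le: "\<bar>g x\<bar> \<le> sqrt 2 * (C / (knorm2 l)\<^sup>2)" for x
    proof -
      have "g x = (\<integral>y. sqrt 2 * (f (x, y) * cos (2 * pi * kdot l y + phase l)) \<partial>tau2)"
        unfolding g_def ebasis_eq_cos by (simp add: mult_ac)
      then have "\<bar>g x\<bar> = sqrt 2 * \<bar>\<integral>y. f (x, y) * cos (2 * pi * kdot l y + phase l) \<partial>tau2\<bar>"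
        by (simp add: abs_mult)
      then show ?thesis using mult_left_mono[OF C(2)[OF l, of x "phase l"], of "sqrt 2"] by simp
    qed
    have F0: "0 \<le> F" using F[of 0] by linarith
    have int4: "integrable tau4 (\<lambda>p. f p * ebasis l (snd p))"
    proof (rule integrable_bounded[where C = "F * sqrt 2"])
      show "\<bar>f p * ebasis l (snd p)\<bar> \<le> F * sqrt 2" for p
        unfolding abs_mult using F abs_ebasis_le F0 by (intro mult_mono) auto
    qed (auto intro: tau4.finite_measure_axioms)
    have gint: "integrable tau2 g"
      using tau22.integrable_fst'[of "\<lambda>p. f p * ebasis l (snd p)"] int4 unfolding tau4_eq_pair g_def by simp
    then have gm[measurable]: "g \<in> borel_measurable tau2" by auto
    have g2: "integrable tau2 (\<lambda>x. (g x)\<^sup>2)"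
    proof (rule integrable_bounded[where C = "(sqrt 2 * (C / (knorm2 l)\<^sup>2))\<^sup>2"])
      show "\<bar>(g x)\<^sup>2\<bar> \<le> (sqrt 2 * (C / (knorm2 l)\<^sup>2))\<^sup>2" for x
        using power_mono[OF g_le[of x], of 2] by simp
    qed (auto intro: tau2.finite_measure_axioms)
    have coef_eq: "coef f (k, l) = (\<integral>x. g x * ebasis k x \<partial>tau2)" for k
    proof -
      have "coef f (k, l) = (\<integral>x. \<integral>y. f (x, y) * ebasis2 (k, l) (x, y) \<partial>tau2 \<partial>tau2)"
        unfolding coef_def
        by (rule integral_tau4_fubini) (intro integrable_mult_ebasis2 fm smooth_periodic_sq_integrable f)
      also have "\<dots> = (\<integral>x. g x * ebasis k x \<partial>tau2)"
      proof (rule Bochner_Integration.integral_cong[OF refl])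
        fix x
        have "(\<integral>y. f (x, y) * ebasis2 (k, l) (x, y) \<partial>tau2) = (\<integral>y. (f (x, y) * ebasis l y) * ebasis k x \<partial>tau2)"
          by (simp add: ebasis2_def mult_ac)
        then show "(\<integral>y. f (x, y) * ebasis2 (k, l) (x, y) \<partial>tau2) = g x * ebasis k x"
          by (simp add: g_def)
      qed
      finally show ?thesis .
    qed
    have "(\<Sum>k\<in>E. (coef f (k, l))\<^sup>2) \<le> 1 * (\<integral>x. (g x)\<^sup>2 \<partial>tau2)"
      unfolding coef_eq
    proof (rule Bessel_inequality[OF E(1)])
      show "integrable tau2 (\<lambda>x. (ebasis k x)\<^sup>2)" for k
        using integrable_ebasis_mult[of k k] by (simp add: power2_eq_square)
      show "(\<integral>x. ebasis k x * ebasis k' x \<partial>tau2) = (if k = k' then 1 else 0)" if "k \<in> E" "k' \<in> E" for k k'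
        using that E by (intro integral_ebasis_mult) auto
    qed (use g2 gm in auto)
    also have "\<dots> \<le> (sqrt 2 * (C / (knorm2 l)\<^sup>2))\<^sup>2"
    proof -
      have "\<bar>\<integral>x. (g x)\<^sup>2 \<partial>tau2\<bar> \<le> (sqrt 2 * (C / (knorm2 l)\<^sup>2))\<^sup>2"
      proof (rule tau2.abs_expectation_le)
        show "\<bar>(g x)\<^sup>2\<bar> \<le> (sqrt 2 * (C / (knorm2 l)\<^sup>2))\<^sup>2" for x
          using power_mono[OF g_le[of x], of 2] by simp
      qed
      then show ?thesis by simp
    qed
    also have "\<dots> = 2 * C\<^sup>2 / (knorm2 l) ^ 4"
      by (simp add: power_mult_distrib power_divide)
    finally show ?thesis .
  qed
  then show ?thesis by (intro that[of "2 * C\<^sup>2"]) auto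
qed

text \<open>The inequality |d| <= 1 / r + r d^2 with r = (1 + n)^2 trades the fourth order decay of
  the squares for first moments of order (1 + n)^(-2). The increments are therefore almost surely
  absolutely summable.\<close>

lemma AE_convergent_increments:
  fixes Y :: "nat \<Rightarrow> 'a \<Rightarrow> real"
  assumes P: "prob_space M" and meas[measurable]: "\<And>n. Y n \<in> borel_measurable M" and C: "0 \<le> C"
    and le: "\<And>n. (\<integral>\<^sup>+ x. ennreal ((Y (Suc n) x - Y n x)\<^sup>2) \<partial>M) \<le> ennreal (C / (1 + real n) ^ 4)"
  shows "AE x in M. convergent (\<lambda>n. Y n x)"
proof -
  interpret prob_space M by fact
  have absle: "\<bar>d\<bar> \<le> 1 / r + r * d\<^sup>2" if r: "0 < r" for d r :: real
  proof -
    have "2 * 1 * (r * \<bar>d\<bar>) \<le> 1\<^sup>2 + (r * \<bar>d\<bar>)\<^sup>2" by (rule sum_squares_bound)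
    moreover have "(r * \<bar>d\<bar>)\<^sup>2 = r * (r * d\<^sup>2)" by (simp add: power2_eq_square algebra_simps)
    moreover have "0 \<le> r * \<bar>d\<bar>" using r by simp
    ultimately have "r * \<bar>d\<bar> \<le> 1 + r * (r * d\<^sup>2)" by simp
    also have "\<dots> = r * (1 / r + r * d\<^sup>2)" using r by (simp add: distrib_left)
    finally show ?thesis using r by (simp only: mult_le_cancel_left_pos)
  qed
  have bound: "(\<integral>\<^sup>+ x. ennreal \<bar>Y (Suc n) x - Y n x\<bar> \<partial>M) \<le> ennreal ((1 + C) / (1 + real n)\<^sup>2)" for n
  proof -
    have "(\<integral>\<^sup>+ x. ennreal \<bar>Y (Suc n) x - Y n x\<bar> \<partial>M)
      \<le> (\<integral>\<^sup>+ x. ennreal (1 / (1 + real n)\<^sup>2) + ennreal ((1 + real n)\<^sup>2) * ennreal ((Y (Suc n) x - Y n x)\<^sup>2) \<partial>M)"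
      using absle[of "(1 + real n)\<^sup>2"] by (intro nn_integral_mono) (simp add: ennreal_mult[symmetric] ennreal_plus[symmetric] ennreal_leI del: ennreal_plus)
    also have "\<dots> = ennreal (1 / (1 + real n)\<^sup>2) + ennreal ((1 + real n)\<^sup>2) * (\<integral>\<^sup>+ x. ennreal ((Y (Suc n) x - Y n x)\<^sup>2) \<partial>M)"
      by (subst nn_integral_add) (auto simp: nn_integral_cmult emeasure_space_1)
    also have "\<dots> \<le> ennreal (1 / (1 + real n)\<^sup>2) + ennreal ((1 + real n)\<^sup>2) * ennreal (C / (1 + real n) ^ 4)"
      by (intro add_left_mono mult_left_mono le) simp
    also have "\<dots> = ennreal (1 / (1 + real n)\<^sup>2 + (1 + real n)\<^sup>2 * (C / (1 + real n) ^ 4))"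
      using C by (simp add: ennreal_mult[symmetric] ennreal_plus[symmetric] del: ennreal_plus)
    also have "1 / (1 + real n)\<^sup>2 + (1 + real n)\<^sup>2 * (C / (1 + real n) ^ 4) = (1 + C) / (1 + real n)\<^sup>2"
    proof -
      have "1 / r\<^sup>2 + r\<^sup>2 * (C / r ^ 4) = (1 + C) / r\<^sup>2" if "0 < r" for r :: real
        using that by (simp add: field_simps eval_nat_numeral)
      then show ?thesis by simp
    qed
    finally show ?thesis .
  qed
  have "summable (\<lambda>n. 1 / real n ^ 2)" using inverse_power_summable[of 2, where 'a = real] by (simp add: divide_inverse)
  then have "summable (\<lambda>n. 1 / real (n + 1) ^ 2)" by (rule summable_ignore_initial_segment)
  then have "summable (\<lambda>n. (1 + C) * (1 / real (n + 1) ^ 2))" by (rule summable_mult)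
  then have sm: "summable (\<lambda>n. (1 + C) / (1 + real n)\<^sup>2)" by (simp add: add.commute)
  have "(\<integral>\<^sup>+ x. (\<Sum>n. ennreal \<bar>Y (Suc n) x - Y n x\<bar>) \<partial>M) = (\<Sum>n. \<integral>\<^sup>+ x. ennreal \<bar>Y (Suc n) x - Y n x\<bar> \<partial>M)"
    by (rule nn_integral_suminf) measurable
  also have "\<dots> \<le> (\<Sum>n. ennreal ((1 + C) / (1 + real n)\<^sup>2))"
    by (intro suminf_le bound) auto
  also have "\<dots> = ennreal (\<Sum>n. (1 + C) / (1 + real n)\<^sup>2)"
    using C by (intro suminf_ennreal2 sm) auto
  also have "\<dots> < \<infinity>" by simp
  finally have "AE x in M. (\<Sum>n. ennreal \<bar>Y (Suc n) x - Y n x\<bar>) \<noteq> \<infinity>"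
    by (intro nn_integral_PInf_AE) auto
  then show ?thesis
  proof eventually_elim
    case (elim x)
    then have "summable (\<lambda>n. \<bar>Y (Suc n) x - Y n x\<bar>)"
      by (intro summable_suminf_not_top) auto
    then have "summable (\<lambda>n. Y (Suc n) x - Y n x)" by (rule summable_rabs_cancel)
    then have "convergent (\<lambda>n. \<Sum>i<n. Y (Suc i) x - Y i x)" by (simp add: summable_iff_convergent)
    then have "convergent (\<lambda>n. Y n x - Y 0 x)"
      by (simp only: sum_lessThan_telescope[of "\<lambda>n. Y n x"])
    then obtain l where "(\<lambda>n. Y n x - Y 0 x) \<longlonglongrightarrow> l" by (auto simp: convergent_def)
    from tendsto_add[OF this tendsto_const[of "Y 0 x"]] show ?case by (auto simp: convergent_def)
  qed
qed

text \<open>Mean square convergence would give almost sure convergence only along a subsequence; the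
  decay of the coefficients of a smooth kernel gives it for the whole sequence.\<close>

lemma admissible_AE_tendsto:
  assumes h: "admissible h"
  shows "AE \<xi> in mu. (\<lambda>M. pair_quad M \<xi> h) \<longlonglongrightarrow> pair_smooth \<xi> h"
proof -
  define f where "f = (\<lambda>p. h (fst p) (snd p))"
  have f: "smooth_periodic f" unfolding f_def by (rule admissible_smooth_periodic[OF h])
  note fm = smooth_periodic_measurable[OF f]
  note f2 = smooth_periodic_sq_integrable[OF f]
  have sym: "coef f (k, l) = coef f (l, k)" for k l
    using h by (intro coef_swap fm) (auto simp: f_def admissible_def)
  have tr: "(\<lambda>m. \<Sum>k\<in>Lambda m. coef f (k, k)) \<longlonglongrightarrow> - (\<integral>p. f p \<partial>tau4)"
    using admissible_trace_zero[OF h] by (intro trace_limit f) (simp add: f_def)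
  obtain C where C: "0 \<le> C" "\<And>l F. \<lbrakk>l \<in> Z2_0; finite F; F \<subseteq> Z2_0\<rbrakk> \<Longrightarrow> (\<Sum>k\<in>F. (coef f (k, l))\<^sup>2) \<le> C / (knorm2 l) ^ 4"
    by (rule coef_row_bound[OF f]) (rule that; blast)
  define S where "S = (\<Sum>\<^sub>\<infinity>k\<in>Z2_0. 1 / (knorm2 k)\<^sup>2)"
  have S0: "0 \<le> S" unfolding S_def by (intro infsum_nonneg) auto
  \<comment> \<open>Shifted by one because the tail bound divides by m^4 and needs m > 0.\<close>
  define Y where "Y n = wick_sum (Lambda (Suc n)) (coef f)" for n
  \<comment> \<open>Outside Lambda m x Lambda m one index has length above m; by symmetry both cases
    cost the same, hence the 2. Of the fourth power of \<open>knorm2 l\<close> two factors yield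
    m^(-4) and two keep the sum over l convergent.\<close>
  have tail: "(\<Sum>i\<in>Lambda R \<times> Lambda R. (coef f i)\<^sup>2) - (\<Sum>i\<in>Lambda m \<times> Lambda m. (coef f i)\<^sup>2) \<le> 2 * C * S / real m ^ 4"
    if m: "0 < m" "m \<le> R" for m R
  proof -
    let ?D = "Lambda R - Lambda m"
    have sub: "Lambda m \<subseteq> Lambda R" by (rule Lambda_mono[OF m(2)])
    have row: "(\<Sum>l\<in>?D. \<Sum>k\<in>Lambda R. (coef f (k, l))\<^sup>2) \<le> C * S / real m ^ 4"
    proof -
      have "(\<Sum>l\<in>?D. \<Sum>k\<in>Lambda R. (coef f (k, l))\<^sup>2) \<le> (\<Sum>l\<in>?D. C / real m ^ 4 * (1 / (knorm2 l)\<^sup>2))"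
      proof (rule sum_mono)
        fix l assume l: "l \<in> ?D"
        then have lz: "l \<in> Z2_0" using Lambda_subset by blast
        have "real m ^ 2 \<le> knorm2 l" using l lz by (auto simp: Lambda_def)
        then have "(real m ^ 2)\<^sup>2 * (knorm2 l)\<^sup>2 \<le> (knorm2 l)\<^sup>2 * (knorm2 l)\<^sup>2"
          by (intro mult_right_mono power_mono) auto
        then have *: "real m ^ 4 * (knorm2 l)\<^sup>2 \<le> knorm2 l ^ 4"
          by (simp add: power_add[symmetric])
        have "(\<Sum>k\<in>Lambda R. (coef f (k, l))\<^sup>2) \<le> C / (knorm2 l) ^ 4"
          using Lambda_subset by (intro C(2) lz) auto
        also have "\<dots> \<le> C / (real m ^ 4 * (knorm2 l)\<^sup>2)"
          using C(1) * m knorm2_ge_1[OF lz] by (intro divide_left_mono mult_pos_pos) auto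
        finally show "(\<Sum>k\<in>Lambda R. (coef f (k, l))\<^sup>2) \<le> C / real m ^ 4 * (1 / (knorm2 l)\<^sup>2)" by simp
      qed
      also have "\<dots> = C / real m ^ 4 * (\<Sum>l\<in>?D. 1 / (knorm2 l)\<^sup>2)" by (simp add: sum_distrib_left)
      also have "\<dots> \<le> C / real m ^ 4 * S"
        unfolding S_def using C(1) Lambda_subset[of R]
        by (intro mult_left_mono finite_sum_le_infsum summable_on_inverse_knorm2_sq) auto
      finally show ?thesis by simp
    qed
    have "(\<Sum>i\<in>Lambda R \<times> Lambda R. (coef f i)\<^sup>2) - (\<Sum>i\<in>Lambda m \<times> Lambda m. (coef f i)\<^sup>2)
        = (\<Sum>i\<in>Lambda R \<times> Lambda R - Lambda m \<times> Lambda m. (coef f i)\<^sup>2)"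
      using sub by (intro sum_diff[symmetric]) auto
    also have "\<dots> \<le> (\<Sum>i\<in>(Lambda R \<times> ?D) \<union> (?D \<times> Lambda R). (coef f i)\<^sup>2)"
      using sub by (intro sum_mono2) auto
    also have "\<dots> \<le> (\<Sum>i\<in>Lambda R \<times> ?D. (coef f i)\<^sup>2) + (\<Sum>i\<in>?D \<times> Lambda R. (coef f i)\<^sup>2)"
      by (subst sum.union_inter[symmetric]) (auto intro!: sum_nonneg)
    also have "(\<Sum>i\<in>Lambda R \<times> ?D. (coef f i)\<^sup>2) = (\<Sum>l\<in>?D. \<Sum>k\<in>Lambda R. (coef f (k, l))\<^sup>2)"
      by (subst sum.swap) (simp add: sum.cartesian_product)
    also have "(\<Sum>i\<in>?D \<times> Lambda R. (coef f i)\<^sup>2) = (\<Sum>l\<in>?D. \<Sum>k\<in>Lambda R. (coef f (k, l))\<^sup>2)"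
      using sym by (simp add: sum.cartesian_product)
    finally show ?thesis using row by simp
  qed
  have "AE \<xi> in mu. convergent (\<lambda>n. Y n \<xi>)"
  proof (rule AE_convergent_increments[OF mu.prob_space_axioms])
    show "Y n \<in> borel_measurable mu" for n
      unfolding Y_def by (rule borel_measurable_wick_sum_mu[OF Lambda_subset])
    show "0 \<le> 4 * C * S" using C(1) S0 by simp
    show "(\<integral>\<^sup>+ \<xi>. ennreal ((Y (Suc n) \<xi> - Y n \<xi>)\<^sup>2) \<partial>mu) \<le> ennreal (4 * C * S / (1 + real n) ^ 4)" for n
    proof -
      have "(\<integral>\<^sup>+ \<xi>. ennreal ((Y (Suc n) \<xi> - Y n \<xi>)\<^sup>2) \<partial>mu)
        \<le> ennreal (2 * ((\<Sum>i\<in>Lambda (Suc (Suc n)) \<times> Lambda (Suc (Suc n)). (coef f i)\<^sup>2)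
            - (\<Sum>i\<in>Lambda (Suc n) \<times> Lambda (Suc n). (coef f i)\<^sup>2)))"
        unfolding Y_def by (intro nn_integral_wick_sum_diff Lambda_subset Lambda_mono) auto
      also have "\<dots> \<le> ennreal (4 * C * S / (1 + real n) ^ 4)"
        using tail[of "Suc n" "Suc (Suc n)"] by (intro ennreal_leI) (simp add: add.commute)
      finally show ?thesis .
    qed
  qed
  then show ?thesis
  proof eventually_elim
    case (elim \<xi>)
    then obtain l where "(\<lambda>n. wick_sum (Lambda (Suc n)) (coef f) \<xi>) \<longlonglongrightarrow> l"
      by (auto simp: Y_def convergent_def)
    then have "(\<lambda>n. wick_sum (Lambda n) (coef f) \<xi>) \<longlonglongrightarrow> l" by (rule LIMSEQ_imp_Suc)
    from tendsto_add[OF this tr] have "convergent (\<lambda>M. pair_quad M \<xi> h)"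
      unfolding pair_quad_eq[OF f_def fm f2] by (auto simp: convergent_def)
    then show ?case by (simp add: pair_smooth_def convergent_LIMSEQ_iff)
  qed
qed

section \<open>The nonlinear term\<close>

lemma borel_measurable_pair_smooth:
  assumes f: "f = (\<lambda>p. h (fst p) (snd p))" "f \<in> borel_measurable borel" "integrable tau4 (\<lambda>p. (f p)\<^sup>2)"
  shows "(\<lambda>\<xi>. pair_smooth \<xi> h) \<in> borel_measurable mu"
proof -
  have [measurable]: "(\<lambda>\<xi>. pair_quad M \<xi> h) \<in> borel_measurable mu" for M
    unfolding pair_quad_eq[OF f]
    by (intro borel_measurable_add borel_measurable_const borel_measurable_wick_sum_mu[OF Lambda_subset])
  have "{\<xi> \<in> space mu. convergent (\<lambda>M. pair_quad M \<xi> h)} \<in> sets mu"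
    unfolding Cauchy_convergent_iff[symmetric] by (rule sets_Collect_Cauchy) measurable
  then have [measurable]: "Measurable.pred mu (\<lambda>\<xi>. convergent (\<lambda>M. pair_quad M \<xi> h))"
    by (simp add: pred_def)
  have [measurable]: "(\<lambda>\<xi>. lim (\<lambda>M. pair_quad M \<xi> h)) \<in> borel_measurable mu"
    by (rule borel_measurable_lim_metric) measurable
  show ?thesis unfolding pair_smooth_def by measurable
qed

text \<open>\<open>e n\<close> is twice the tail of the sum of squared coefficients. It tends to 0
  for each j and stays below twice the energy of the kernel: the two inputs of dominated convergence
  over j.\<close>

lemma Hf_chaos_limit:
  assumes j: "j \<in> Z2_0"
  shows "\<exists>X e. X \<in> borel_measurable mu \<and> e \<longlonglongrightarrow> 0 \<and>
    (\<forall>n. 0 \<le> e n) \<and> (\<forall>n. e n \<le> 2 * (\<integral>p. (Hf j p)\<^sup>2 \<partial>tau4)) \<and>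
    (\<forall>n. (\<integral>\<^sup>+ \<xi>. ennreal ((wick_sum (Lambda n) (coef (Hf j)) \<xi> - X \<xi>)\<^sup>2) \<partial>mu) \<le> ennreal (e n))"
proof -
  define S where "S n = (\<Sum>i\<in>Lambda n \<times> Lambda n. (coef (Hf j) i)\<^sup>2)" for n
  have inc: "incseq S"
    unfolding incseq_def S_def using Lambda_mono by (auto intro!: sum_mono2)
  have bd: "S n \<le> (\<integral>p. (Hf j p)\<^sup>2 \<partial>tau4)" for n
    unfolding S_def using Hf_L2(3)[OF j] Lambda_subset by (intro sum_coef_sq_le) auto
  obtain l where l: "S \<longlonglongrightarrow> l" "\<And>n. S n \<le> l"
    using incseq_convergent[OF inc, of "\<integral>p. (Hf j p)\<^sup>2 \<partial>tau4"] bd by blast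
  have l_le: "l \<le> (\<integral>p. (Hf j p)\<^sup>2 \<partial>tau4)" using LIMSEQ_le_const2[OF l(1)] bd by blast
  have S0: "0 \<le> S n" for n by (simp add: S_def sum_nonneg)
  define e where "e n = 2 * (l - S n)" for n
  have e0: "e \<longlonglongrightarrow> 0"
  proof -
    have "(\<lambda>n. 2 * (l - S n)) \<longlonglongrightarrow> 2 * (l - l)" by (intro tendsto_intros l(1))
    then show ?thesis by (simp add: e_def[abs_def])
  qed
  have cauchy: "(\<integral>\<^sup>+ \<xi>. ennreal ((wick_sum (Lambda m) (coef (Hf j)) \<xi> - wick_sum (Lambda n) (coef (Hf j)) \<xi>)\<^sup>2) \<partial>mu)
      \<le> ennreal (e n)" if "n \<le> m" for n m
  proof -
    have "(\<integral>\<^sup>+ \<xi>. ennreal ((wick_sum (Lambda m) (coef (Hf j)) \<xi> - wick_sum (Lambda n) (coef (Hf j)) \<xi>)\<^sup>2) \<partial>mu)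
      \<le> ennreal (2 * (S m - S n))"
      unfolding S_def by (intro nn_integral_wick_sum_diff Lambda_mono that Lambda_subset) simp
    also have "\<dots> \<le> ennreal (e n)" using l(2)[of m] by (intro ennreal_leI) (simp add: e_def)
    finally show ?thesis .
  qed
  have "\<exists>X. X \<in> borel_measurable mu \<and>
    (\<forall>n. (\<integral>\<^sup>+ \<xi>. ennreal ((wick_sum (Lambda n) (coef (Hf j)) \<xi> - X \<xi>)\<^sup>2) \<partial>mu) \<le> ennreal (e n))"
  proof (rule mu.L2_complete[where Y = "\<lambda>n. wick_sum (Lambda n) (coef (Hf j))" and e = e])
    show "wick_sum (Lambda n) (coef (Hf j)) \<in> borel_measurable mu" for n
      by (rule borel_measurable_wick_sum_mu[OF Lambda_subset])
    show "(\<integral>\<^sup>+ \<xi>. ennreal ((wick_sum (Lambda m) (coef (Hf j)) \<xi> - wick_sum (Lambda n) (coef (Hf j)) \<xi>)\<^sup>2) \<partial>mu)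
      \<le> ennreal (e n)" if "n \<le> m" for n m by (rule cauchy[OF that])
  qed (use e0 in blast)+
  moreover have "0 \<le> e n" for n using l(2)[of n] by (simp add: e_def)
  moreover have "e n \<le> 2 * (\<integral>p. (Hf j p)\<^sup>2 \<partial>tau4)" for n using l_le S0[of n] by (simp add: e_def)
  ultimately show ?thesis using e0 by blast
qed

text \<open>The pairing minus X splits into the Wick sum of h - H, the chaos error and the trace.
  With D the squared distance of h and H, the first contributes 4 D and the second vanishes in the
  limit. The trace contributes 4 times the squared mean of h, again at most 4 D since H has mean
  zero.\<close>

lemma nn_integral_pair_smooth_diff:
  assumes j: "j \<in> Z2_0" and X: "X \<in> borel_measurable mu" and e: "e \<longlonglongrightarrow> 0" "\<And>n. 0 \<le> e n"
    and Xe: "\<And>n. (\<integral>\<^sup>+ \<xi>. ennreal ((wick_sum (Lambda n) (coef (Hf j)) \<xi> - X \<xi>)\<^sup>2) \<partial>mu) \<le> ennreal (e n)"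
    and h: "admissible h"
  shows "(\<integral>\<^sup>+ \<xi>. ennreal ((pair_smooth \<xi> h - X \<xi>)\<^sup>2) \<partial>mu)
     \<le> ennreal (8 * (\<integral>p. (h (fst p) (snd p) - Hf j p)\<^sup>2 \<partial>tau4))"
proof -
  note [measurable] = X
  define f where "f = (\<lambda>p. h (fst p) (snd p))"
  have f: "smooth_periodic f" unfolding f_def by (rule admissible_smooth_periodic[OF h])
  note fm[measurable] = smooth_periodic_measurable[OF f]
  note f2 = smooth_periodic_sq_integrable[OF f]
  note H2 = Hf_L2(3)[OF j]
  define D where "D = (\<integral>p. (f p - Hf j p)\<^sup>2 \<partial>tau4)"
  have D0: "0 \<le> D" by (simp add: D_def)
  have d2: "integrable tau4 (\<lambda>p. (f p - Hf j p)\<^sup>2)"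
    using f2 H2 by (intro integrable_sq_linear) auto
  define t where "t m = (\<Sum>k\<in>Lambda m. coef f (k, k))" for m
  have t: "t \<longlonglongrightarrow> - (\<integral>p. f p \<partial>tau4)"
    unfolding t_def using admissible_trace_zero[OF h] by (intro trace_limit f) (simp add: f_def)
  have mean: "(\<integral>p. f p \<partial>tau4)\<^sup>2 \<le> D"
  proof -
    have "(\<integral>p. f p - Hf j p \<partial>tau4) = (\<integral>p. f p \<partial>tau4)"
      using integral_sq_le(2)[OF _ f2] integral_sq_le(2)[OF _ H2] Hf_mean[OF j] by simp
    then show ?thesis using integral_sq_le(1)[OF _ d2] by (simp add: D_def)
  qed
  let ?A = "\<lambda>m. wick_sum (Lambda m) (coef (\<lambda>p. f p - Hf j p))"
  let ?B = "\<lambda>m \<xi>. wick_sum (Lambda m) (coef (Hf j)) \<xi> - X \<xi>"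
  have W[measurable]: "wick_sum (Lambda m) c \<in> borel_measurable mu" for m c
    by (rule borel_measurable_wick_sum_mu[OF Lambda_subset])
  have split: "pair_quad m \<xi> h - X \<xi> = ?A m \<xi> + (?B m \<xi> + t m)" for m \<xi>
    unfolding pair_quad_eq[OF f_def fm f2] t_def
    by (simp add: wick_sum_def coef_diff[OF fm f2 borel_measurable_Hf H2] left_diff_distrib sum_subtractf)
  have "(\<integral>\<^sup>+ \<xi>. ennreal ((pair_smooth \<xi> h - X \<xi>)\<^sup>2) \<partial>mu) \<le> ennreal (4 * D + 4 * (\<integral>p. f p \<partial>tau4)\<^sup>2)"
  proof (rule Fatou_sq)
    show "(\<lambda>\<xi>. pair_quad m \<xi> h - X \<xi>) \<in> borel_measurable mu" for m
      unfolding split by measurable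
    show "AE \<xi> in mu. (\<lambda>m. pair_quad m \<xi> h - X \<xi>) \<longlonglongrightarrow> pair_smooth \<xi> h - X \<xi>"
      using admissible_AE_tendsto[OF h] by eventually_elim (intro tendsto_intros)
    show "(\<integral>\<^sup>+ \<xi>. ennreal ((pair_quad m \<xi> h - X \<xi>)\<^sup>2) \<partial>mu) \<le> ennreal (4 * D + 4 * e m + 4 * (t m)\<^sup>2)" for m
    proof -
      have A: "(\<integral>\<^sup>+ \<xi>. ennreal ((?A m \<xi>)\<^sup>2) \<partial>mu) \<le> ennreal (2 * D)"
      proof (rule order_trans[OF nn_integral_wick_sum ennreal_leI])
        have "(\<Sum>i\<in>Lambda m \<times> Lambda m. (coef (\<lambda>p. f p - Hf j p) i)\<^sup>2) \<le> D"
          unfolding D_def using d2 Lambda_subset by (intro sum_coef_sq_le) auto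
        then show "2 * (\<Sum>i\<in>Lambda m \<times> Lambda m. (coef (\<lambda>p. f p - Hf j p) i)\<^sup>2) \<le> 2 * D" by simp
      qed (auto dest: subsetD[OF Lambda_subset])
      have B: "(\<integral>\<^sup>+ \<xi>. ennreal ((?B m \<xi> + t m)\<^sup>2) \<partial>mu) \<le> 2 * ennreal (e m) + 2 * ennreal ((t m)\<^sup>2)"
      proof -
        have "(\<integral>\<^sup>+ \<xi>. ennreal ((?B m \<xi> + t m)\<^sup>2) \<partial>mu)
          \<le> 2 * (\<integral>\<^sup>+ \<xi>. ennreal ((?B m \<xi>)\<^sup>2) \<partial>mu) + 2 * (\<integral>\<^sup>+ \<xi>. ennreal ((t m)\<^sup>2) \<partial>mu)"
          by (rule nn_integral_sq_add_le) measurable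
        also have "(\<integral>\<^sup>+ \<xi>. ennreal ((t m)\<^sup>2) \<partial>mu) = ennreal ((t m)\<^sup>2)"
          by (simp add: mu.emeasure_space_1)
        also have "2 * (\<integral>\<^sup>+ \<xi>. ennreal ((?B m \<xi>)\<^sup>2) \<partial>mu) + 2 * ennreal ((t m)\<^sup>2) \<le> 2 * ennreal (e m) + 2 * ennreal ((t m)\<^sup>2)"
          by (intro add_right_mono mult_left_mono Xe) simp
        finally show ?thesis .
      qed
      have "(\<integral>\<^sup>+ \<xi>. ennreal ((pair_quad m \<xi> h - X \<xi>)\<^sup>2) \<partial>mu)
          \<le> 2 * (\<integral>\<^sup>+ \<xi>. ennreal ((?A m \<xi>)\<^sup>2) \<partial>mu) + 2 * (\<integral>\<^sup>+ \<xi>. ennreal ((?B m \<xi> + t m)\<^sup>2) \<partial>mu)"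
        unfolding split by (rule nn_integral_sq_add_le) measurable
      also have "\<dots> \<le> 2 * ennreal (2 * D) + 2 * (2 * ennreal (e m) + 2 * ennreal ((t m)\<^sup>2))"
        by (intro add_mono mult_left_mono A B) auto
      also have "\<dots> = ennreal (2 * (2 * D) + 2 * (2 * e m + 2 * (t m)\<^sup>2))"
        using D0 e(2)[of m] by (simp add: ennreal_plus ennreal_mult)
      also have "2 * (2 * D) + 2 * (2 * e m + 2 * (t m)\<^sup>2) = 4 * D + 4 * e m + 4 * (t m)\<^sup>2" by simp
      finally show ?thesis .
    qed
    have "(\<lambda>m. 4 * D + 4 * e m + 4 * (t m)\<^sup>2) \<longlonglongrightarrow> 4 * D + 4 * 0 + 4 * (- (\<integral>p. f p \<partial>tau4))\<^sup>2"
      by (intro tendsto_add tendsto_mult tendsto_const tendsto_power e t)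
    then show "(\<lambda>m. ennreal (4 * D + 4 * e m + 4 * (t m)\<^sup>2)) \<longlonglongrightarrow> ennreal (4 * D + 4 * (\<integral>p. f p \<partial>tau4)\<^sup>2)"
      by (intro tendsto_ennrealI) simp
  qed
  also have "\<dots> \<le> ennreal (8 * D)" using mean by (intro ennreal_leI) simp
  finally show ?thesis by (simp add: D_def f_def)
qed

lemma is_pair_H_chaos_limit:
  assumes j: "j \<in> Z2_0" and X: "X \<in> borel_measurable mu" and e: "e \<longlonglongrightarrow> 0" "\<And>n. 0 \<le> e n"
    and Xe: "\<And>n. (\<integral>\<^sup>+ \<xi>. ennreal ((wick_sum (Lambda n) (coef (Hf j)) \<xi> - X \<xi>)\<^sup>2) \<partial>mu) \<le> ennreal (e n)"
  shows "is_pair_H (Hphi (ebasis j)) X"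
  unfolding is_pair_H_def
proof (intro conjI allI impI)
  show "X \<in> borel_measurable mu" by (rule X)
  fix hs assume hs: "(\<forall>n. admissible (hs n)) \<and> L2_conv_T4 hs (Hphi (ebasis j))"
  define D where "D n = (\<integral>\<^sup>+ p. ennreal ((hs n (fst p) (snd p) - Hf j p)\<^sup>2) \<partial>tau4)" for n
  have sp: "smooth_periodic (\<lambda>p. hs n (fst p) (snd p))" for n
    using hs by (intro admissible_smooth_periodic) simp
  have D: "D n = ennreal (\<integral>p. (hs n (fst p) (snd p) - Hf j p)\<^sup>2 \<partial>tau4)" for n
    unfolding D_def
    using smooth_periodic_sq_integrable[OF sp[of n]] Hf_L2(3)[OF j] smooth_periodic_measurable[OF sp[of n]]
    by (intro nn_integral_eq_integral integrable_sq_linear) auto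
  have "D n = (\<integral>\<^sup>+ p \<in> T2 \<times> T2. ennreal ((hs n (fst p) (snd p) - Hphi (ebasis j) (fst p) (snd p))\<^sup>2) \<partial>lborel)" for n
    unfolding D_def using smooth_periodic_measurable[OF sp[of n]] by (subst nn_integral_tau4) (auto simp: Hf_def[symmetric])
  then have "D \<longlonglongrightarrow> 0" using hs unfolding L2_conv_T4_def by (simp add: D_def[abs_def])
  then have "(\<lambda>n. 8 * D n) \<longlonglongrightarrow> 8 * 0" by (intro tendsto_intros) auto
  then have lim: "(\<lambda>n. 8 * D n) \<longlonglongrightarrow> 0" by simp
  show "(\<lambda>n. \<integral>\<^sup>+ \<xi>. ennreal ((pair_smooth \<xi> (hs n) - X \<xi>)\<^sup>2) \<partial>mu) \<longlonglongrightarrow> 0"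
  proof (rule tendsto_sandwich[OF _ _ tendsto_const lim])
    show "\<forall>\<^sub>F n in sequentially. (\<integral>\<^sup>+ \<xi>. ennreal ((pair_smooth \<xi> (hs n) - X \<xi>)\<^sup>2) \<partial>mu) \<le> 8 * D n"
      using nn_integral_pair_smooth_diff[OF j X e Xe] hs by (intro always_eventually allI) (simp add: D ennreal_mult)
  qed simp
qed

text \<open>Both candidates are mean square limits along the truncations \<open>HM\<close>, which
  are admissible and converge to the kernel. Without such a sequence the condition in
  \<open>is_pair_H\<close> would hold vacuously and determine nothing.\<close>

lemma chaos_limit_unique:
  assumes j: "j \<in> Z2_0" and Y: "is_pair_H (Hphi (ebasis j)) Y" and X: "is_pair_H (Hphi (ebasis j)) X"
  shows "AE \<xi> in mu. X \<xi> = Y \<xi>"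
proof -
  have m[measurable]: "X \<in> borel_measurable mu" "Y \<in> borel_measurable mu"
    using X Y by (auto simp: is_pair_H_def)
  have intM: "integrable tau4 (\<lambda>p. (HMf M j p)\<^sup>2)" for M
    by (rule integral_HMf_sq(2)[OF j, of "square M \<union> (\<lambda>k. k - j) ` square M"]) auto
  have P[measurable]: "(\<lambda>\<xi>. pair_smooth \<xi> (HM M j)) \<in> borel_measurable mu" for M
    by (rule borel_measurable_pair_smooth[OF _ borel_measurable_HMf intM]) (simp add: HMf_def[abs_def])
  have conv: "L2_conv_T4 (\<lambda>M. HM M j) (Hphi (ebasis j))"
  proof -
    have "(\<integral>\<^sup>+ p \<in> T2 \<times> T2. ennreal ((HM M j (fst p) (snd p) - Hphi (ebasis j) (fst p) (snd p))\<^sup>2) \<partial>lborel)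
        = ennreal (\<integral>p. (HMf M j p - Hf j p)\<^sup>2 \<partial>tau4)" for M
    proof -
      have "(\<integral>\<^sup>+ p \<in> T2 \<times> T2. ennreal ((HMf M j p - Hf j p)\<^sup>2) \<partial>lborel) = (\<integral>\<^sup>+ p. ennreal ((HMf M j p - Hf j p)\<^sup>2) \<partial>tau4)"
        by (subst nn_integral_tau4) auto
      also have "\<dots> = ennreal (\<integral>p. (HMf M j p - Hf j p)\<^sup>2 \<partial>tau4)"
        by (rule nn_integral_eq_integral[OF Hf_L2(2)[OF j]]) simp
      finally show ?thesis by (simp add: HMf_def Hf_def)
    qed
    then show ?thesis
      unfolding L2_conv_T4_def using tendsto_ennrealI[OF Hf_L2(1)[OF j]] by simp
  qed
  have c: "(\<lambda>M. \<integral>\<^sup>+ \<xi>. ennreal ((pair_smooth \<xi> (HM M j) - Z \<xi>)\<^sup>2) \<partial>mu) \<longlonglongrightarrow> 0"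
    if "is_pair_H (Hphi (ebasis j)) Z" for Z
  proof -
    from that have "\<forall>hs. (\<forall>n. admissible (hs n)) \<and> L2_conv_T4 hs (Hphi (ebasis j)) \<longrightarrow>
        (\<lambda>n. \<integral>\<^sup>+ \<xi>. ennreal ((pair_smooth \<xi> (hs n) - Z \<xi>)\<^sup>2) \<partial>mu) \<longlonglongrightarrow> 0"
      unfolding is_pair_H_def by (rule conjunct2)
    from this[THEN spec, of "\<lambda>M. HM M j"] show ?thesis using admissible_HM conv by simp
  qed
  have "(\<integral>\<^sup>+ \<xi>. ennreal ((X \<xi> - Y \<xi>)\<^sup>2) \<partial>mu) \<le> 0"
  proof (rule tendsto_lowerbound)
    show "(\<lambda>M. 2 * (\<integral>\<^sup>+ \<xi>. ennreal ((pair_smooth \<xi> (HM M j) - X \<xi>)\<^sup>2) \<partial>mu)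
        + 2 * (\<integral>\<^sup>+ \<xi>. ennreal ((pair_smooth \<xi> (HM M j) - Y \<xi>)\<^sup>2) \<partial>mu)) \<longlonglongrightarrow> 0"
    proof -
      have "(\<lambda>M. 2 * (\<integral>\<^sup>+ \<xi>. ennreal ((pair_smooth \<xi> (HM M j) - X \<xi>)\<^sup>2) \<partial>mu)
        + 2 * (\<integral>\<^sup>+ \<xi>. ennreal ((pair_smooth \<xi> (HM M j) - Y \<xi>)\<^sup>2) \<partial>mu)) \<longlonglongrightarrow> 2 * 0 + 2 * 0"
        by (intro tendsto_add ennreal_tendsto_cmult c X Y) auto
      then show ?thesis by simp
    qed
    show "\<forall>\<^sub>F M in sequentially. (\<integral>\<^sup>+ \<xi>. ennreal ((X \<xi> - Y \<xi>)\<^sup>2) \<partial>mu)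
        \<le> 2 * (\<integral>\<^sup>+ \<xi>. ennreal ((pair_smooth \<xi> (HM M j) - X \<xi>)\<^sup>2) \<partial>mu)
        + 2 * (\<integral>\<^sup>+ \<xi>. ennreal ((pair_smooth \<xi> (HM M j) - Y \<xi>)\<^sup>2) \<partial>mu)"
    proof (intro always_eventually allI)
      fix M
      show "(\<integral>\<^sup>+ \<xi>. ennreal ((X \<xi> - Y \<xi>)\<^sup>2) \<partial>mu)
        \<le> 2 * (\<integral>\<^sup>+ \<xi>. ennreal ((pair_smooth \<xi> (HM M j) - X \<xi>)\<^sup>2) \<partial>mu)
        + 2 * (\<integral>\<^sup>+ \<xi>. ennreal ((pair_smooth \<xi> (HM M j) - Y \<xi>)\<^sup>2) \<partial>mu)"
        using nn_integral_sq_add_le[of "\<lambda>\<xi>. X \<xi> - pair_smooth \<xi> (HM M j)" mu "\<lambda>\<xi>. pair_smooth \<xi> (HM M j) - Y \<xi>"]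
        by (simp add: power2_commute[of "X _"])
    qed
  qed simp
  then have "(\<integral>\<^sup>+ \<xi>. ennreal ((X \<xi> - Y \<xi>)\<^sup>2) \<partial>mu) = 0" by simp
  then have "AE \<xi> in mu. ennreal ((X \<xi> - Y \<xi>)\<^sup>2) = 0"
    by (subst (asm) nn_integral_0_iff_AE) auto
  then show ?thesis by eventually_elim simp
qed

lemma ex_is_b: "\<exists>B. is_b B"
proof -
  have "\<forall>j\<in>Z2_0. \<exists>X. is_pair_H (Hphi (ebasis j)) X"
  proof
    fix j assume j: "j \<in> Z2_0"
    obtain X e where "X \<in> borel_measurable mu" "e \<longlonglongrightarrow> 0" "\<And>n. 0 \<le> e n"
      "\<And>n. (\<integral>\<^sup>+ \<xi>. ennreal ((wick_sum (Lambda n) (coef (Hf j)) \<xi> - X \<xi>)\<^sup>2) \<partial>mu) \<le> ennreal (e n)"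
      using Hf_chaos_limit[OF j] by blast
    then show "\<exists>X. is_pair_H (Hphi (ebasis j)) X" using is_pair_H_chaos_limit[OF j] by blast
  qed
  then obtain X where X: "\<And>j. j \<in> Z2_0 \<Longrightarrow> is_pair_H (Hphi (ebasis j)) (X j)" by metis
  then have "is_b (\<lambda>j \<xi>. - X j \<xi>)" by (simp add: is_b_def)
  then show ?thesis by blast
qed

lemma bN_error_bound:
  assumes B: "is_b B" and j: "j \<in> Z2_0"
  obtains E where "E \<longlonglongrightarrow> 0" "\<And>N. 0 \<le> E N" "\<And>N. E N \<le> 2 * (\<integral>p. (Hf j p)\<^sup>2 \<partial>tau4)"
    "\<And>N. (\<integral>\<^sup>+ \<xi>. ennreal ((bN N j \<xi> - B j \<xi>)\<^sup>2) \<partial>mu) \<le> ennreal (E N)"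
proof -
  obtain X e where X: "X \<in> borel_measurable mu" and e: "e \<longlonglongrightarrow> 0" "\<And>n. 0 \<le> e n"
    and e_le: "\<And>n. e n \<le> 2 * (\<integral>p. (Hf j p)\<^sup>2 \<partial>tau4)"
    and Xe: "\<And>n. (\<integral>\<^sup>+ \<xi>. ennreal ((wick_sum (Lambda n) (coef (Hf j)) \<xi> - X \<xi>)\<^sup>2) \<partial>mu) \<le> ennreal (e n)"
    using Hf_chaos_limit[OF j] by blast
  have AE: "AE \<xi> in mu. X \<xi> = - B j \<xi>"
    using B j by (intro chaos_limit_unique[OF j _ is_pair_H_chaos_limit[OF j X e Xe]]) (simp add: is_b_def)
  \<comment> \<open>If j is outside \<open>Lambda N\<close>, the coordinate of b_N is 0, which is
    the Wick sum over the empty set \<open>Lambda 0\<close>; the bound \<open>e 0\<close> then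
    applies.\<close>
  define n where "n N = (if j \<in> Lambda N then N else 0)" for N
  have "(\<integral>\<^sup>+ \<xi>. ennreal ((bN N j \<xi> - B j \<xi>)\<^sup>2) \<partial>mu) \<le> ennreal (e (n N))" for N
  proof -
    have bN: "bN N j \<xi> = - wick_sum (Lambda (n N)) (coef (Hf j)) \<xi>" for \<xi>
    proof (cases "j \<in> Lambda N")
      case True
      have "Hf j = (\<lambda>p. Hphi (ebasis j) (fst p) (snd p))" by (simp add: Hf_def[abs_def])
      from pair_quad_eq[OF this borel_measurable_Hf Hf_L2(3)[OF j]]
      have "pair_quad N \<xi> (Hphi (ebasis j)) = wick_sum (Lambda N) (coef (Hf j)) \<xi> + (\<Sum>k\<in>Lambda N. coef (Hf j) (k, k))" .
      moreover have "(\<Sum>k\<in>Lambda N. coef (Hf j) (k, k)) = 0"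
        using Hf_diagonal[OF j] Lambda_subset[of N] by (intro sum.neutral) auto
      ultimately show ?thesis using True by (simp add: bN_def n_def)
    next
      case False
      then show ?thesis by (simp add: bN_def n_def wick_sum_def)
    qed
    have "(\<integral>\<^sup>+ \<xi>. ennreal ((bN N j \<xi> - B j \<xi>)\<^sup>2) \<partial>mu)
        = (\<integral>\<^sup>+ \<xi>. ennreal ((wick_sum (Lambda (n N)) (coef (Hf j)) \<xi> - X \<xi>)\<^sup>2) \<partial>mu)"
    proof (rule nn_integral_cong_AE, use AE in eventually_elim)
      case (elim \<xi>)
      then have "bN N j \<xi> - B j \<xi> = - (wick_sum (Lambda (n N)) (coef (Hf j)) \<xi> - X \<xi>)" by (simp add: bN)
      then show ?case by (simp only: power2_minus)
    qed
    then show ?thesis using Xe by simp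
  qed
  moreover have "(\<lambda>N. e (n N)) \<longlonglongrightarrow> 0"
  proof (rule Lim_transform_eventually[OF e(1)])
    show "\<forall>\<^sub>F N in sequentially. e N = e (n N)"
      using eventually_in_Lambda[OF j] by eventually_elim (simp add: n_def)
  qed
  ultimately show ?thesis using e(2) e_le by (intro that[of "\<lambda>N. e (n N)"]) auto
qed

section \<open>Summation over modes\<close>

lemma nn_integral_Hneg_sq:
  assumes "\<And>j. j \<in> Z2_0 \<Longrightarrow> f j \<in> borel_measurable mu"
  shows "(\<integral>\<^sup>+ \<xi>. Hneg_sq \<delta> (\<lambda>j. f j \<xi>) \<partial>mu)
    = (\<integral>\<^sup>+ j. ennreal (knorm2 j powr (- (2 + \<delta>))) * (\<integral>\<^sup>+ \<xi>. ennreal ((f j \<xi>)\<^sup>2) \<partial>mu) \<partial>count_space Z2_0)"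
proof -
  interpret C: sigma_finite_measure "count_space Z2_0"
    by (rule sigma_finite_measure_count_space_countable) simp
  interpret P: pair_sigma_finite "count_space Z2_0" mu ..
  let ?g = "\<lambda>j \<xi>. ennreal (knorm2 j powr (- (2 + \<delta>)) * (f j \<xi>)\<^sup>2)"
  have "case_prod ?g \<in> borel_measurable (count_space Z2_0 \<Otimes>\<^sub>M mu)"
    using assms by (intro measurable_pair_measure_countable1) auto
  from P.Fubini'[OF this]
  have "(\<integral>\<^sup>+ \<xi>. Hneg_sq \<delta> (\<lambda>j. f j \<xi>) \<partial>mu) = (\<integral>\<^sup>+ j. (\<integral>\<^sup>+ \<xi>. ?g j \<xi> \<partial>mu) \<partial>count_space Z2_0)"
    by (simp add: Hneg_sq_def)
  also have "\<dots> = (\<integral>\<^sup>+ j. ennreal (knorm2 j powr (- (2 + \<delta>))) * (\<integral>\<^sup>+ \<xi>. ennreal ((f j \<xi>)\<^sup>2) \<partial>mu) \<partial>count_space Z2_0)"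
  proof (rule nn_integral_cong)
    fix j assume "j \<in> space (count_space Z2_0)"
    then have [measurable]: "f j \<in> borel_measurable mu" using assms by simp
    show "(\<integral>\<^sup>+ \<xi>. ?g j \<xi> \<partial>mu) = ennreal (knorm2 j powr (- (2 + \<delta>))) * (\<integral>\<^sup>+ \<xi>. ennreal ((f j \<xi>)\<^sup>2) \<partial>mu)"
      by (simp add: ennreal_mult nn_integral_cmult)
  qed
  finally show ?thesis .
qed

lemma borel_measurable_bN:
  assumes "j \<in> Z2_0"
  shows "bN N j \<in> borel_measurable mu"
proof -
  have "Hf j = (\<lambda>p. Hphi (ebasis j) (fst p) (snd p))" by (simp add: Hf_def[abs_def])
  note eq = pair_quad_eq[OF this borel_measurable_Hf Hf_L2(3)[OF assms]]
  have [measurable]: "wick_sum (Lambda N) (coef (Hf j)) \<in> borel_measurable mu"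
    by (rule borel_measurable_wick_sum_mu[OF Lambda_subset])
  show ?thesis unfolding bN_def[abs_def] eq by measurable
qed

lemma weighted_energy_bound:
  assumes "\<delta> > 0"
  obtains K where "0 \<le> K" "\<And>j. j \<in> Z2_0 \<Longrightarrow>
    knorm2 j powr (- (2 + \<delta>)) * (2 * (\<integral>p. (Hf j p)\<^sup>2 \<partial>tau4)) \<le> K * knorm2 j powr (- (1 + \<delta> / 2))"
proof -
  \<comment> \<open>s <= delta / 2 turns the exponent - (2 + delta) + (1 + s) into at most - (1 +
    delta / 2), still below - 1; the cap 1 is the range of the bound on \<open>gam\<close>. The
    constant 128 below is 2 * 8 * 8.\<close>
  define s where "s = min (\<delta> / 2) 1"
  have s: "0 < s" "s \<le> 1" "s \<le> \<delta> / 2" using assms by (auto simp: s_def)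
  define Z where "Z = (\<Sum>\<^sub>\<infinity>k\<in>Z2_0. knorm2 k powr (- (1 + s)))"
  have Z0: "0 \<le> Z" unfolding Z_def by (intro infsum_nonneg) auto
  have "knorm2 j powr (- (2 + \<delta>)) * (2 * (\<integral>p. (Hf j p)\<^sup>2 \<partial>tau4)) \<le> (128 * pi ^ 4 * Z) * knorm2 j powr (- (1 + \<delta> / 2))"
    if j: "j \<in> Z2_0" for j
  proof -
    have "(\<integral>p. (Hf j p)\<^sup>2 \<partial>tau4) \<le> 8 * pi ^ 4 * (8 * Z * knorm2 j powr (1 + s))"
      unfolding Z_def
      by (rule order_trans[OF Hf_L2(4)[OF j] mult_left_mono[OF infsum_gam_sq_le[OF s(1,2)]]]) simp
    then have "knorm2 j powr (- (2 + \<delta>)) * (2 * (\<integral>p. (Hf j p)\<^sup>2 \<partial>tau4))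
        \<le> knorm2 j powr (- (2 + \<delta>)) * (2 * (8 * pi ^ 4 * (8 * Z * knorm2 j powr (1 + s))))"
      by (intro mult_left_mono) auto
    also have "\<dots> = (128 * pi ^ 4 * Z) * (knorm2 j powr (- (2 + \<delta>)) * knorm2 j powr (1 + s))" by simp
    also have "knorm2 j powr (- (2 + \<delta>)) * knorm2 j powr (1 + s) = knorm2 j powr (- (2 + \<delta>) + (1 + s))"
      by (rule powr_add[symmetric])
    also have "(128 * pi ^ 4 * Z) * \<dots> \<le> (128 * pi ^ 4 * Z) * knorm2 j powr (- (1 + \<delta> / 2))"
      using Z0 s knorm2_ge_1[OF j] by (intro mult_left_mono powr_mono) auto
    finally show ?thesis .
  qed
  then show ?thesis using Z0 by (intro that[of "128 * pi ^ 4 * Z"]) auto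
qed

lemma nn_integral_knorm2_powr_finite:
  fixes a :: real
  assumes "a > 1"
  shows "(\<integral>\<^sup>+ j. ennreal (K * knorm2 j powr (- a)) \<partial>count_space Z2_0) < \<infinity>"
proof -
  have "(\<lambda>j. K * knorm2 j powr (- a)) summable_on Z2_0"
    by (intro summable_on_cmult_right summable_on_knorm2_powr assms)
  then have "(\<lambda>j. norm (K * knorm2 j powr (- a))) summable_on Z2_0"
    by (rule summable_on_iff_abs_summable_on_real[THEN iffD1])
  then have "integrable (count_space Z2_0) (\<lambda>j. K * knorm2 j powr (- a))"
    by (rule abs_summable_equivalent[THEN iffD1, unfolded Infinite_Set_Sum.abs_summable_on_def])
  from integrableD(2)[OF this] show ?thesis by (simp add: top.not_eq_extremum)
qed

theorem mainTheorem18: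
  fixes \<delta> :: real
  assumes "\<delta> > 0"
  shows "(\<exists>B. is_b B) \<and>
    (\<forall>B. is_b B \<longrightarrow>
       (\<lambda>N. \<integral>\<^sup>+ \<xi>. Hneg_sq \<delta> (\<lambda>j. bN N j \<xi> - B j \<xi>) \<partial>mu) \<longlonglongrightarrow> 0 \<and>
       (\<integral>\<^sup>+ \<xi>. Hneg_sq \<delta> (\<lambda>j. B j \<xi>) \<partial>mu) < \<infinity>)"
proof (intro conjI allI impI)
  show "\<exists>B. is_b B" by (rule ex_is_b)
next
  fix B assume B: "is_b B"
  have Bm: "B j \<in> borel_measurable mu" if "j \<in> Z2_0" for j
  proof -
    have "(\<lambda>\<xi>. - B j \<xi>) \<in> borel_measurable mu" using B that by (simp add: is_b_def is_pair_H_def)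
    then have "(\<lambda>\<xi>. - (- B j \<xi>)) \<in> borel_measurable mu" by (rule borel_measurable_uminus)
    then show ?thesis by simp
  qed
  obtain K where K: "0 \<le> K" "\<And>j. j \<in> Z2_0 \<Longrightarrow>
    knorm2 j powr (- (2 + \<delta>)) * (2 * (\<integral>p. (Hf j p)\<^sup>2 \<partial>tau4)) \<le> K * knorm2 j powr (- (1 + \<delta> / 2))"
    by (rule weighted_energy_bound[OF assms]) (rule that; blast)
  let ?w = "\<lambda>j. knorm2 j powr (- (2 + \<delta>))"
  define v where "v j = ennreal (K * knorm2 j powr (- (1 + \<delta> / 2)))" for j
  define u where "u N j = ennreal (?w j) * (\<integral>\<^sup>+ \<xi>. ennreal ((bN N j \<xi> - B j \<xi>)\<^sup>2) \<partial>mu)" for N j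
  have u_eq: "(\<integral>\<^sup>+ \<xi>. Hneg_sq \<delta> (\<lambda>j. bN N j \<xi> - B j \<xi>) \<partial>mu) = (\<integral>\<^sup>+ j. u N j \<partial>count_space Z2_0)" for N
    unfolding u_def by (intro nn_integral_Hneg_sq borel_measurable_diff borel_measurable_bN Bm)
  have u: "u N j \<le> v j" "(\<lambda>N. u N j) \<longlonglongrightarrow> 0" if j: "j \<in> Z2_0" for N j
  proof -
    obtain E where E: "E \<longlonglongrightarrow> 0" "\<And>N. 0 \<le> E N" "\<And>N. E N \<le> 2 * (\<integral>p. (Hf j p)\<^sup>2 \<partial>tau4)"
      "\<And>N. (\<integral>\<^sup>+ \<xi>. ennreal ((bN N j \<xi> - B j \<xi>)\<^sup>2) \<partial>mu) \<le> ennreal (E N)"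
      by (rule bN_error_bound[OF B j]) (rule that; blast)
    have le: "u N j \<le> ennreal (?w j * E N)" for N
      unfolding u_def using E(2)[of N] E(4)[of N] by (simp add: ennreal_mult mult_left_mono)
    also have "?w j * E N \<le> ?w j * (2 * (\<integral>p. (Hf j p)\<^sup>2 \<partial>tau4))"
      by (intro mult_left_mono E(3)) simp
    also note K(2)[OF j]
    finally show "u N j \<le> v j"
      by (simp add: v_def ennreal_leI)
    have "(\<lambda>N. ?w j * E N) \<longlonglongrightarrow> 0" by (rule tendsto_mult_right_zero[OF E(1)])
    from tendsto_ennrealI[OF this] have lim: "(\<lambda>N. ennreal (?w j * E N)) \<longlonglongrightarrow> 0" by simp
    show "(\<lambda>N. u N j) \<longlonglongrightarrow> 0"
      by (rule tendsto_sandwich[OF _ _ tendsto_const lim]) (use le in auto)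
  qed
  have fin: "(\<integral>\<^sup>+ j. v j \<partial>count_space Z2_0) < \<infinity>"
    unfolding v_def using assms by (intro nn_integral_knorm2_powr_finite) simp
  have "(\<lambda>N. \<integral>\<^sup>+ j. u N j \<partial>count_space Z2_0) \<longlonglongrightarrow> (\<integral>\<^sup>+ j. 0 \<partial>count_space Z2_0)"
    by (rule nn_integral_dominated_convergence[OF _ _ _ _ fin]) (auto simp: AE_count_space u)
  then show "(\<lambda>N. \<integral>\<^sup>+ \<xi>. Hneg_sq \<delta> (\<lambda>j. bN N j \<xi> - B j \<xi>) \<partial>mu) \<longlonglongrightarrow> 0"
    unfolding u_eq by simp
  \<comment> \<open>b_0 vanishes, so b is up to sign the error at N = 0 and the same majorant
    \<open>v\<close> bounds its norm.\<close>
  have "Hneg_sq \<delta> (\<lambda>j. B j \<xi>) = Hneg_sq \<delta> (\<lambda>j. bN 0 j \<xi> - B j \<xi>)" for \<xi>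
    unfolding Hneg_sq_def by (simp add: bN_def)
  then have "(\<integral>\<^sup>+ \<xi>. Hneg_sq \<delta> (\<lambda>j. B j \<xi>) \<partial>mu) = (\<integral>\<^sup>+ j. u 0 j \<partial>count_space Z2_0)"
    using u_eq[of 0] by simp
  also have "\<dots> \<le> (\<integral>\<^sup>+ j. v j \<partial>count_space Z2_0)"
    using u(1) by (intro nn_integral_mono) auto
  also note fin
  finally show "(\<integral>\<^sup>+ \<xi>. Hneg_sq \<delta> (\<lambda>j. B j \<xi>) \<partial>mu) < \<infinity>" .
qed

end
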